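(* Let $k\ge 1$ be an integer. There are constants $c_1,c_2>0$ (which may depend on $k$ but not on $d$ or $n$) such that for all integers $d>k$ and $n\geq c_1d$ the following holds. If $V_1,\dots,V_n\in\mathcal{G}_{k,d}$ are chosen independently, identically distributed according to $\sigma_k$, then with probability at least $1-e^{-c_2n}$ it holds simultaneously for all $x\in\mathbb{R}^d$ that the matrix $xx^*$ is the unique solution $X$ of the feasibility problem $$\text{find } X\in\mathscr{H}\quad\text{subject to}\quad \mathcal{F}_n(X)=\mathcal{F}_n(xx^* ),\quad X\succeq 0 .$$
   Context: $\mathcal{G}_{k,d}$ is the real Grassmann space of $k$-dimensional linear subspaces of $\mathbb{R}^d$, and $\sigma_k$ is the probability measure on it induced by the Haar measure on $O(\mathbb{R}^d)$. $P_V$ is the orthogonal projector onto $V$. $\mathscr{H}$ is the space of symmetric matrices in $\mathbb{R}^{d\times d}$ with inner product $\langle A,B\rangle=\operatorname{trace}(AB)$, and $X\succeq0$ means $X$ is positive semidefinite. For given $V_1,\dots,V_n\in\mathcal{G}_{k,d}$, $$\mathcal{F}_n:\mathscr{H}\to\mathbb{R}^n,\qquad X\mapsto\frac{d}{k}\big(\langle X,P_{V_j}\rangle\big)_{j=1}^n,$$ so that $\mathcal{F}_n(xx^* )=\frac dk(\|P_{V_j}(x)\|^2)_{j=1}^n$. *)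

theory Defs
  imports
    "HOL-Probability.Probability"
    "Jordan_Normal_Form.VS_Connect"
begin

(* The dimension d has to vary inside the statement, below constants that do not depend on it.
   R^d and R^(d x d) are therefore carrier_vec d and carrier_mat d d. *)

no_notation vec_nth (infixl "$" 90)
no_notation inner (infix "\<bullet>" 70)
no_notation fps_nth (infixl "$" 75)

definition trace_mat :: "real mat \<Rightarrow> real" where
  "trace_mat A = (\<Sum>i<dim_row A. A $$ (i, i))"

text \<open>The space \<open>\<H>\<close> of symmetric matrices, and its inner product.\<close>

definition sym_mats :: "nat \<Rightarrow> real mat set" where
  "sym_mats d = {X \<in> carrier_mat d d. transpose_mat X = X}"

definition mat_inner :: "real mat \<Rightarrow> real mat \<Rightarrow> real" where
  "mat_inner A B = trace_mat (A * B)"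

definition psd :: "real mat \<Rightarrow> bool" where
  "psd X \<longleftrightarrow> (\<forall>v\<in>carrier_vec (dim_col X). 0 \<le> v \<bullet> (X *\<^sub>v v))"

definition outer_prod :: "real vec \<Rightarrow> real mat" where
  "outer_prod x = Matrix.mat (dim_vec x) (dim_vec x) (\<lambda>(i, j). x $ i * x $ j)"

definition grassmannian :: "nat \<Rightarrow> nat \<Rightarrow> real vec set set" where
  "grassmannian k d = {V. VectorSpace.subspace class_ring V (module_vec TYPE(real) d)
      \<and> vectorspace.dim class_ring ((module_vec TYPE(real) d)\<lparr>carrier := V\<rparr>) = k}"

definition proj_mat :: "nat \<Rightarrow> real vec set \<Rightarrow> real mat" where
  "proj_mat d V = (THE P. P \<in> carrier_mat d d \<and>
      (\<forall>x\<in>carrier_vec d. P *\<^sub>v x \<in> V \<and> (\<forall>v\<in>V. (x - P *\<^sub>v x) \<bullet> v = 0)))"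

text \<open>The map \<open>\<F>\<^sub>n\<close>, for subspaces \<open>V 0, \<dots>, V (n - 1)\<close>.\<close>

definition meas_map :: "nat \<Rightarrow> nat \<Rightarrow> nat \<Rightarrow> (nat \<Rightarrow> real vec set) \<Rightarrow> real mat \<Rightarrow> real vec" where
  "meas_map k d n V X =
     Matrix.vec n (\<lambda>j. real d / real k * mat_inner X (proj_mat d (V j)))"

definition feasible_set ::
  "nat \<Rightarrow> nat \<Rightarrow> nat \<Rightarrow> (nat \<Rightarrow> real vec set) \<Rightarrow> real vec \<Rightarrow> real mat set" where
  "feasible_set k d n V x =
     {X \<in> sym_mats d. meas_map k d n V X = meas_map k d n V (outer_prod x) \<and> psd X}"

text \<open>The Borel \<open>\<sigma>\<close>-algebra of \<open>d \<times> d\<close> matrices is generated by the matrix entries.\<close>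

definition borel_mat :: "nat \<Rightarrow> real mat measure" where
  "borel_mat d = sigma (carrier_mat d d)
     {{A \<in> carrier_mat d d. A $$ (i, j) \<in> S} | i j S. i < d \<and> j < d \<and> S \<in> sets borel}"

definition orthogonal_group :: "nat \<Rightarrow> real mat set" where
  "orthogonal_group d = {U \<in> carrier_mat d d. transpose_mat U * U = 1\<^sub>m d}"

text \<open>The (normalized) Haar measure on \<open>O(d)\<close>: the left-invariant Borel probability measure,
  which exists and is unique because \<open>O(d)\<close> is a compact group.\<close>

definition haar_orthogonal :: "nat \<Rightarrow> real mat measure \<Rightarrow> bool" where
  "haar_orthogonal d \<mu> \<longleftrightarrow> prob_space \<mu>
     \<and> space \<mu> = orthogonal_group d
     \<and> sets \<mu> = sets (restrict_space (borel_mat d) (orthogonal_group d))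
     \<and> (\<forall>A\<in>orthogonal_group d. distr \<mu> \<mu> (\<lambda>U. A * U) = \<mu>)"

text \<open>The Borel structure of the Grassmannian comes from the embedding \<open>V \<mapsto> P\<^sub>V\<close>, which is a
  homeomorphism onto its image. (The measure of this measure space is irrelevant.)\<close>

definition grassmann_space :: "nat \<Rightarrow> nat \<Rightarrow> real vec set measure" where
  "grassmann_space k d = vimage_algebra (grassmannian k d) (proj_mat d) (borel_mat d)"

definition coord_subspace :: "nat \<Rightarrow> nat \<Rightarrow> real vec set" where
  "coord_subspace k d = {v \<in> carrier_vec d. \<forall>i<d. k \<le> i \<longrightarrow> v $ i = 0}"

text \<open>The measure \<open>\<sigma>\<^sub>k\<close>: the image of the Haar measure \<open>\<mu>\<close> under \<open>U \<mapsto> U V\<^sub>0\<close>. By invariance of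
  \<open>\<mu>\<close>, every \<open>k\<close>-dimensional \<open>V\<^sub>0\<close> gives the same measure.\<close>

definition grassmann_measure :: "nat \<Rightarrow> nat \<Rightarrow> real mat measure \<Rightarrow> real vec set measure" where
  "grassmann_measure k d \<mu> =
     distr \<mu> (grassmann_space k d) (\<lambda>U. (\<lambda>v. U *\<^sub>v v) ` coord_subspace k d)"

end

(* Write a(z) = (d/k) |P z|^2 for the random projector P; then E a(z) = 1 for unit vectors z. If X is
   positive semidefinite with the same measurements as x x^T, then H = X - x x^T has at most one negative
   eigenvalue, so unless H is positive semidefinite, H = sum_m g_m g_m^T - lam z z^T with lam > 0, z a unit
   vector and all g_m orthogonal to z. Put phi = c - min(a(z), B) and Y(g) = sum_j phi_j(z) a_j(g). As the
   measurements of H vanish, sum_m Y(g_m) = lam Y(z). Since E a(z)^2 > 1 while E a(z) a(y) <= 1 for orthonormal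
   z and y, a suitable c > 1 and a large B give E Y(z) < 0 < E Y(y); once this holds for the empirical sums,
   simultaneously for all z and y, it forces H = 0.

   Uniformity over z and y needs only n >= c_1 d: a(z) has exponential moments bounded independently of d, so a
   net of the ball with K^d points controls sup_z sum_j a_j(z), and then, as the root of a is a seminorm, the
   empirical means of every bounded Lipschitz function of (a(z), a(y)). The part of a(y) above a truncation
   level is controlled by comparing its full mean with its truncated mean. *)

theory Submission
  imports Defs
begin

section \<open>Rademacher sums and nets\<close>

text \<open>The obstacle is that a product a(z) a(y) has no exponential moment bounded independently
  of d, so a net of K^d points cannot control its empirical means when n is only proportional to d.
  Every quantity that needs two-sided control is therefore truncated, and what is cut off enters
  only through sums of a(y), whose root is a seminorm. The bounded weight makes this affordable: the
  part of a(y) above the truncation level is multiplied by at most B. All constants come from one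
  gap that survives as d grows: E a(z)^2 - 1 = 2 (d - k) / (k (d + 2)) is smallest at d = k + 1,
  where it is 2 / (k (k + 3)). The estimates are made for orthogonal matrices U, with V the span of
  the first k columns, and are transported to the Grassmannian by a push-forward. There the recovery
  event itself has to be measurable, since a set outside the \<sigma>-algebra would be assigned
  measure zero, although it is defined by quantifiers over uncountably many x and X.\<close>

lemma two_power_fact_le: "2 ^ n * fact n \<le> (fact (2 * n) :: real)"
proof (induction n)
  case (Suc n)
  have "2 ^ Suc n * fact (Suc n) = (2 * real (Suc n)) * (2 ^ n * fact n)"
    by (simp add: algebra_simps)
  also have "\<dots> \<le> (2 * real (Suc n)) * fact (2 * n)"
    using Suc by (intro mult_left_mono) auto
  also have "\<dots> \<le> (real (2 * n + 2) * real (2 * n + 1)) * fact (2 * n)"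
    by (intro mult_right_mono) (auto simp: algebra_simps)
  also have "\<dots> = fact (2 * Suc n)"
    by (simp add: algebra_simps)
  finally show ?case .
qed simp

text \<open>Termwise comparison of power series: the coefficients of x^(2n) are 1 / (2n)! and 1 /
  (2^n n!). As \<open>cosh x\<close> is the exponential moment of a random sign, this is the
  sub-Gaussian bound for one sign.\<close>

lemma cosh_le_exp_square: "cosh (x :: real) \<le> exp (x\<^sup>2 / 2)"
proof -
  let ?f = "\<lambda>n. if even n then x ^ n /\<^sub>R fact n else 0"
  have "?f sums cosh x" by (rule cosh_converges)
  moreover have "strict_mono ((*) (2 :: nat))" by (auto simp: strict_mono_def)
  ultimately have "(\<lambda>n. ?f (2 * n)) sums cosh x"
    by (subst sums_mono_reindex) (auto elim!: evenE)
  moreover have "(\<lambda>n. (x\<^sup>2 / 2) ^ n /\<^sub>R fact n) sums exp (x\<^sup>2 / 2)"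
    by (rule exp_converges)
  moreover have "?f (2 * n) \<le> (x\<^sup>2 / 2) ^ n /\<^sub>R fact n" for n
  proof -
    have "?f (2 * n) = (x\<^sup>2) ^ n / fact (2 * n)"
      by (simp add: power_mult divide_inverse)
    also have "\<dots> \<le> (x\<^sup>2) ^ n / (2 ^ n * fact n)"
      by (intro divide_left_mono two_power_fact_le) auto
    also have "\<dots> = (x\<^sup>2 / 2) ^ n /\<^sub>R fact n"
      unfolding real_scaleR_def power_divide by (simp add: field_simps)
    finally show ?thesis .
  qed
  ultimately show ?thesis by (rule sums_le[rotated 1])
qed

definition signs :: "nat \<Rightarrow> (nat \<Rightarrow> real) set" where
  "signs d = PiE {..<d} (\<lambda>_. {-1, 1})"

lemma finite_signs [simp]: "finite (signs d)"
  unfolding signs_def by (intro finite_PiE) auto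

lemma card_signs: "card (signs d) = 2 ^ d"
  unfolding signs_def by (subst card_PiE) (auto simp: numeral_2_eq_2)

lemma signs_square: "\<epsilon> \<in> signs d \<Longrightarrow> i < d \<Longrightarrow> (\<epsilon> i)\<^sup>2 = 1"
  by (auto simp: signs_def PiE_iff dest!: bspec[of _ _ i])

lemma sum_signs_Suc:
  "(\<Sum>\<epsilon>\<in>signs (Suc d). F \<epsilon>) = (\<Sum>\<epsilon>\<in>signs d. F (\<epsilon>(d := 1)) + F (\<epsilon>(d := -1)))"
  for F :: "(nat \<Rightarrow> real) \<Rightarrow> real"
proof -
  have inj: "inj_on (\<lambda>(y, \<epsilon>). \<epsilon>(d := y)) ({-1, 1} \<times> signs d)"
    using inj_combinator[of d "{..<d}" "\<lambda>_. {-1, 1::real}"] by (simp add: signs_def)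
  have "signs (Suc d) = (\<lambda>(y, \<epsilon>). \<epsilon>(d := y)) ` ({-1, 1} \<times> signs d)"
    unfolding signs_def lessThan_Suc by (rule PiE_insert_eq)
  then have "(\<Sum>\<epsilon>\<in>signs (Suc d). F \<epsilon>) = sum (F \<circ> (\<lambda>(y, \<epsilon>). \<epsilon>(d := y))) ({-1, 1} \<times> signs d)"
    by (simp only: sum.reindex[OF inj])
  also have "\<dots> = (\<Sum>(y, \<epsilon>)\<in>{-1, 1} \<times> signs d. F (\<epsilon>(d := y)))"
    by (intro sum.cong) auto
  also have "\<dots> = (\<Sum>y\<in>{-1, 1}. \<Sum>\<epsilon>\<in>signs d. F (\<epsilon>(d := y)))"
    by (rule sum.cartesian_product[symmetric])
  finally show ?thesis by (simp add: sum.distrib add.commute)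
qed

text \<open>Replacing a summand \<open>u \<epsilon>\<close> by \<open>u\<^sup>2\<close> turns the parameter \<open>t\<close> into at most \<open>t / (1 - 2 t u\<^sup>2)\<close>,
  and these moves add up: \<open>1 / t\<close> decreases by \<open>2 u\<^sup>2\<close> each time.\<close>

lemma sum_signs_exp_square_le:
  fixes u :: "nat \<Rightarrow> real"
  assumes "0 \<le> t" "2 * t * (\<Sum>l<d. (u l)\<^sup>2) < 1"
  shows "(\<Sum>\<epsilon>\<in>signs d. exp (t * (b + (\<Sum>l<d. u l * \<epsilon> l))\<^sup>2))
    \<le> 2 ^ d * exp (t / (1 - 2 * t * (\<Sum>l<d. (u l)\<^sup>2)) * (b\<^sup>2 + (\<Sum>l<d. (u l)\<^sup>2)))"
  using assms(2)
proof (induction d arbitrary: b)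
  case 0
  then show ?case by (simp add: signs_def)
next
  case (Suc d)
  define s where "s = (\<Sum>l<d. (u l)\<^sup>2)"
  define v where "v = u d"
  define p where "p = 1 - 2 * t * s"
  define w where "w = 2 * t * v\<^sup>2"
  define T where "T = t / p"
  have sum_Suc: "(\<Sum>l<Suc d. (u l)\<^sup>2) = s + v\<^sup>2" by (simp add: s_def v_def)
  have w0: "0 \<le> w" using \<open>0 \<le> t\<close> by (simp add: w_def)
  have pw: "0 < p - w" using Suc.prems unfolding sum_Suc p_def w_def by (simp add: algebra_simps)
  then have p0: "0 < p" using w0 by simp
  have IH: "(\<Sum>\<epsilon>\<in>signs d. exp (t * (c + (\<Sum>l<d. u l * \<epsilon> l))\<^sup>2)) \<le> 2 ^ d * exp (T * (c\<^sup>2 + s))" for c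
    using Suc.IH[of c] p0 unfolding T_def p_def s_def by simp
  have T0: "0 \<le> T" using p0 \<open>0 \<le> t\<close> by (simp add: T_def)
  \<comment> \<open>This is p^2 - w^2 \<le> p^2 divided by p^2 (p - w), with T = t / p and w = 2 t
    v^2.\<close>
  have step: "T + 2 * T\<^sup>2 * v\<^sup>2 \<le> t / (p - w)"
  proof -
    have "T + 2 * T\<^sup>2 * v\<^sup>2 = t * ((p + w) / p\<^sup>2)"
      using p0 by (simp add: T_def w_def field_simps power2_eq_square)
    also have "(p + w) / p\<^sup>2 \<le> 1 / (p - w)"
      using p0 pw w0 by (simp add: field_simps power2_eq_square)
    then have "t * ((p + w) / p\<^sup>2) \<le> t * (1 / (p - w))"
      using \<open>0 \<le> t\<close> by (intro mult_left_mono)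
    finally show ?thesis by simp
  qed
  have split: "(\<Sum>l<Suc d. u l * (\<epsilon>(d := y)) l) = v * y + (\<Sum>l<d. u l * \<epsilon> l)" for \<epsilon> y
    by (simp add: v_def)
  have "(\<Sum>\<epsilon>\<in>signs (Suc d). exp (t * (b + (\<Sum>l<Suc d. u l * \<epsilon> l))\<^sup>2))
      = (\<Sum>\<epsilon>\<in>signs d. exp (t * ((b + v) + (\<Sum>l<d. u l * \<epsilon> l))\<^sup>2))
      + (\<Sum>\<epsilon>\<in>signs d. exp (t * ((b - v) + (\<Sum>l<d. u l * \<epsilon> l))\<^sup>2))"
    unfolding sum_signs_Suc split by (simp add: sum.distrib algebra_simps)
  also have "\<dots> \<le> 2 ^ d * exp (T * ((b + v)\<^sup>2 + s)) + 2 ^ d * exp (T * ((b - v)\<^sup>2 + s))"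
    by (intro add_mono IH)
  \<comment> \<open>The last sign shifts b to b + v or b - v; the two cross terms combine to a
    \<open>cosh\<close>, whose bound costs the extra exponent 2 T^2 v^2 b^2.\<close>
  also have "\<dots> = 2 ^ d * (exp (T * (b\<^sup>2 + v\<^sup>2 + s)) * (2 * cosh (2 * T * b * v)))"
    by (simp add: cosh_field_def power2_eq_square algebra_simps flip: exp_add)
  also have "\<dots> \<le> 2 ^ d * (exp (T * (b\<^sup>2 + v\<^sup>2 + s)) * (2 * exp ((2 * T * b * v)\<^sup>2 / 2)))"
    by (intro mult_left_mono cosh_le_exp_square) auto
  also have "\<dots> = 2 ^ Suc d * exp (T * (b\<^sup>2 + v\<^sup>2 + s) + 2 * T\<^sup>2 * v\<^sup>2 * b\<^sup>2)"
    by (simp add: exp_add power_mult_distrib algebra_simps)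
  also have "\<dots> \<le> 2 ^ Suc d * exp ((T + 2 * T\<^sup>2 * v\<^sup>2) * (b\<^sup>2 + v\<^sup>2 + s))"
  proof -
    have "0 \<le> s" by (simp add: s_def sum_nonneg)
    then have "2 * T\<^sup>2 * v\<^sup>2 * b\<^sup>2 \<le> 2 * T\<^sup>2 * v\<^sup>2 * (b\<^sup>2 + v\<^sup>2 + s)"
      by (intro mult_left_mono) auto
    then show ?thesis by (simp add: algebra_simps)
  qed
  also have "\<dots> \<le> 2 ^ Suc d * exp (t / (p - w) * (b\<^sup>2 + v\<^sup>2 + s))"
  proof -
    have "0 \<le> b\<^sup>2 + v\<^sup>2 + s" by (simp add: s_def sum_nonneg)
    then show ?thesis using mult_right_mono[OF step] by simp
  qed
  also have "p - w = 1 - 2 * t * (s + v\<^sup>2)" by (simp add: p_def w_def algebra_simps)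
  finally show ?case unfolding sum_Suc by (simp add: add.assoc add.left_commute add.commute)
qed

section \<open>Lattice nets of the Euclidean ball\<close>

text \<open>The two-sided geometric series of ratio 1/2 has sum 3; keeping the tail term makes the
  induction close.\<close>

lemma sum_half_powers_le: "(\<Sum>j\<in>{- int M..int M}. (1 / 2 :: real) ^ nat \<bar>j\<bar>) \<le> 3 - 2 * (1 / 2) ^ M"
proof (induction M)
  case (Suc M)
  have "{- int (Suc M)..int (Suc M)} = insert (int (Suc M)) (insert (- int (Suc M)) {- int M..int M})"
    by auto
  then have "(\<Sum>j\<in>{- int (Suc M)..int (Suc M)}. (1 / 2 :: real) ^ nat \<bar>j\<bar>)
      = (1 / 2) ^ Suc M + ((1 / 2) ^ Suc M + (\<Sum>j\<in>{- int M..int M}. (1 / 2) ^ nat \<bar>j\<bar>))"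
    by (simp add: nat_add_distrib)
  then show ?case using Suc by simp
qed simp

text \<open>Give the point m the weight 2^(-|m|_1). Each point of \<open>I\<close> weighs at least
  2^(-R), while the weights of the whole box factorise over the coordinates into at most 3^d. The
  box makes the set finite, and the bound is independent of its size.\<close>

lemma card_int_l1_ball_le:
  fixes d M :: nat and R :: real
  defines "I \<equiv> {m \<in> PiE {..<d} (\<lambda>_. {- int M..int M}). real_of_int (\<Sum>i<d. \<bar>m i\<bar>) \<le> R}"
  shows "finite I" "real (card I) \<le> 3 ^ d * 2 powr R"
proof -
  have finP: "finite (PiE {..<d} (\<lambda>_. {- int M..int M}))" by (intro finite_PiE) auto
  then show fin: "finite I" unfolding I_def by auto
  have w: "(\<Prod>i<d. (1 / 2 :: real) ^ nat \<bar>m i\<bar>) \<ge> 2 powr (- R)" if "m \<in> I" for m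
  proof -
    have "(\<Prod>i<d. (1 / 2 :: real) ^ nat \<bar>m i\<bar>) = (1 / 2) ^ (\<Sum>i<d. nat \<bar>m i\<bar>)"
      by (simp add: power_sum)
    also have "\<dots> = 2 powr (- real (\<Sum>i<d. nat \<bar>m i\<bar>))"
      by (simp add: powr_minus powr_realpow power_one_over inverse_eq_divide del: of_nat_sum)
    also have "real (\<Sum>i<d. nat \<bar>m i\<bar>) = real_of_int (\<Sum>i<d. \<bar>m i\<bar>)" by simp
    finally show ?thesis using that by (simp add: I_def)
  qed
  have "real (card I) * 2 powr (- R) = (\<Sum>m\<in>I. 2 powr (- R))" by simp
  also have "\<dots> \<le> (\<Sum>m\<in>I. \<Prod>i<d. (1 / 2 :: real) ^ nat \<bar>m i\<bar>)" by (intro sum_mono w)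
  also have "\<dots> \<le> (\<Sum>m\<in>PiE {..<d} (\<lambda>_. {- int M..int M}). \<Prod>i<d. (1 / 2 :: real) ^ nat \<bar>m i\<bar>)"
  proof (rule sum_mono2[OF finP])
    show "I \<subseteq> PiE {..<d} (\<lambda>_. {- int M..int M})" unfolding I_def by blast
    show "0 \<le> (\<Prod>i<d. (1 / 2 :: real) ^ nat \<bar>m i\<bar>)" for m :: "nat \<Rightarrow> int"
      by (rule prod_nonneg) simp
  qed
  also have "\<dots> = (\<Prod>i<d. \<Sum>j\<in>{- int M..int M}. (1 / 2 :: real) ^ nat \<bar>j\<bar>)"
    by (subst prod_sum_PiE) auto
  also have "\<dots> \<le> (\<Prod>i<d. 3)"
  proof (intro prod_mono conjI sum_nonneg)
    show "(\<Sum>j\<in>{- int M..int M}. (1 / 2 :: real) ^ nat \<bar>j\<bar>) \<le> 3"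
      by (rule order.trans[OF sum_half_powers_le]) simp
  qed auto
  finally have "real (card I) * 2 powr (- R) \<le> 3 ^ d" by simp
  then show "real (card I) \<le> 3 ^ d * 2 powr R"
    by (simp add: powr_minus field_simps)
qed

lemma sum_abs_le_sqrt_L2_set: "(\<Sum>i<d. \<bar>x i\<bar>) \<le> sqrt (real d) * L2_set x {..<d}"
proof -
  have "(\<Sum>i<d. \<bar>x i\<bar>) = (\<Sum>i<d. \<bar>1\<bar> * \<bar>x i\<bar>)" by simp
  also have "\<dots> \<le> L2_set (\<lambda>_. 1) {..<d} * L2_set x {..<d}" by (rule L2_set_mult_ineq)
  finally show ?thesis by (simp add: L2_set_constant)
qed

text \<open>The net is the part of the lattice (\<eta> / sqrt d) Z^d in the unit ball. By
  Cauchy-Schwarz the integer coordinates of such points have l1 norm at most d / \<eta>, so the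
  count of lattice points yields 3^d 2^(d/\<eta>), a d-th power.\<close>

lemma unit_ball_net:
  fixes \<eta> :: real
  assumes "\<eta> > 0"
  obtains K :: real where "K \<ge> 1"
    "\<And>d. \<exists>N :: (nat \<Rightarrow> real) set. finite N \<and> real (card N) \<le> K ^ d \<and> (\<forall>v\<in>N. L2_set v {..<d} \<le> 1) \<and>
      (\<forall>x. L2_set x {..<d} \<le> 1 \<longrightarrow> (\<exists>v\<in>N. L2_set (\<lambda>i. x i - v i) {..<d} \<le> \<eta>))"
proof
  let ?K = "3 * 2 powr (1 / \<eta>) :: real"
  have "1 \<le> (2 :: real) powr (1 / \<eta>)" using assms by (intro ge_one_powr_ge_zero) auto
  then show "1 \<le> ?K" by linarith
  fix d :: nat
  define M where "M = nat \<lfloor>real d / \<eta>\<rfloor>"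
  define I where "I = {m \<in> PiE {..<d} (\<lambda>_. {- int M..int M}). real_of_int (\<Sum>i<d. \<bar>m i\<bar>) \<le> real d / \<eta>}"
  define g where "g = (\<lambda>(m :: nat \<Rightarrow> int) i. \<eta> / sqrt (real d) * real_of_int (m i))"
  define N where "N = {v \<in> g ` I. L2_set v {..<d} \<le> 1}"
  note I = card_int_l1_ball_le[of d M "real d / \<eta>", folded I_def]
  have "card N \<le> card I"
    using I(1) card_image_le[OF I(1), of g] card_mono[of "g ` I" N] by (simp add: N_def) 
  then have "real (card N) \<le> 3 ^ d * 2 powr (real d / \<eta>)" using I(2) by linarith
  also have "\<dots> = ?K ^ d"
    by (simp add: power_mult_distrib powr_powr flip: powr_realpow)
  finally have card: "real (card N) \<le> ?K ^ d" .
  have "\<exists>v\<in>N. L2_set (\<lambda>i. x i - v i) {..<d} \<le> \<eta>" if x: "L2_set x {..<d} \<le> 1" for x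
  proof (cases "d = 0")
    case True
    \<comment> \<open>The extensional function space over the empty index set has this single
      element.\<close>
    have "(\<lambda>_. undefined) \<in> I" using True assms by (simp add: I_def)
    then have "g (\<lambda>_. undefined) \<in> N" using True by (simp add: N_def)
    then show ?thesis using True assms by (intro bexI[of _ "g (\<lambda>_. undefined)"]) auto
  next
    case False
    define q where "q = (\<lambda>i. sqrt (real d) / \<eta> * x i)"
    \<comment> \<open>Rounding towards zero: no coordinate grows in absolute value, so the rounded
      point stays in the ball, and each coordinate of x moves by at most \<eta> / sqrt d.\<close>
    define m where "m = (\<lambda>i\<in>{..<d}. if q i \<ge> 0 then \<lfloor>q i\<rfloor> else \<lceil>q i\<rceil>)"
    have m_le: "\<bar>real_of_int (m i)\<bar> \<le> \<bar>q i\<bar>" "\<bar>q i - real_of_int (m i)\<bar> \<le> 1" if "i < d" for i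
      using that by (auto simp: m_def) linarith+
    have xq: "x i = \<eta> / sqrt (real d) * q i" for i using False assms by (simp add: q_def)
    have abs_g: "\<bar>g m i\<bar> \<le> \<bar>x i\<bar>" if "i < d" for i
      unfolding g_def xq abs_mult using m_le(1)[OF that] by (intro mult_left_mono) auto
    have "(\<Sum>i<d. \<bar>q i\<bar>) = sqrt (real d) / \<eta> * (\<Sum>i<d. \<bar>x i\<bar>)"
      using assms by (simp add: q_def sum_distrib_left abs_mult)
    also have "\<dots> \<le> sqrt (real d) / \<eta> * (sqrt (real d) * 1)"
      using assms x
      by (intro mult_left_mono order.trans[OF sum_abs_le_sqrt_L2_set]) auto
    finally have sum_q: "(\<Sum>i<d. \<bar>q i\<bar>) \<le> real d / \<eta>" by simp
    have "real_of_int (\<Sum>i<d. \<bar>m i\<bar>) = (\<Sum>i<d. \<bar>real_of_int (m i)\<bar>)" by simp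
    also have "\<dots> \<le> (\<Sum>i<d. \<bar>q i\<bar>)" by (intro sum_mono m_le) auto
    finally have sum_m: "real_of_int (\<Sum>i<d. \<bar>m i\<bar>) \<le> real d / \<eta>" using sum_q by linarith
    have "m i \<in> {- int M..int M}" if "i < d" for i
    proof -
      have "\<bar>m i\<bar> \<le> (\<Sum>i<d. \<bar>m i\<bar>)" using that by (intro member_le_sum) auto
      also have "\<dots> \<le> \<lfloor>real d / \<eta>\<rfloor>" using sum_m by (simp add: le_floor_iff)
      also have "\<dots> = int M" using assms by (simp add: M_def)
      finally show ?thesis by auto
    qed
    then have "m \<in> I" using sum_m by (auto simp: I_def m_def PiE_iff)
    moreover have "L2_set (g m) {..<d} \<le> L2_set x {..<d}"
      unfolding L2_set_def using abs_g
      by (intro real_sqrt_le_mono sum_mono) (simp add: abs_le_square_iff)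
    ultimately have "g m \<in> N" using x by (auto simp: N_def)
    moreover have "L2_set (\<lambda>i. x i - g m i) {..<d} \<le> \<eta>"
    proof -
      have "(x i - g m i)\<^sup>2 \<le> \<eta>\<^sup>2 / real d" if "i < d" for i
      proof -
        have "(x i - g m i)\<^sup>2 = \<eta>\<^sup>2 / real d * (q i - real_of_int (m i))\<^sup>2"
        proof -
          have "x i - g m i = \<eta> / sqrt (real d) * (q i - real_of_int (m i))"
            unfolding xq g_def by (rule right_diff_distrib[symmetric])
          then show ?thesis by (simp add: power_divide power_mult_distrib)
        qed
        also have "(q i - real_of_int (m i))\<^sup>2 \<le> 1"
          using m_le(2)[OF that] by (simp add: abs_square_le_1)
        then have "\<eta>\<^sup>2 / real d * (q i - real_of_int (m i))\<^sup>2 \<le> \<eta>\<^sup>2 / real d * 1"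
          by (intro mult_left_mono) auto
        finally show ?thesis by simp
      qed
      then have "(\<Sum>i<d. (x i - g m i)\<^sup>2) \<le> (\<Sum>i<d. \<eta>\<^sup>2 / real d)" by (intro sum_mono) auto
      then have "(\<Sum>i<d. (x i - g m i)\<^sup>2) \<le> \<eta>\<^sup>2" using False by simp
      then show ?thesis unfolding L2_set_def using assms by (intro real_le_lsqrt) (auto intro: sum_nonneg)
    qed
    ultimately show ?thesis by blast
  qed
  then show "\<exists>N :: (nat \<Rightarrow> real) set. finite N \<and> real (card N) \<le> ?K ^ d \<and> (\<forall>v\<in>N. L2_set v {..<d} \<le> 1) \<and>
      (\<forall>x. L2_set x {..<d} \<le> 1 \<longrightarrow> (\<exists>v\<in>N. L2_set (\<lambda>i. x i - v i) {..<d} \<le> \<eta>))"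
    using card I(1) by (intro exI[of _ N]) (auto simp: N_def)
qed

section \<open>Positive semidefinite matrices\<close>

text \<open>Matrices and vectors are plain functions, read only below \<open>d\<close>. This spares
  carrier conditions and gives access to the product topology for compactness arguments.\<close>

definition qform :: "nat \<Rightarrow> (nat \<Rightarrow> nat \<Rightarrow> real) \<Rightarrow> (nat \<Rightarrow> real) \<Rightarrow> real" where
  "qform d H v = (\<Sum>i<d. \<Sum>l<d. v i * H i l * v l)"

lemma qform_add_scale:
  assumes sym: "\<And>i l. i < d \<Longrightarrow> l < d \<Longrightarrow> H i l = H l i"
  shows "qform d H (\<lambda>i. s * v i + t * w i)
    = s\<^sup>2 * qform d H v + 2 * s * t * (\<Sum>i<d. w i * (\<Sum>l<d. H i l * v l)) + t\<^sup>2 * qform d H w"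
proof -
  have "(\<Sum>i<d. \<Sum>l<d. v i * H i l * w l) = (\<Sum>l<d. \<Sum>i<d. v i * H i l * w l)"
    by (rule sum.swap)
  also have "\<dots> = (\<Sum>i<d. w i * (\<Sum>l<d. H i l * v l))"
    by (intro sum.cong refl) (auto simp: sum_distrib_left sym intro!: sum.cong)
  finally have 1: "(\<Sum>i<d. \<Sum>l<d. v i * H i l * w l) = (\<Sum>i<d. w i * (\<Sum>l<d. H i l * v l))" .
  have 2: "(\<Sum>i<d. \<Sum>l<d. w i * H i l * v l) = (\<Sum>i<d. w i * (\<Sum>l<d. H i l * v l))"
    by (simp add: sum_distrib_left mult.assoc)
  have "qform d H (\<lambda>i. s * v i + t * w i)
      = (\<Sum>i<d. \<Sum>l<d. s\<^sup>2 * (v i * H i l * v l) + s * t * (v i * H i l * w l)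
          + s * t * (w i * H i l * v l) + t\<^sup>2 * (w i * H i l * w l))"
    unfolding qform_def by (intro sum.cong refl) (simp add: algebra_simps power2_eq_square)
  also have "\<dots> = s\<^sup>2 * qform d H v + s * t * (\<Sum>i<d. \<Sum>l<d. v i * H i l * w l)
      + s * t * (\<Sum>i<d. \<Sum>l<d. w i * H i l * v l) + t\<^sup>2 * qform d H w"
    unfolding qform_def by (simp add: sum.distrib sum_distrib_left)
  finally show ?thesis unfolding 1 2 by simp
qed

text \<open>Near t = 0 the linear term dominates and would take both signs.\<close>

lemma quadratic_nonneg_imp_linear_zero:
  fixes b c :: real
  assumes "\<And>t. 0 \<le> 2 * t * b + t\<^sup>2 * c"
  shows "b = 0"
proof (rule ccontr)
  assume "b \<noteq> 0"
  \<comment> \<open>A positive upper bound for c; then - b / C minimises 2 t b + t^2 C, with value -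
    b^2 / C.\<close>
  define C where "C = \<bar>c\<bar> + 1"
  have "C > 0" "c \<le> C" by (auto simp: C_def)
  have "0 \<le> 2 * (- b / C) * b + (- b / C)\<^sup>2 * c" by (rule assms)
  also have "\<dots> \<le> 2 * (- b / C) * b + (- b / C)\<^sup>2 * C"
    using \<open>c \<le> C\<close> by (intro add_left_mono mult_left_mono) auto
  also have "\<dots> = - (b\<^sup>2 / C)" using \<open>C > 0\<close> by (simp add: field_simps power2_eq_square)
  also have "\<dots> < 0" using \<open>b \<noteq> 0\<close> \<open>C > 0\<close> by simp
  finally show False by simp
qed

text \<open>A zero of a nonnegative quadratic form is a minimum, so the gradient 2 H z vanishes
  there; it is tested in the direction of the i-th unit vector.\<close>

lemma psd_null_vector:
  assumes sym: "\<And>i l. i < d \<Longrightarrow> l < d \<Longrightarrow> H i l = H l i"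
    and psd: "\<And>v. 0 \<le> qform d H v" and "qform d H z = 0" "i < d"
  shows "(\<Sum>l<d. H i l * z l) = 0"
proof (rule quadratic_nonneg_imp_linear_zero)
  fix t
  let ?e = "\<lambda>l. if l = i then 1 else 0 :: real"
  have "(\<Sum>j<d. ?e j * (\<Sum>l<d. H j l * z l)) = (\<Sum>l<d. H i l * z l)"
    using \<open>i < d\<close> by (simp add: if_distrib[of "\<lambda>x. x * _"] cong: if_cong)
  then show "0 \<le> 2 * t * (\<Sum>l<d. H i l * z l) + t\<^sup>2 * qform d H ?e"
    using psd[of "\<lambda>l. 1 * z l + t * ?e l"] assms(3) by (subst (asm) qform_add_scale[where H = H and d = d, OF sym]) auto
qed

lemma qform_rank_one: "qform d (\<lambda>i l. g i * g l) v = (\<Sum>i<d. g i * v i)\<^sup>2"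
  unfolding qform_def power2_eq_square sum_product by (intro sum.cong refl) (simp add: mult_ac)

lemma qform_diff: "qform d (\<lambda>i l. G i l - H i l) v = qform d G v - qform d H v"
  unfolding qform_def by (simp add: algebra_simps sum_subtractf)

lemma qform_scale: "qform d (\<lambda>i l. c * H i l) v = c * qform d H v"
  unfolding qform_def by (simp add: algebra_simps sum_distrib_left)

lemma qform_vec_scale: "qform d H (\<lambda>i. c * v i) = c\<^sup>2 * qform d H v"
  unfolding qform_def by (simp add: algebra_simps sum_distrib_left power2_eq_square)

lemma qform_unit: "i < d \<Longrightarrow> qform d H (\<lambda>l. if l = i then 1 else 0) = H i i"
  unfolding qform_def
  by (simp add: if_distrib[of "\<lambda>x. x * _"] if_distrib[of "\<lambda>x. _ * x"] cong: if_cong)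

text \<open>Cholesky: subtracting \<open>H e\<^sub>i (H e\<^sub>i)\<^sup>T / H\<^sub>i\<^sub>i\<close> keeps a positive semidefinite matrix positive
  semidefinite and kills its \<open>i\<close>-th row and column.\<close>

lemma psd_sum_rank_one:
  assumes "\<And>i l. i < d \<Longrightarrow> l < d \<Longrightarrow> H i l = H l i"
    and "\<And>v. 0 \<le> qform d H v"
  shows "\<exists>g :: nat \<Rightarrow> nat \<Rightarrow> real. \<forall>i<d. \<forall>l<d. H i l = (\<Sum>m<d. g m i * g m l)"
proof -
  \<comment> \<open>The induction runs over the number \<open>r\<close> of rows that may still be
    nonzero; for r = 0 only the zero matrix is left.\<close>
  have "\<exists>g :: nat \<Rightarrow> nat \<Rightarrow> real. \<forall>i<d. \<forall>l<d. H i l = (\<Sum>m<r. g m i * g m l)"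
    if "r \<le> d" "\<And>i l. i < d \<Longrightarrow> l < d \<Longrightarrow> H i l = H l i" "\<And>v. 0 \<le> qform d H v"
      "\<And>i l. i < d \<Longrightarrow> l < d \<Longrightarrow> r \<le> i \<Longrightarrow> H i l = 0" for H r
    using that
  proof (induction r arbitrary: H)
    case 0
    then show ?case by auto
  next
    case (Suc r)
    note sym = Suc.prems(2) and psd = Suc.prems(3)
    let ?e = "\<lambda>l. if l = r then 1 else 0 :: real"
    have r: "r < d" using Suc.prems(1) by simp
    have He: "(\<Sum>l<d. H i l * ?e l) = H i r" if "i < d" for i
      using r by (simp add: if_distrib[of "\<lambda>x. _ * x"] cong: if_cong)
    have diag: "0 \<le> H r r" using psd[of ?e] r by (simp add: qform_unit)
    \<comment> \<open>If \<open>H r r = 0\<close>, division by zero gives h = 0 and H' = H; in that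
      case row r vanishes already by \<open>psd_null_vector\<close>.\<close>
    define h where "h = (\<lambda>i. H i r / sqrt (H r r))"
    define H' where "H' = (\<lambda>i l. H i l - h i * h l)"
    have hh: "h i * h l = H i r * H l r / H r r" for i l
      using diag by (simp add: h_def)
    have "0 \<le> qform d H' v" for v
    proof -
      define b where "b = (\<Sum>i<d. v i * H i r)"
      have b: "(\<Sum>i<d. v i * (\<Sum>l<d. H i l * ?e l)) = b"
        unfolding b_def using He by simp
      have expand: "qform d H (\<lambda>i. s * ?e i + t * v i) = s\<^sup>2 * H r r + 2 * s * t * b + t\<^sup>2 * qform d H v" for s t
        using qform_add_scale[where H = H and d = d, OF sym, where v = ?e and w = v and s = s and t = t] r
        unfolding b qform_unit[OF r] by simp
      have "(\<Sum>i<d. h i * v i) = b / sqrt (H r r)"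
        by (simp add: b_def h_def sum_divide_distrib mult.commute)
      then have H': "qform d H' v = qform d H v - b\<^sup>2 / H r r"
        unfolding H'_def qform_diff qform_rank_one using diag by (simp add: power_divide)
      show ?thesis
      proof (cases "H r r = 0")
        case False
        \<comment> \<open>Completing the square: - b / H r r minimises the form over the multiples
          of the r-th unit vector added to v, and the minimum is the form of H' at v.\<close>
        then show ?thesis
          using psd[of "\<lambda>i. (- b / H r r) * ?e i + 1 * v i"] 
          unfolding expand H' by (simp add: power2_eq_square field_simps)
      qed (use psd in \<open>simp add: H'\<close>)
    qed
    moreover have "H' i l = H' l i" if "i < d" "l < d" for i l
      using sym[OF that] by (simp add: H'_def mult.commute)
    moreover have "H' i l = 0" if "i < d" "l < d" "r \<le> i" for i l
    proof (cases "i = r")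
      case True
      show ?thesis
      proof (cases "H r r = 0")
        case True
        then have "qform d H ?e = 0" using r by (simp add: qform_unit)
        from psd_null_vector[where H = H and d = d, OF sym psd this] have "H l r = 0" if "l < d" for l
          using He that by fastforce
        then show ?thesis using \<open>i = r\<close> that r sym by (simp add: H'_def hh)
      next
        case False
        then show ?thesis using \<open>i = r\<close> that r sym[of r l] by (simp add: H'_def hh)
      qed
    next
      case False
      then have "H i l = 0" "H i r = 0" using Suc.prems(4)[of i] that r by auto
      then show ?thesis by (simp add: H'_def h_def)
    qed
    ultimately obtain g where g: "\<And>i l. i < d \<Longrightarrow> l < d \<Longrightarrow> H' i l = (\<Sum>m<r. g m i * g m l)"
      using Suc.IH[of H'] Suc.prems(1) by force
    show ?case
    proof (intro exI allI impI)
      fix i l assume "i < d" "l < d"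
      then show "H i l = (\<Sum>m<Suc r. (g(r := h)) m i * (g(r := h)) m l)"
        using g[of i l] by (simp add: H'_def)
    qed
  qed
  from this[of d H] assms show ?thesis by auto
qed

section \<open>Minimal eigenvectors by compactness\<close>

text \<open>Tychonoff's theorem for a product of intervals. It takes the role of Heine-Borel,
  because vectors and matrices are functions on an infinite index type.\<close>

lemma compact_pointwise_bounded: "compact {f :: 'i :: countable \<Rightarrow> real. \<forall>i. \<bar>f i\<bar> \<le> R}"
proof -
  have "compactin (product_topology (\<lambda>_. euclidean) UNIV) (PiE UNIV (\<lambda>_ :: 'i. {-R..R}))"
    by (intro compactin_PiE[THEN iffD2]) auto
  also have "PiE UNIV (\<lambda>_ :: 'i. {-R..R}) = {f. \<forall>i. \<bar>f i\<bar> \<le> R}"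
    by (auto simp: abs_le_iff PiE_iff minus_le_iff)
  finally show ?thesis by (simp add: euclidean_product_topology)
qed

lemma continuous_on_coordinate: "continuous_on S (\<lambda>v :: 'i \<Rightarrow> 'b :: topological_space. v i)"
  by (rule continuous_on_subset[OF continuous_on_product_coordinates]) auto

lemma continuous_on_qform: "continuous_on S (\<lambda>v. qform d H v)"
  unfolding qform_def by (intro continuous_intros continuous_on_coordinate)

text \<open>The minimum \<mu> of the form on the unit sphere is attained at some z. Then H - \<mu> I
  is positive semidefinite with form zero at z, so \<open>psd_null_vector\<close> gives the
  eigenvector equation.\<close>

lemma qform_minimal_eigenvector:
  assumes sym: "\<And>i l. i < d \<Longrightarrow> l < d \<Longrightarrow> H i l = H l i" and "0 < d"
  obtains z \<mu> where "(\<Sum>i<d. (z i)\<^sup>2) = 1" "\<And>i. i < d \<Longrightarrow> (\<Sum>l<d. H i l * z l) = \<mu> * z i"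
    "\<And>v. \<mu> * (\<Sum>i<d. (v i)\<^sup>2) \<le> qform d H v"
proof -
  \<comment> \<open>The equation for the norm leaves the coordinates from \<open>d\<close> on free;
    the cube bounds them and makes the set compact. The comparison vectors \<open>w\<close> below
    are set to 0 there.\<close>
  define S where "S = {v :: nat \<Rightarrow> real. \<forall>i. \<bar>v i\<bar> \<le> 1} \<inter> {v. (\<Sum>i<d. (v i)\<^sup>2) = 1}"
  have "compact S" unfolding S_def
    by (intro compact_Int_closed compact_pointwise_bounded closed_Collect_eq continuous_intros
        continuous_on_coordinate)
  moreover have "(\<lambda>l. if l = 0 then 1 else 0) \<in> S"
    using \<open>0 < d\<close> by (auto simp: S_def if_distrib[of "\<lambda>x. x\<^sup>2"] cong: if_cong)
  then have "S \<noteq> {}" by blast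
  ultimately obtain z where z: "z \<in> S" "\<And>v. v \<in> S \<Longrightarrow> qform d H z \<le> qform d H v"
    using continuous_attains_inf[OF _ _ continuous_on_qform[of S d H]] by blast
  have z1: "(\<Sum>i<d. (z i)\<^sup>2) = 1" using z(1) by (simp add: S_def)
  define \<mu> where "\<mu> = qform d H z"
  have ge: "\<mu> * (\<Sum>i<d. (v i)\<^sup>2) \<le> qform d H v" for v
  proof (cases "(\<Sum>i<d. (v i)\<^sup>2) = 0")
    case True
    then have "\<forall>i<d. v i = 0" by (subst (asm) sum_nonneg_eq_0_iff) auto
    then show ?thesis by (simp add: qform_def)
  next
    case False
    define r where "r = sqrt (\<Sum>i<d. (v i)\<^sup>2)"
    have r: "r > 0" "r\<^sup>2 = (\<Sum>i<d. (v i)\<^sup>2)"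
      using False sum_nonneg[of "{..<d}" "\<lambda>i. (v i)\<^sup>2"] by (auto simp: r_def less_le)
    define w where "w = (\<lambda>i. if i < d then v i / r else 0)"
    have "(\<Sum>i<d. (w i)\<^sup>2) = (\<Sum>i<d. (v i)\<^sup>2) / r\<^sup>2"
      by (simp add: w_def power_divide sum_divide_distrib)
    then have w1: "(\<Sum>i<d. (w i)\<^sup>2) = 1"
      unfolding r(2)[symmetric] using r(1) by simp
    have "\<bar>w i\<bar> \<le> 1" for i
    proof (cases "i < d")
      case True
      then have "(w i)\<^sup>2 \<le> 1" unfolding w1[symmetric] by (intro member_le_sum) auto
      then show ?thesis by (simp add: abs_square_le_1)
    qed (simp add: w_def)
    then have "w \<in> S" using w1 by (simp add: S_def)
    then have "\<mu> \<le> qform d H w" unfolding \<mu>_def by (rule z(2))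
    also have "qform d H w = qform d H (\<lambda>i. (1 / r) * v i)"
      unfolding qform_def by (intro sum.cong refl) (simp add: w_def)
    also have "\<dots> = qform d H v / r\<^sup>2" unfolding qform_vec_scale by (simp add: power_divide)
    finally have "\<mu> * r\<^sup>2 \<le> qform d H v" using r(1) by (simp add: field_simps)
    then show ?thesis by (simp only: r(2))
  qed
  define D where "D = (\<lambda>i l :: nat. if i = l then \<mu> else 0)"
  have D: "qform d D v = \<mu> * (\<Sum>i<d. (v i)\<^sup>2)" for v
    unfolding qform_def D_def
    by (simp add: if_distrib[of "\<lambda>x. x * _"] if_distrib[of "\<lambda>x. _ * x"] sum_distrib_left power2_eq_square
        mult_ac cong: if_cong)
  have "(\<Sum>l<d. H i l * z l) = \<mu> * z i" if "i < d" for i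
  proof -
    have "(\<Sum>l<d. (H i l - D i l) * z l) = 0"
    proof (rule psd_null_vector[OF _ _ _ that])
      show "0 \<le> qform d (\<lambda>i l. H i l - D i l) v" for v using ge[of v] by (simp add: qform_diff D)
      show "qform d (\<lambda>i l. H i l - D i l) z = 0" by (simp add: qform_diff D z1 \<mu>_def)
      show "H i l - D i l = H l i - D l i" if "i < d" "l < d" for i l
        using sym[OF that] by (simp add: D_def)
    qed
    moreover have "(\<Sum>l<d. D i l * z l) = \<mu> * z i"
      using that by (simp add: D_def if_distrib[of "\<lambda>x. x * _"] cong: if_cong)
    ultimately show ?thesis by (simp add: left_diff_distrib sum_subtractf)
  qed
  then show ?thesis using that z1 ge by blast
qed

text \<open>There is at most one negative eigenvalue: two negative directions would span a plane meeting the
  hyperplane orthogonal to \<open>x\<close>, on which \<open>H\<close> is nonnegative.\<close>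

lemma psd_minus_rank_one_decomposition:
  assumes sym: "\<And>i l. i < d \<Longrightarrow> l < d \<Longrightarrow> H i l = H l i" and "0 < d"
    and psd: "\<And>v. 0 \<le> qform d H v + (\<Sum>i<d. x i * v i)\<^sup>2"
    and neg: "qform d H v0 < 0"
  obtains z lam g where "(\<Sum>i<d. (z i)\<^sup>2) = 1" "lam > 0" "\<And>m. m < d \<Longrightarrow> (\<Sum>i<d. g m i * z i) = 0"
    "\<And>i l. i < d \<Longrightarrow> l < d \<Longrightarrow> H i l = (\<Sum>m<d. g m i * g m l) - lam * (z i * z l)"
proof -
  obtain z \<mu> where z: "(\<Sum>i<d. (z i)\<^sup>2) = 1"
    and ev: "\<And>i. i < d \<Longrightarrow> (\<Sum>l<d. H i l * z l) = \<mu> * z i"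
    and ge: "\<And>v. \<mu> * (\<Sum>i<d. (v i)\<^sup>2) \<le> qform d H v"
    using qform_minimal_eigenvector[where H = H and d = d, OF sym \<open>0 < d\<close>] by blast
  have add_scale: "qform d H (\<lambda>i. s * v i + t * w i)
      = s\<^sup>2 * qform d H v + 2 * s * t * (\<Sum>i<d. w i * (\<Sum>l<d. H i l * v l)) + t\<^sup>2 * qform d H w" for s t v w
    by (rule qform_add_scale) (rule sym)
  have "\<mu> < 0"
  proof (rule ccontr)
    assume "\<not> \<mu> < 0"
    then have "0 \<le> \<mu> * (\<Sum>i<d. (v0 i)\<^sup>2)" by (simp add: sum_nonneg)
    then show False using ge[of v0] neg by linarith
  qed
  have cross: "(\<Sum>i<d. w i * (\<Sum>l<d. H i l * z l)) = \<mu> * (\<Sum>i<d. w i * z i)" for w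
  proof -
    have "(\<Sum>i<d. w i * (\<Sum>l<d. H i l * z l)) = (\<Sum>i<d. w i * (\<mu> * z i))"
      by (intro sum.cong refl) (simp add: ev)
    then show ?thesis by (simp add: sum_distrib_left mult_ac)
  qed
  have "qform d H z = (\<Sum>i<d. z i * (\<Sum>l<d. H i l * z l))"
    by (simp add: qform_def sum_distrib_left mult.assoc)
  then have qz: "qform d H z = \<mu>"
    using z unfolding cross by (simp add: power2_eq_square)
  have orth: "0 \<le> qform d H y" if y: "(\<Sum>i<d. y i * z i) = 0" for y
  proof (rule ccontr)
    assume "\<not> 0 \<le> qform d H y"
    then have qy: "qform d H y < 0" by simp
    \<comment> \<open>With these coefficients \<alpha> z + \<beta> y is orthogonal to x. If \<beta>
      = 0, then z itself is orthogonal to x and contradicts the hypothesis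
      \<open>psd\<close>.\<close>
    define \<alpha> \<beta> where "\<alpha> = (\<Sum>i<d. x i * y i)" and "\<beta> = - (\<Sum>i<d. x i * z i)"
    have q: "qform d H (\<lambda>i. s * z i + t * y i) = s\<^sup>2 * \<mu> + t\<^sup>2 * qform d H y" for s t
      unfolding add_scale cross y qz by simp
    show False
    proof (cases "\<beta> = 0")
      case True
      then show False using psd[of z] \<open>\<mu> < 0\<close> by (simp add: qz \<beta>_def)
    next
      case False
      have "(\<Sum>i<d. x i * (\<alpha> * z i + \<beta> * y i)) = \<alpha> * (\<Sum>i<d. x i * z i) + \<beta> * (\<Sum>i<d. x i * y i)"
        by (simp add: algebra_simps sum.distrib sum_distrib_left)
      also have "\<dots> = 0" by (simp add: \<alpha>_def \<beta>_def)
      finally have "0 \<le> \<alpha>\<^sup>2 * \<mu> + \<beta>\<^sup>2 * qform d H y"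
        using psd[of "\<lambda>i. \<alpha> * z i + \<beta> * y i"] by (simp add: q)
      moreover have "\<alpha>\<^sup>2 * \<mu> \<le> 0" using \<open>\<mu> < 0\<close> by (simp add: mult_nonneg_nonpos)
      moreover have "\<beta>\<^sup>2 * qform d H y < 0" using False qy by (simp add: mult_pos_neg)
      ultimately show False by linarith
    qed
  qed
  \<comment> \<open>Adding back the negative eigenvalue. G vanishes along z and agrees with H on the
    complement of z, so splitting v into these two parts shows that G is positive
    semidefinite.\<close>
  define G where "G = (\<lambda>i l. H i l - \<mu> * (z i * z l))"
  have qG: "qform d G v = qform d H v - \<mu> * (\<Sum>i<d. z i * v i)\<^sup>2" for v
    unfolding G_def qform_diff qform_scale qform_rank_one ..
  have "0 \<le> qform d G v" for v
  proof -
    define \<alpha> where "\<alpha> = (\<Sum>i<d. z i * v i)"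
    define y where "y = (\<lambda>i. 1 * v i + (- \<alpha>) * z i)"
    have "(\<Sum>i<d. y i * z i) = (\<Sum>i<d. v i * z i) - \<alpha> * (\<Sum>i<d. (z i)\<^sup>2)"
      by (simp add: y_def algebra_simps sum_subtractf sum_distrib_left power2_eq_square)
    then have "(\<Sum>i<d. y i * z i) = 0" by (simp add: z \<alpha>_def mult.commute)
    then have "0 \<le> qform d H y" by (rule orth)
    moreover have "qform d H y = qform d H (\<lambda>i. (-\<alpha>) * z i + 1 * v i)"
      by (simp add: y_def add.commute)
    then have "qform d H y = \<alpha>\<^sup>2 * \<mu> - 2 * \<alpha> * (\<mu> * (\<Sum>i<d. v i * z i)) + qform d H v"
      unfolding add_scale cross qz by simp
    moreover have "(\<Sum>i<d. v i * z i) = \<alpha>" by (simp add: \<alpha>_def mult.commute)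
    ultimately show ?thesis unfolding qG \<alpha>_def[symmetric] by (simp add: power2_eq_square algebra_simps)
  qed
  moreover have "G i l = G l i" if "i < d" "l < d" for i l
    using sym[OF that] by (simp add: G_def mult.commute)
  ultimately obtain g where g: "\<And>i l. i < d \<Longrightarrow> l < d \<Longrightarrow> G i l = (\<Sum>m<d. g m i * g m l)"
    using psd_sum_rank_one[of d G] by blast
  \<comment> \<open>The form of G at z is zero and is also the sum of the squares of the inner
    products of the g_m with z, which forces the orthogonality.\<close>
  have "qform d G z = (\<Sum>i<d. \<Sum>l<d. \<Sum>m<d. (g m i * z i) * (g m l * z l))"
    unfolding qform_def by (intro sum.cong refl) (auto simp: g sum_distrib_left sum_distrib_right mult_ac intro!: sum.cong)
  also have "\<dots> = (\<Sum>m<d. (\<Sum>i<d. g m i * z i)\<^sup>2)"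
    unfolding power2_eq_square sum_product
    by (subst sum.swap, subst (2) sum.swap, subst (3) sum.swap, subst sum.swap) (rule refl)
  finally have "(\<Sum>m<d. (\<Sum>i<d. g m i * z i)\<^sup>2) = 0"
    using z by (simp add: qG qz power2_eq_square)
  then have gz: "(\<Sum>i<d. g m i * z i) = 0" if "m < d" for m
    using that by (subst (asm) sum_nonneg_eq_0_iff) auto
  have Hg: "H i l = (\<Sum>m<d. g m i * g m l) - (- \<mu>) * (z i * z l)" if "i < d" "l < d" for i l
    using g[OF that] by (simp add: G_def)
  show ?thesis using that[OF z _ gz Hg] \<open>\<mu> < 0\<close> by simp
qed

section \<open>Invariance of the random projector\<close>

lemma space_borel_mat [simp]: "space (borel_mat d) = carrier_mat d d"
  unfolding borel_mat_def by (rule space_measure_of) auto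

lemma measurable_mat_entry:
  assumes "i < d" "j < d"
  shows "(\<lambda>A. A $$ (i, j)) \<in> borel_measurable (borel_mat d)"
proof (rule measurableI)
  fix S :: "real set"
  assume "S \<in> sets borel"
  then have "{A \<in> carrier_mat d d. A $$ (i, j) \<in> S} \<in> sets (borel_mat d)"
    unfolding borel_mat_def using assms by (subst sets_measure_of) (auto intro!: sigma_sets.Basic)
  moreover have "(\<lambda>A. A $$ (i, j)) -` S \<inter> space (borel_mat d) = {A \<in> carrier_mat d d. A $$ (i, j) \<in> S}"
    by auto
  ultimately show "(\<lambda>A. A $$ (i, j)) -` S \<inter> space (borel_mat d) \<in> sets (borel_mat d)" by simp
qed simp

lemma measurable_borel_matI:
  assumes "f \<in> space M \<rightarrow> carrier_mat d d"
    and "\<And>i j. i < d \<Longrightarrow> j < d \<Longrightarrow> (\<lambda>\<omega>. f \<omega> $$ (i, j)) \<in> borel_measurable M"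
  shows "f \<in> measurable M (borel_mat d)"
  unfolding borel_mat_def
proof (rule measurable_measure_of)
  fix Y :: "real mat set"
  assume "Y \<in> {{A \<in> carrier_mat d d. A $$ (i, j) \<in> S} | i j S. i < d \<and> j < d \<and> S \<in> sets borel}"
  then obtain i j and S :: "real set" where Y: "Y = {A \<in> carrier_mat d d. A $$ (i, j) \<in> S}"
    and "i < d" "j < d" "S \<in> sets borel" by blast
  then have "(\<lambda>\<omega>. f \<omega> $$ (i, j)) -` S \<inter> space M \<in> sets M"
    using assms(2) by (intro measurable_sets)
  moreover have "f -` Y \<inter> space M = (\<lambda>\<omega>. f \<omega> $$ (i, j)) -` S \<inter> space M"
    using assms(1) by (auto simp: Y)
  ultimately show "f -` Y \<inter> space M \<in> sets M" by simp
qed (use assms(1) in auto)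

section \<open>The scaled projection length as a seminorm\<close>

text \<open>For orthogonal \<open>U\<close> this is sqrt(d/k) |P x|, where P projects onto the span
  of the first \<open>k\<close> columns, computed from the coefficients of x along these columns.
  Its square is the a(x) of the overview. The root is the primary notion because it is a seminorm in
  x.\<close>

definition proj_len :: "nat \<Rightarrow> nat \<Rightarrow> real mat \<Rightarrow> (nat \<Rightarrow> real) \<Rightarrow> real" where
  "proj_len k d U x = sqrt (real d / real k) * L2_set (\<lambda>i. \<Sum>l<d. U $$ (l, i) * x l) {..<k}"

lemma proj_len_nonneg: "0 \<le> proj_len k d U x"
  unfolding proj_len_def by (simp add: L2_set_nonneg)

lemma proj_len_square: "(proj_len k d U x)\<^sup>2 = real d / real k * (\<Sum>i<k. (\<Sum>l<d. U $$ (l, i) * x l)\<^sup>2)"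
  unfolding proj_len_def L2_set_def by (simp add: power_mult_distrib sum_nonneg)

lemma proj_len_cong: "(\<And>l. l < d \<Longrightarrow> x l = y l) \<Longrightarrow> proj_len k d U x = proj_len k d U y"
  unfolding proj_len_def by simp

lemma proj_len_triangle: "proj_len k d U (\<lambda>l. x l + y l) \<le> proj_len k d U x + proj_len k d U y"
proof -
  have "L2_set (\<lambda>i. \<Sum>l<d. U $$ (l, i) * (x l + y l)) {..<k}
      \<le> L2_set (\<lambda>i. \<Sum>l<d. U $$ (l, i) * x l) {..<k} + L2_set (\<lambda>i. \<Sum>l<d. U $$ (l, i) * y l) {..<k}"
    using L2_set_triangle_ineq[of "\<lambda>i. \<Sum>l<d. U $$ (l, i) * x l" "\<lambda>i. \<Sum>l<d. U $$ (l, i) * y l" "{..<k}"]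
    by (simp add: distrib_left sum.distrib)
  then show ?thesis unfolding proj_len_def by (simp add: mult_left_mono flip: distrib_left)
qed

lemma proj_len_scale: "proj_len k d U (\<lambda>l. c * x l) = \<bar>c\<bar> * proj_len k d U x"
proof -
  have "L2_set (\<lambda>i. \<Sum>l<d. U $$ (l, i) * (c * x l)) {..<k} = L2_set (\<lambda>i. c * (\<Sum>l<d. U $$ (l, i) * x l)) {..<k}"
    by (simp add: sum_distrib_left mult.left_commute)
  also have "\<dots> = \<bar>c\<bar> * L2_set (\<lambda>i. \<Sum>l<d. U $$ (l, i) * x l) {..<k}"
    by (simp add: L2_set_def power_mult_distrib real_sqrt_mult flip: sum_distrib_left)
  finally show ?thesis by (simp add: proj_len_def)
qed

lemma exists_normalization:
  assumes "(\<Sum>l<d. (x l)\<^sup>2) \<noteq> 0"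
  obtains r :: real where "0 < r" "(\<Sum>l<d. (x l)\<^sup>2) = r\<^sup>2" "(\<Sum>l<d. (x l / r)\<^sup>2) = 1"
    "\<And>k U. proj_len k d U x = r * proj_len k d U (\<lambda>l. x l / r)"
proof
  define r where "r = sqrt (\<Sum>l<d. (x l)\<^sup>2)"
  show r: "0 < r" "(\<Sum>l<d. (x l)\<^sup>2) = r\<^sup>2"
    using assms sum_nonneg[of "{..<d}" "\<lambda>l. (x l)\<^sup>2"] by (auto simp: r_def less_le)
  have "(\<Sum>l<d. (x l / r)\<^sup>2) = (\<Sum>l<d. (x l)\<^sup>2) / r\<^sup>2" by (simp add: power_divide sum_divide_distrib)
  then show "(\<Sum>l<d. (x l / r)\<^sup>2) = 1" unfolding r(2) using r(1) by simp
  show "proj_len k d U x = r * proj_len k d U (\<lambda>l. x l / r)" for k U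
    using proj_len_scale[of k d U r "\<lambda>l. x l / r"] r(1) by simp
qed

lemma proj_len_diff_le: "\<bar>proj_len k d U x - proj_len k d U y\<bar> \<le> proj_len k d U (\<lambda>l. x l - y l)"
proof -
  have "proj_len k d U (\<lambda>l. (-1) * (x l - y l)) = proj_len k d U (\<lambda>l. x l - y l)"
    by (subst proj_len_scale) simp
  then show ?thesis
    using proj_len_triangle[of k d U "\<lambda>l. x l - y l" y] proj_len_triangle[of k d U "\<lambda>l. (-1) * (x l - y l)" x]
    by simp
qed

lemma orthogonal_group_columns:
  assumes "U \<in> orthogonal_group d" "i < d" "j < d"
  shows "(\<Sum>l<d. U $$ (l, i) * U $$ (l, j)) = (if i = j then 1 else 0)"
proof -
  have U: "U \<in> carrier_mat d d" "transpose_mat U * U = 1\<^sub>m d"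
    using assms(1) by (auto simp: orthogonal_group_def)
  have "(transpose_mat U * U) $$ (i, j) = (\<Sum>l<d. U $$ (l, i) * U $$ (l, j))"
    using U(1) assms(2,3) by (auto simp: scalar_prod_def lessThan_atLeast0 intro!: sum.cong)
  then show ?thesis using U(2) assms(2,3) by simp
qed

lemma orthogonal_groupI:
  assumes "U \<in> carrier_mat d d"
    and "\<And>i j. i < d \<Longrightarrow> j < d \<Longrightarrow> (\<Sum>l<d. U $$ (l, i) * U $$ (l, j)) = (if i = j then 1 else 0)"
  shows "U \<in> orthogonal_group d"
proof -
  have "transpose_mat U * U = 1\<^sub>m d"
  proof (rule eq_matI)
    fix i j assume "i < dim_row (1\<^sub>m d :: real mat)" "j < dim_col (1\<^sub>m d :: real mat)"
    then have ij: "i < d" "j < d" by auto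
    have "(transpose_mat U * U) $$ (i, j) = (\<Sum>l<d. U $$ (l, i) * U $$ (l, j))"
      using assms(1) ij by (auto simp: scalar_prod_def lessThan_atLeast0 intro!: sum.cong)
    then show "(transpose_mat U * U) $$ (i, j) = 1\<^sub>m d $$ (i, j)" using assms(2) ij by simp
  qed (use assms(1) in auto)
  then show ?thesis using assms(1) by (simp add: orthogonal_group_def)
qed

lemma orthogonal_group_entry_le:
  assumes "U \<in> orthogonal_group d" "l < d" "i < d"
  shows "\<bar>U $$ (l, i)\<bar> \<le> 1"
proof -
  have "(U $$ (l, i))\<^sup>2 \<le> (\<Sum>l<d. (U $$ (l, i))\<^sup>2)"
    using assms(2) by (intro member_le_sum) auto
  also have "\<dots> = 1" using orthogonal_group_columns[OF assms(1,3,3)] by (simp add: power2_eq_square)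
  finally show ?thesis by (simp add: abs_square_le_1)
qed

text \<open>Orthogonal matrices have entries of modulus at most 1. The bound grows with
  \<open>d\<close> and serves only qualitative purposes: integrability, and finiteness of a
  supremum.\<close>

lemma proj_len_bound:
  assumes "U \<in> orthogonal_group d" "k \<le> d"
  shows "proj_len k d U x \<le> sqrt (real d / real k) * (real k * (\<Sum>l<d. \<bar>x l\<bar>))"
  unfolding proj_len_def
proof (intro mult_left_mono)
  have "\<bar>\<Sum>l<d. U $$ (l, i) * x l\<bar> \<le> (\<Sum>l<d. \<bar>x l\<bar>)" if "i < k" for i
  proof (rule order.trans[OF sum_abs sum_mono])
    fix l assume "l \<in> {..<d}"
    then show "\<bar>U $$ (l, i) * x l\<bar> \<le> \<bar>x l\<bar>"
      using orthogonal_group_entry_le[OF assms(1), of l i] that assms(2)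
      by (simp add: abs_mult mult_left_le_one_le)
  qed
  then have "(\<Sum>i<k. \<bar>\<Sum>l<d. U $$ (l, i) * x l\<bar>) \<le> (\<Sum>i<k. \<Sum>l<d. \<bar>x l\<bar>)" by (intro sum_mono) auto
  then show "L2_set (\<lambda>i. \<Sum>l<d. U $$ (l, i) * x l) {..<k} \<le> real k * (\<Sum>l<d. \<bar>x l\<bar>)"
    by (intro order.trans[OF L2_set_le_sum_abs]) simp
qed simp

section \<open>Invariance of the joint law of two projection lengths\<close>

text \<open>The Householder reflection I - 2 v v^T / |v|^2 with v = x - y. It swaps x and y and
  fixes every w orthogonal to v, that is, every w with equal inner products with x and y.
  \<open>T\<close> is the action of the transpose of \<open>A\<close>, the form in which left
  multiplication reaches \<open>proj_len\<close>.\<close>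

lemma exists_reflection:
  assumes norm: "(\<Sum>l<d. (x l)\<^sup>2) = (\<Sum>l<d. (y l)\<^sup>2)"
  obtains A T where "A \<in> orthogonal_group d"
    "\<And>w m. m < d \<Longrightarrow> (\<Sum>l<d. A $$ (l, m) * w l) = T w m"
    "\<And>m. m < d \<Longrightarrow> T x m = y m"
    "\<And>w m. (\<Sum>l<d. x l * w l) = (\<Sum>l<d. y l * w l) \<Longrightarrow> m < d \<Longrightarrow> T w m = w m"
    "\<And>w w'. (\<Sum>m<d. T w m * T w' m) = (\<Sum>m<d. w m * w' m)"
proof -
  define v where "v = (\<lambda>l. x l - y l)"
  define V where "V = (\<Sum>l<d. (v l)\<^sup>2)"
  \<comment> \<open>If v = 0, division by zero makes c = 0 and A the identity; \<open>cV\<close>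
    holds in both cases.\<close>
  define c where "c = 2 / V"
  define A where "A = Matrix.mat d d (\<lambda>(i, j). (if i = j then 1 else 0) - c * (v i * v j))"
  define T where "T = (\<lambda>w m. w m - c * (\<Sum>l<d. v l * w l) * v m)"
  have cV: "c * c * V = 2 * c" by (cases "V = 0") (auto simp: c_def)
  have T: "(\<Sum>l<d. A $$ (l, m) * w l) = T w m" if "m < d" for w m
  proof -
    have "(\<Sum>l<d. A $$ (l, m) * w l) = (\<Sum>l<d. (if l = m then w l else 0) - c * v m * (v l * w l))"
      using that by (intro sum.cong refl) (auto simp: A_def algebra_simps)
    also have "\<dots> = w m - c * v m * (\<Sum>l<d. v l * w l)"
      using that by (simp add: sum_subtractf sum_distrib_left)
    finally show ?thesis by (simp add: T_def)
  qed
  have TT: "(\<Sum>m<d. T w m * T w' m) = (\<Sum>m<d. w m * w' m)" for w w'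
  proof -
    let ?p = "\<Sum>l<d. v l * w l" and ?q = "\<Sum>l<d. v l * w' l"
    have "(\<Sum>m<d. T w m * T w' m)
        = (\<Sum>m<d. w m * w' m - c * ?q * (v m * w m) - c * ?p * (v m * w' m) + c * c * ?p * ?q * (v m)\<^sup>2)"
      by (intro sum.cong refl) (simp add: T_def algebra_simps power2_eq_square)
    also have "\<dots> = (\<Sum>m<d. w m * w' m) - c * ?q * ?p - c * ?p * ?q + c * c * ?p * ?q * V"
      unfolding V_def by (simp add: sum_subtractf sum.distrib flip: sum_distrib_left)
    also have "\<dots> = (\<Sum>m<d. w m * w' m) + ?p * ?q * (c * c * V - 2 * c)" by (simp add: algebra_simps)
    finally show ?thesis unfolding cV by simp
  qed
  have A: "A \<in> orthogonal_group d"
  proof (rule orthogonal_groupI)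
    fix i j assume ij: "i < d" "j < d"
    have sym: "A $$ (l, m) = A $$ (m, l)" if "l < d" "m < d" for l m
      using that by (auto simp: A_def)
    let ?e = "\<lambda>i l. if l = i then 1 else 0 :: real"
    have Te: "T (?e i) m = A $$ (m, i)" if "m < d" "i < d" for m i
      using T[OF that(1), of "?e i"] that sym
      by (simp add: if_distrib[of "\<lambda>x. _ * x"] cong: if_cong)
    have "(\<Sum>l<d. A $$ (l, i) * A $$ (l, j)) = (\<Sum>l<d. T (?e i) l * T (?e j) l)"
      using ij by (intro sum.cong refl) (simp add: Te)
    also have "\<dots> = (if i = j then 1 else 0)"
      using ij by (simp add: TT if_distrib[of "\<lambda>x. x * _"] cong: if_cong)
    finally show "(\<Sum>l<d. A $$ (l, i) * A $$ (l, j)) = (if i = j then 1 else 0)" .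
  qed (simp add: A_def)
  have Tx: "T x m = y m" if "m < d" for m
  proof (cases "V = 0")
    case True
    then have "v m = 0" unfolding V_def using that by (subst (asm) sum_nonneg_eq_0_iff) auto
    then show ?thesis by (simp add: T_def) (simp add: v_def)
  next
    case False
    have "V = (\<Sum>l<d. (x l)\<^sup>2) - 2 * (\<Sum>l<d. x l * y l) + (\<Sum>l<d. (y l)\<^sup>2)"
      unfolding V_def v_def by (simp add: power2_diff sum_subtractf sum.distrib sum_distrib_left algebra_simps)
    moreover have "(\<Sum>l<d. v l * x l) = (\<Sum>l<d. (x l)\<^sup>2) - (\<Sum>l<d. x l * y l)"
      unfolding v_def by (simp add: sum_subtractf algebra_simps power2_eq_square)
    ultimately have "c * (\<Sum>l<d. v l * x l) = 1" using False norm by (simp add: c_def)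
    then show ?thesis by (simp add: T_def) (simp add: v_def)
  qed
  have Tw: "T w m = w m" if "(\<Sum>l<d. x l * w l) = (\<Sum>l<d. y l * w l)" for w m
  proof -
    have "(\<Sum>l<d. v l * w l) = 0" using that by (simp add: v_def left_diff_distrib sum_subtractf)
    then show ?thesis by (simp add: T_def)
  qed
  show ?thesis using that A T Tx Tw TT by blast
qed

locale haar_subspace =
  fixes k d :: nat and \<mu> :: "real mat measure"
  assumes k_pos: "1 \<le> k" and k_less: "k < d" and haar: "haar_orthogonal d \<mu>"
begin

sublocale prob_space \<mu>
  using haar by (simp add: haar_orthogonal_def)

lemma space_haar [simp]: "space \<mu> = orthogonal_group d"
  using haar by (simp add: haar_orthogonal_def)

lemma measurable_entry [measurable]:
  assumes "i < d" "j < d" shows "(\<lambda>U. U $$ (i, j)) \<in> borel_measurable \<mu>"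
proof -
  have "(\<lambda>U. U $$ (i, j)) \<in> borel_measurable (restrict_space (borel_mat d) (orthogonal_group d))"
    by (intro measurable_restrict_space1 measurable_mat_entry assms)
  moreover have "sets \<mu> = sets (restrict_space (borel_mat d) (orthogonal_group d))"
    using haar by (simp add: haar_orthogonal_def)
  ultimately show ?thesis using measurable_cong_sets by blast
qed

lemma measurable_proj_len [measurable]: "(\<lambda>U. proj_len k d U x) \<in> borel_measurable \<mu>"
  unfolding proj_len_def L2_set_def
  by (intro borel_measurable_times borel_measurable_sqrt borel_measurable_sum borel_measurable_power
      borel_measurable_const measurable_compose[OF _ borel_measurable_sqrt] measurable_entry)
    (use k_less in auto)

text \<open>The entries of \<open>A * U\<close> are linear in those of \<open>U\<close> and
  \<open>A * U\<close> is again orthogonal, so left multiplication is measurable; then this is a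
  change of variables under a map preserving \<mu>.\<close>

lemma integral_invariant:
  assumes A: "A \<in> orthogonal_group d" and g: "g \<in> borel_measurable \<mu>"
  shows "(\<integral>U. g (A * U) \<partial>\<mu>) = (\<integral>U. g U \<partial>\<mu> :: real)"
proof -
  have sets: "sets \<mu> = sets (restrict_space (borel_mat d) (orthogonal_group d))"
    and inv: "distr \<mu> \<mu> (\<lambda>U. A * U) = \<mu>"
    using haar A by (auto simp: haar_orthogonal_def)
  have A': "A \<in> carrier_mat d d" "transpose_mat A * A = 1\<^sub>m d" using A by (auto simp: orthogonal_group_def)
  have "(\<lambda>U. A * U) \<in> measurable \<mu> (borel_mat d)"
  proof (rule measurable_borel_matI)
    fix i j assume ij: "i < d" "j < d"
    have "(\<lambda>U. \<Sum>l<d. A $$ (i, l) * U $$ (l, j)) \<in> borel_measurable \<mu>"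
      using ij by (intro borel_measurable_sum borel_measurable_times borel_measurable_const measurable_entry) auto
    moreover have "(A * U) $$ (i, j) = (\<Sum>l<d. A $$ (i, l) * U $$ (l, j))" if "U \<in> space \<mu>" for U
      using that ij A' by (auto simp: orthogonal_group_def scalar_prod_def lessThan_atLeast0 intro!: sum.cong)
    ultimately show "(\<lambda>U. (A * U) $$ (i, j)) \<in> borel_measurable \<mu>"
      by (subst measurable_cong) auto
  qed (use A' in \<open>auto simp: orthogonal_group_def\<close>)
  moreover have "A * U \<in> orthogonal_group d" if "U \<in> orthogonal_group d" for U
  proof -
    have U: "U \<in> carrier_mat d d" "transpose_mat U * U = 1\<^sub>m d" using that by (auto simp: orthogonal_group_def)
    have "transpose_mat A * (A * U) = U"
      using A' U assoc_mult_mat[of "transpose_mat A" d d A d U d] by simp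
    then have "transpose_mat (A * U) * (A * U) = 1\<^sub>m d"
      using A' U by (simp add: assoc_mult_mat[of _ d d _ d _ d] transpose_mult[of _ d d _ d])
    then show ?thesis using A' U by (simp add: orthogonal_group_def)
  qed
  ultimately have "(\<lambda>U. A * U) \<in> measurable \<mu> (restrict_space (borel_mat d) (orthogonal_group d))"
    by (intro measurable_restrict_space2) auto
  then have m: "(\<lambda>U. A * U) \<in> measurable \<mu> \<mu>" using measurable_cong_sets[OF refl sets] by blast
  have "(\<integral>U. g (A * U) \<partial>\<mu>) = (\<integral>U. g U \<partial>distr \<mu> \<mu> (\<lambda>U. A * U))"
    by (rule integral_distr[symmetric, OF m g])
  then show ?thesis unfolding inv .
qed

lemma proj_len_mult:
  assumes "A \<in> orthogonal_group d" "U \<in> orthogonal_group d"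
  shows "proj_len k d (A * U) x = proj_len k d U (\<lambda>m. \<Sum>l<d. A $$ (l, m) * x l)"
proof -
  have "(\<Sum>l<d. (A * U) $$ (l, i) * x l) = (\<Sum>m<d. U $$ (m, i) * (\<Sum>l<d. A $$ (l, m) * x l))" if "i < k" for i
  proof -
    have "(\<Sum>l<d. (A * U) $$ (l, i) * x l) = (\<Sum>l<d. \<Sum>m<d. A $$ (l, m) * U $$ (m, i) * x l)"
      using assms that k_less
      by (intro sum.cong refl) (auto simp: orthogonal_group_def scalar_prod_def lessThan_atLeast0 sum_distrib_right
          intro!: sum.cong)
    also have "\<dots> = (\<Sum>m<d. U $$ (m, i) * (\<Sum>l<d. A $$ (l, m) * x l))"
      by (subst sum.swap) (simp add: sum_distrib_left mult_ac)
    finally show ?thesis .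
  qed
  then show ?thesis by (simp add: proj_len_def L2_set_def)
qed

text \<open>Replacing U by A U amounts to applying the transpose of A to both vectors, so left
  invariance of \<mu> becomes invariance of the joint law under a common orthogonal motion.\<close>

lemma integral_proj_len_orthogonal:
  fixes F :: "real \<Rightarrow> real \<Rightarrow> real"
  assumes A: "A \<in> orthogonal_group d"
    and T: "\<And>w m. m < d \<Longrightarrow> (\<Sum>l<d. A $$ (l, m) * w l) = T w m"
    and F: "case_prod F \<in> borel_measurable (borel \<Otimes>\<^sub>M borel)"
  shows "(\<integral>U. F (proj_len k d U x) (proj_len k d U y) \<partial>\<mu>)
    = (\<integral>U. F (proj_len k d U (T x)) (proj_len k d U (T y)) \<partial>\<mu>)"
proof -
  have "(\<lambda>U. case_prod F (proj_len k d U x, proj_len k d U y)) \<in> borel_measurable \<mu>"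
    by (intro measurable_compose[OF _ F] measurable_Pair measurable_proj_len)
  then have "(\<integral>U. F (proj_len k d U x) (proj_len k d U y) \<partial>\<mu>)
      = (\<integral>U. F (proj_len k d (A * U) x) (proj_len k d (A * U) y) \<partial>\<mu>)"
    by (subst integral_invariant[OF A]) auto
  also have "\<dots> = (\<integral>U. F (proj_len k d U (T x)) (proj_len k d U (T y)) \<partial>\<mu>)"
  proof (rule Bochner_Integration.integral_cong[OF refl])
    fix U assume "U \<in> space \<mu>"
    then have "proj_len k d (A * U) w = proj_len k d U (T w)" for w
      using A by (simp add: proj_len_mult T cong: proj_len_cong)
    then show "F (proj_len k d (A * U) x) (proj_len k d (A * U) y) = F (proj_len k d U (T x)) (proj_len k d U (T y))"
      by simp
  qed
  finally show ?thesis .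
qed

lemma integral_proj_len_eq:
  fixes F :: "real \<Rightarrow> real"
  assumes "(\<Sum>l<d. (x l)\<^sup>2) = (\<Sum>l<d. (y l)\<^sup>2)" and F: "F \<in> borel_measurable borel"
  shows "(\<integral>U. F (proj_len k d U x) \<partial>\<mu>) = (\<integral>U. F (proj_len k d U y) \<partial>\<mu>)"
proof -
  obtain A T where A: "A \<in> orthogonal_group d" "\<And>w m. m < d \<Longrightarrow> (\<Sum>l<d. A $$ (l, m) * w l) = T w m"
    "\<And>m. m < d \<Longrightarrow> T x m = y m"
    "\<And>w m. (\<Sum>l<d. x l * w l) = (\<Sum>l<d. y l * w l) \<Longrightarrow> m < d \<Longrightarrow> T w m = w m"
    "\<And>w w'. (\<Sum>m<d. T w m * T w' m) = (\<Sum>m<d. w m * w' m)"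
    by (rule exists_reflection[OF assms(1)]) (rule that)
  have "proj_len k d U (T x) = proj_len k d U y" for U
    by (rule proj_len_cong) (rule A(3))
  then show ?thesis
    using integral_proj_len_orthogonal[OF A(1,2), of "\<lambda>u _. F u" x x] F by simp
qed

text \<open>Two reflections move one orthonormal pair to the other. One takes x to x'; the second
  takes the image of y to y' and fixes x', because x' is orthogonal to both.\<close>

lemma integral_proj_len_pair_eq:
  fixes F :: "real \<Rightarrow> real \<Rightarrow> real"
  assumes x: "(\<Sum>l<d. (x l)\<^sup>2) = 1" "(\<Sum>l<d. (y l)\<^sup>2) = 1" "(\<Sum>l<d. x l * y l) = 0"
    and x': "(\<Sum>l<d. (x' l)\<^sup>2) = 1" "(\<Sum>l<d. (y' l)\<^sup>2) = 1" "(\<Sum>l<d. x' l * y' l) = 0"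
    and F: "case_prod F \<in> borel_measurable (borel \<Otimes>\<^sub>M borel)"
  shows "(\<integral>U. F (proj_len k d U x) (proj_len k d U y) \<partial>\<mu>)
    = (\<integral>U. F (proj_len k d U x') (proj_len k d U y') \<partial>\<mu>)"
proof -
  have xx': "(\<Sum>l<d. (x l)\<^sup>2) = (\<Sum>l<d. (x' l)\<^sup>2)" using x(1) x'(1) by simp
  obtain A T where A: "A \<in> orthogonal_group d" "\<And>w m. m < d \<Longrightarrow> (\<Sum>l<d. A $$ (l, m) * w l) = T w m"
    "\<And>m. m < d \<Longrightarrow> T x m = x' m"
    "\<And>w m. (\<Sum>l<d. x l * w l) = (\<Sum>l<d. x' l * w l) \<Longrightarrow> m < d \<Longrightarrow> T w m = w m"
    "\<And>w w'. (\<Sum>m<d. T w m * T w' m) = (\<Sum>m<d. w m * w' m)"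
    by (rule exists_reflection[OF xx']) (rule that)
  have Ty: "(\<Sum>l<d. (T y l)\<^sup>2) = (\<Sum>l<d. (y' l)\<^sup>2)"
    using A(5)[of y y] x(2) x'(2) by (simp add: power2_eq_square)
  obtain B S where B: "B \<in> orthogonal_group d" "\<And>w m. m < d \<Longrightarrow> (\<Sum>l<d. B $$ (l, m) * w l) = S w m"
    "\<And>m. m < d \<Longrightarrow> S (T y) m = y' m"
    "\<And>w m. (\<Sum>l<d. T y l * w l) = (\<Sum>l<d. y' l * w l) \<Longrightarrow> m < d \<Longrightarrow> S w m = w m"
    "\<And>w w'. (\<Sum>m<d. S w m * S w' m) = (\<Sum>m<d. w m * w' m)"
    by (rule exists_reflection[OF Ty]) (rule that)
  have "(\<Sum>l<d. T y l * T x l) = (\<Sum>l<d. y' l * T x l)"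
    using A(5)[of y x] x(3) x'(3) A(3) by (simp add: mult.commute)
  then have STx: "S (T x) m = x' m" if "m < d" for m
    using B(4)[of "T x" m] A(3) that by simp
  have "(\<integral>U. F (proj_len k d U x) (proj_len k d U y) \<partial>\<mu>)
      = (\<integral>U. F (proj_len k d U (T x)) (proj_len k d U (T y)) \<partial>\<mu>)"
    by (rule integral_proj_len_orthogonal[OF A(1,2) F])
  also have "\<dots> = (\<integral>U. F (proj_len k d U (S (T x))) (proj_len k d U (S (T y))) \<partial>\<mu>)"
    by (rule integral_proj_len_orthogonal[OF B(1,2) F])
  also have "\<dots> = (\<integral>U. F (proj_len k d U x') (proj_len k d U y') \<partial>\<mu>)"
    using STx B(3) by (simp cong: proj_len_cong)
  finally show ?thesis .
qed

end

section \<open>Moments of the random projector\<close>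

definition unit_fun :: "nat \<Rightarrow> nat \<Rightarrow> real" where
  "unit_fun i = (\<lambda>l. if l = i then 1 else 0)"

lemma sum_unit_fun: "i < d \<Longrightarrow> (\<Sum>l<d. f l * unit_fun i l) = f i"
  by (simp add: unit_fun_def if_distrib[of "\<lambda>x. _ * x"] cong: if_cong)

lemma sum_unit_fun_mult: "i < d \<Longrightarrow> j < d \<Longrightarrow> (\<Sum>l<d. unit_fun i l * unit_fun j l) = (if i = j then 1 else 0)"
  by (subst sum_unit_fun) (auto simp: unit_fun_def)

lemma sum_unit_fun_square: "i < d \<Longrightarrow> (\<Sum>l<d. (unit_fun i l)\<^sup>2) = 1"
  by (simp add: power2_eq_square sum_unit_fun_mult)

lemma sum_rotate3:
  "(\<Sum>m\<in>A. \<Sum>i\<in>B. \<Sum>j\<in>C. f m i j) = (\<Sum>i\<in>B. \<Sum>j\<in>C. \<Sum>m\<in>A. f m i j)"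
  by (subst sum.swap, intro sum.cong refl, rule sum.swap)

context haar_subspace
begin

lemma prob_orthogonal_group [simp]: "prob (orthogonal_group d) = 1"
  using prob_space by simp

text \<open>For fixed x and y the two lengths stay in a compact rectangle as U runs over O(d), and a
  continuous F is bounded there. Exponentials of squares are thus covered too.\<close>

lemma integrable_proj_len:
  fixes F :: "real \<Rightarrow> real \<Rightarrow> real"
  assumes F: "continuous_on UNIV (case_prod F)"
  shows "integrable \<mu> (\<lambda>U. F (proj_len k d U x) (proj_len k d U y))"
proof -
  define R where "R = (\<lambda>x :: nat \<Rightarrow> real. sqrt (real d / real k) * (real k * (\<Sum>l<d. \<bar>x l\<bar>)))"
  have "compact (case_prod F ` ({0..R x} \<times> {0..R y}))"
    by (intro compact_continuous_image continuous_on_subset[OF F] compact_Times) auto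
  then obtain B where B: "\<And>v. v \<in> case_prod F ` ({0..R x} \<times> {0..R y}) \<Longrightarrow> norm v \<le> B"
    using compact_imp_bounded bounded_iff by metis
  have "case_prod F \<in> borel_measurable (borel \<Otimes>\<^sub>M borel)"
    unfolding borel_prod by (rule borel_measurable_continuous_onI[OF F])
  then have "(\<lambda>U. case_prod F (proj_len k d U x, proj_len k d U y)) \<in> borel_measurable \<mu>"
    by (rule measurable_compose[rotated]) (intro measurable_Pair measurable_proj_len)
  then have "(\<lambda>U. F (proj_len k d U x) (proj_len k d U y)) \<in> borel_measurable \<mu>" by simp
  moreover have "norm (F (proj_len k d U x) (proj_len k d U y)) \<le> B" if "U \<in> space \<mu>" for U
  proof -
    have "0 \<le> proj_len k d U w \<and> proj_len k d U w \<le> R w" for w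
      using that k_less proj_len_nonneg proj_len_bound[of U d k w] by (auto simp: R_def)
    then show ?thesis by (intro B) (auto intro!: image_eqI[where x = "(proj_len k d U x, proj_len k d U y)"])
  qed
  ultimately show ?thesis by (intro integrable_const_bound[where B = B] AE_I2) auto
qed

lemma integrable_proj_len1:
  fixes F :: "real \<Rightarrow> real"
  assumes "continuous_on UNIV F"
  shows "integrable \<mu> (\<lambda>U. F (proj_len k d U x))"
proof -
  have "continuous_on UNIV (\<lambda>(u, v :: real). F u)"
    unfolding case_prod_beta' by (rule continuous_on_compose2[OF assms]) (auto intro: continuous_intros)
  from integrable_proj_len[OF this] show ?thesis .
qed

lemma proj_len_zero: "(\<Sum>l<d. (x l)\<^sup>2) = 0 \<Longrightarrow> proj_len k d U x = 0"
  by (subst (asm) sum_nonneg_eq_0_iff) (auto simp: proj_len_def L2_set_def)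

text \<open>The trace of P is k, scaled by d / k.\<close>

lemma sum_proj_len_unit_square:
  assumes "U \<in> orthogonal_group d"
  shows "(\<Sum>m<d. (proj_len k d U (unit_fun m))\<^sup>2) = real d"
proof -
  have "(\<Sum>m<d. (proj_len k d U (unit_fun m))\<^sup>2) = (\<Sum>m<d. real d / real k * (\<Sum>i<k. (U $$ (m, i))\<^sup>2))"
    by (simp add: proj_len_square sum_unit_fun)
  also have "\<dots> = real d / real k * (\<Sum>i<k. \<Sum>m<d. (U $$ (m, i))\<^sup>2)"
    by (subst sum.swap) (simp add: sum_distrib_left)
  also have "\<dots> = real d / real k * (\<Sum>i<k. 1)"
    using k_less orthogonal_group_columns[OF assms] by (simp add: power2_eq_square)
  finally show ?thesis using k_pos by simp
qed

text \<open>All coordinate vectors have the same expectation as a given unit vector, and their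
  squared lengths sum to d. General vectors follow by scaling.\<close>

lemma integral_proj_len_square: "(\<integral>U. (proj_len k d U x)\<^sup>2 \<partial>\<mu>) = (\<Sum>l<d. (x l)\<^sup>2)"
proof -
  have unit: "(\<integral>U. (proj_len k d U x)\<^sup>2 \<partial>\<mu>) = 1" if x: "(\<Sum>l<d. (x l)\<^sup>2) = 1" for x
  proof -
    have "real d * (\<integral>U. (proj_len k d U x)\<^sup>2 \<partial>\<mu>) = (\<Sum>m<d. \<integral>U. (proj_len k d U (unit_fun m))\<^sup>2 \<partial>\<mu>)"
    proof -
      have "(\<integral>U. (proj_len k d U (unit_fun m))\<^sup>2 \<partial>\<mu>) = (\<integral>U. (proj_len k d U x)\<^sup>2 \<partial>\<mu>)" if "m < d" for m
        by (rule integral_proj_len_eq) (use x that in \<open>auto simp: sum_unit_fun_square\<close>)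
      then show ?thesis by simp
    qed
    also have "\<dots> = (\<integral>U. (\<Sum>m<d. (proj_len k d U (unit_fun m))\<^sup>2) \<partial>\<mu>)"
      by (rule Bochner_Integration.integral_sum[symmetric]) (intro integrable_proj_len1 continuous_intros)
    also have "\<dots> = (\<integral>U. real d \<partial>\<mu>)"
      by (rule Bochner_Integration.integral_cong) (auto simp: sum_proj_len_unit_square)
    also have "\<dots> = real d" by (simp add: prob_space)
    finally show ?thesis using k_less by simp
  qed
  show ?thesis
  proof (cases "(\<Sum>l<d. (x l)\<^sup>2) = 0")
    case True
    then show ?thesis by (simp add: proj_len_zero)
  next
    case False
    from exists_normalization[OF False] obtain r :: real where r: "(\<Sum>l<d. (x l)\<^sup>2) = r\<^sup>2" "(\<Sum>l<d. (x l / r)\<^sup>2) = 1"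
      "\<And>U. proj_len k d U x = r * proj_len k d U (\<lambda>l. x l / r)" by metis
    then show ?thesis using unit[OF r(2)] unfolding r(1) by (simp add: r(3)[of _] power_mult_distrib)
  qed
qed

text \<open>By invariance the unit vector may be averaged over \<open>{-1, 1}\<^sup>d / \<surd>d\<close>, which makes the
  tail of \<open>proj_len\<close> that of a Rademacher sum.\<close>

lemma exp_moment_proj_len:
  assumes "(\<Sum>l<d. (x l)\<^sup>2) \<le> 1"
  shows "(\<integral>U. exp ((proj_len k d U x)\<^sup>2 / 4) \<partial>\<mu>) \<le> 2"
proof -
  have cont: "continuous_on UNIV (\<lambda>u :: real. exp (u\<^sup>2 / 4))" by (intro continuous_intros) auto
  have unit: "(\<integral>U. exp ((proj_len k d U x)\<^sup>2 / 4) \<partial>\<mu>) \<le> 2" if x: "(\<Sum>l<d. (x l)\<^sup>2) = 1" for x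
  proof -
    define h where "h = (\<lambda>\<epsilon> :: nat \<Rightarrow> real. \<lambda>l. \<epsilon> l / sqrt (real d))"
    have h1: "(\<Sum>l<d. (h \<epsilon> l)\<^sup>2) = 1" if "\<epsilon> \<in> signs d" for \<epsilon>
      using k_less that by (simp add: h_def power_divide signs_square)
    have pointwise: "(\<Sum>\<epsilon>\<in>signs d. exp ((proj_len k d U (h \<epsilon>))\<^sup>2 / 4)) \<le> 2 ^ d * exp (1 / 2)"
      if U: "U \<in> orthogonal_group d" for U
    proof -
      have "exp ((proj_len k d U (h \<epsilon>))\<^sup>2 / 4)
          \<le> (\<Sum>i<k. 1 / real k * exp (1 / 4 * (0 + (\<Sum>l<d. U $$ (l, i) * \<epsilon> l))\<^sup>2))" for \<epsilon>
      proof -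
        have "(\<Sum>l<d. U $$ (l, i) * h \<epsilon> l)\<^sup>2 = (\<Sum>l<d. U $$ (l, i) * \<epsilon> l)\<^sup>2 / real d" for i
          unfolding h_def by (simp add: power_divide flip: sum_divide_distrib)
        \<comment> \<open>The factors d of \<open>proj_len\<close> and of h cancel, which leaves an
          average over the k columns. Jensen's inequality for \<open>exp\<close> then reduces to one
          column, so the bound does not depend on k.\<close>
        then have "(proj_len k d U (h \<epsilon>))\<^sup>2 / 4 = (\<Sum>i<k. (1 / real k) *\<^sub>R (1 / 4 * (0 + (\<Sum>l<d. U $$ (l, i) * \<epsilon> l))\<^sup>2))"
          using k_less by (simp add: proj_len_square flip: sum_divide_distrib)
        moreover have "convex_on UNIV (exp :: real \<Rightarrow> real)"
          by (intro f''_ge0_imp_convex) (auto intro!: derivative_eq_intros)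
        moreover have "{..<k} \<noteq> {}" using k_pos by (simp add: lessThan_empty_iff)
        ultimately show ?thesis
          using convex_on_sum[of "{..<k}" UNIV exp "\<lambda>_. 1 / real k" "\<lambda>i. 1 / 4 * (0 + (\<Sum>l<d. U $$ (l, i) * \<epsilon> l))\<^sup>2"] k_pos
          by auto
      qed
      then have "(\<Sum>\<epsilon>\<in>signs d. exp ((proj_len k d U (h \<epsilon>))\<^sup>2 / 4))
          \<le> (\<Sum>\<epsilon>\<in>signs d. \<Sum>i<k. 1 / real k * exp (1 / 4 * (0 + (\<Sum>l<d. U $$ (l, i) * \<epsilon> l))\<^sup>2))"
        by (intro sum_mono)
      also have "\<dots> = (\<Sum>i<k. 1 / real k * (\<Sum>\<epsilon>\<in>signs d. exp (1 / 4 * (0 + (\<Sum>l<d. U $$ (l, i) * \<epsilon> l))\<^sup>2)))"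
        by (subst sum.swap) (simp add: sum_distrib_left)
      also have "\<dots> \<le> (\<Sum>i<k. 1 / real k * (2 ^ d * exp (1 / 2)))"
      proof (intro sum_mono mult_left_mono)
        fix i assume "i \<in> {..<k}"
        then have "(\<Sum>l<d. (U $$ (l, i))\<^sup>2) = 1"
          using orthogonal_group_columns[OF U, of i i] k_less by (simp add: power2_eq_square)
        \<comment> \<open>With t = 1/4 and a column of norm 1 the new parameter t / (1 - 2 t) is
          1/2.\<close>
        then show "(\<Sum>\<epsilon>\<in>signs d. exp (1 / 4 * (0 + (\<Sum>l<d. U $$ (l, i) * \<epsilon> l))\<^sup>2)) \<le> 2 ^ d * exp (1 / 2)"
          using sum_signs_exp_square_le[of "1 / 4" "\<lambda>l. U $$ (l, i)" d 0] by simp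
      qed auto
      finally show ?thesis using k_pos by simp
    qed
    have "2 ^ d * (\<integral>U. exp ((proj_len k d U x)\<^sup>2 / 4) \<partial>\<mu>) = (\<Sum>\<epsilon>\<in>signs d. \<integral>U. exp ((proj_len k d U x)\<^sup>2 / 4) \<partial>\<mu>)"
      by (simp add: card_signs)
    also have "\<dots> = (\<Sum>\<epsilon>\<in>signs d. \<integral>U. exp ((proj_len k d U (h \<epsilon>))\<^sup>2 / 4) \<partial>\<mu>)"
    proof (intro sum.cong refl)
      fix \<epsilon> assume "\<epsilon> \<in> signs d"
      then show "(\<integral>U. exp ((proj_len k d U x)\<^sup>2 / 4) \<partial>\<mu>) = (\<integral>U. exp ((proj_len k d U (h \<epsilon>))\<^sup>2 / 4) \<partial>\<mu>)"
        using integral_proj_len_eq[of x "h \<epsilon>" "\<lambda>u. exp (u\<^sup>2 / 4)"] x h1 by simp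
    qed
    also have "\<dots> = (\<integral>U. (\<Sum>\<epsilon>\<in>signs d. exp ((proj_len k d U (h \<epsilon>))\<^sup>2 / 4)) \<partial>\<mu>)"
      by (rule Bochner_Integration.integral_sum[symmetric]) (intro integrable_proj_len1 cont)
    also have "\<dots> \<le> (\<integral>U. 2 ^ d * exp (1 / 2) \<partial>\<mu>)"
      by (intro integral_mono Bochner_Integration.integrable_sum integrable_proj_len1[OF cont] pointwise) auto
    also have "\<dots> = 2 ^ d * exp (1 / 2)" by (simp add: prob_space)
    finally have "(\<integral>U. exp ((proj_len k d U x)\<^sup>2 / 4) \<partial>\<mu>) \<le> exp (1 / 2)" by simp
    also have "exp (1 / 2) \<le> (2 :: real)"
    proof -
      have "exp (1 / 2 :: real) \<le> 1 + 1 / 2 + (1 / 2)\<^sup>2" by (rule exp_bound) auto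
      then show ?thesis by (simp add: power2_eq_square)
    qed
    finally show ?thesis .
  qed
  show ?thesis
  proof (cases "(\<Sum>l<d. (x l)\<^sup>2) = 0")
    case True
    then show ?thesis by (simp add: proj_len_zero prob_space)
  next
    case False
    from exists_normalization[OF False] obtain r :: real where r: "0 < r" "(\<Sum>l<d. (x l)\<^sup>2) = r\<^sup>2"
      "(\<Sum>l<d. (x l / r)\<^sup>2) = 1" "\<And>U. proj_len k d U x = r * proj_len k d U (\<lambda>l. x l / r)" by metis
    have r1: "r \<le> 1" using assms r(1) unfolding r(2) by (simp add: power_le_one_iff)
    from unit[OF r(3)] have "(\<integral>U. exp ((proj_len k d U (\<lambda>l. x l / r))\<^sup>2 / 4) \<partial>\<mu>) \<le> 2" .
    moreover have "(\<integral>U. exp ((proj_len k d U x)\<^sup>2 / 4) \<partial>\<mu>) \<le> (\<integral>U. exp ((proj_len k d U (\<lambda>l. x l / r))\<^sup>2 / 4) \<partial>\<mu>)"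
    proof (intro integral_mono integrable_proj_len1[OF cont])
      fix U
      have "proj_len k d U x \<le> proj_len k d U (\<lambda>l. x l / r)"
        unfolding r(4) using r(1) r1 by (simp add: mult_left_le_one_le proj_len_nonneg)
      then show "exp ((proj_len k d U x)\<^sup>2 / 4) \<le> exp ((proj_len k d U (\<lambda>l. x l / r))\<^sup>2 / 4)"
        by (simp add: power_mono proj_len_nonneg)
    qed
    ultimately show ?thesis by linarith
  qed
qed

text \<open>The two identities are \<open>trace P = k\<close>, squared, and \<open>trace P\<^sup>2 = k\<close>; the off-diagonal entries of \<open>P\<close>
  are reached by polarisation with \<open>(e\<^sub>l \<plusminus> e\<^sub>m) / \<surd>2\<close>.\<close>

lemma fourth_moments:
  obtains m2 m11 where
    "\<And>x. (\<Sum>l<d. (x l)\<^sup>2) = 1 \<Longrightarrow> (\<integral>U. (proj_len k d U x) ^ 4 \<partial>\<mu>) = m2"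
    "\<And>x y. (\<Sum>l<d. (x l)\<^sup>2) = 1 \<Longrightarrow> (\<Sum>l<d. (y l)\<^sup>2) = 1 \<Longrightarrow> (\<Sum>l<d. x l * y l) = 0 \<Longrightarrow>
      (\<integral>U. (proj_len k d U x)\<^sup>2 * (proj_len k d U y)\<^sup>2 \<partial>\<mu>) = m11"
    "real d * m2 + real d * (real d - 1) * m11 = (real d)\<^sup>2"
    "real d * m2 + real d * (real d - 1) * ((m2 - m11) / 2) = (real d)\<^sup>2 / real k"
proof -
  have d: "0 < d" "1 < d" using k_pos k_less by auto
  define a where "a = (\<lambda>U x. (proj_len k d U x)\<^sup>2)"
  define m2 where "m2 = (\<integral>U. (proj_len k d U (unit_fun 0)) ^ 4 \<partial>\<mu>)"
  define m11 where "m11 = (\<integral>U. a U (unit_fun 0) * a U (unit_fun 1) \<partial>\<mu>)"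
  have m2: "(\<integral>U. (proj_len k d U x) ^ 4 \<partial>\<mu>) = m2" if "(\<Sum>l<d. (x l)\<^sup>2) = 1" for x
    unfolding m2_def by (rule integral_proj_len_eq) (use that d in \<open>auto simp: sum_unit_fun_square\<close>)
  then have m2': "(\<integral>U. a U x * a U x \<partial>\<mu>) = m2" if "(\<Sum>l<d. (x l)\<^sup>2) = 1" for x
    using that by (simp add: a_def flip: power_add)
  have m11: "(\<integral>U. a U x * a U y \<partial>\<mu>) = m11"
    if "(\<Sum>l<d. (x l)\<^sup>2) = 1" "(\<Sum>l<d. (y l)\<^sup>2) = 1" "(\<Sum>l<d. x l * y l) = 0" for x y
    unfolding m11_def a_def
    by (rule integral_proj_len_pair_eq) (use that d in \<open>auto simp: sum_unit_fun_square sum_unit_fun_mult\<close>)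
  have int: "integrable \<mu> (\<lambda>U. a U x * a U y)" for x y
    unfolding a_def
    by (rule integrable_proj_len) (auto simp: case_prod_beta' intro!: continuous_intros)
  have pairs: "(\<Sum>l<d. \<Sum>m<d. if l = m then p else q) = real d * p + real d * (real d - 1) * q" for p q :: real
  proof -
    have "(\<Sum>m<d. if l = m then p else q) = p + (real d - 1) * q" if "l < d" for l
    proof -
      have "(\<Sum>m<d. if l = m then p else q) = (\<Sum>m<d. q + (if l = m then p - q else 0))"
        by (intro sum.cong) auto
      also have "\<dots> = real d * q + (p - q)" using that by (simp add: sum.distrib)
      finally show ?thesis by (simp add: algebra_simps)
    qed
    then have "(\<Sum>l<d. \<Sum>m<d. if l = m then p else q) = (\<Sum>l<d. p + (real d - 1) * q)"
      by (intro sum.cong) auto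
    then show ?thesis by (simp add: algebra_simps)
  qed
  have unit_pair: "(\<integral>U. a U (unit_fun l) * a U (unit_fun m) \<partial>\<mu>) = (if l = m then m2 else m11)"
    if "l < d" "m < d" for l m
    using that by (auto simp: m2' m11 sum_unit_fun_square sum_unit_fun_mult)
  have "(\<Sum>l<d. \<Sum>m<d. if l = m then m2 else m11) = (\<Sum>l<d. \<Sum>m<d. \<integral>U. a U (unit_fun l) * a U (unit_fun m) \<partial>\<mu>)"
    by (intro sum.cong refl) (simp add: unit_pair)
  also have "\<dots> = (\<integral>U. (\<Sum>l<d. \<Sum>m<d. a U (unit_fun l) * a U (unit_fun m)) \<partial>\<mu>)"
    by (simp add: Bochner_Integration.integral_sum int)
  also have "\<dots> = (\<integral>U. (real d)\<^sup>2 \<partial>\<mu>)"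
  proof (rule Bochner_Integration.integral_cong[OF refl])
    fix U assume "U \<in> space \<mu>"
    then have "(\<Sum>m<d. a U (unit_fun m)) = real d" by (simp add: a_def sum_proj_len_unit_square)
    then show "(\<Sum>l<d. \<Sum>m<d. a U (unit_fun l) * a U (unit_fun m)) = (real d)\<^sup>2"
      by (simp add: power2_eq_square flip: sum_product)
  qed
  finally have eq1: "real d * m2 + real d * (real d - 1) * m11 = (real d)\<^sup>2"
    unfolding pairs by (simp add: prob_space)

  \<comment> \<open>The entries of (d/k) P.\<close>
  define b where "b = (\<lambda>U l m. real d / real k * (\<Sum>i<k. U $$ (l, i) * U $$ (m, i)))"
  have a_unit: "a U (unit_fun l) = b U l l" if "l < d" for U l
    using that unfolding a_def b_def proj_len_square by (simp add: sum_unit_fun power2_eq_square)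
  \<comment> \<open>For s = 1 and s = -1, with l and m distinct, these are two orthonormal vectors
    in the plane of the l-th and m-th unit vectors.\<close>
  define p where "p = (\<lambda>s l m j. (unit_fun l j + s * unit_fun m j) / sqrt 2 :: real)"
  have a_p: "a U (p s l m) = (b U l l + 2 * s * b U l m + s\<^sup>2 * b U m m) / 2" if "l < d" "m < d" for U s l m
  proof -
    have "(\<Sum>j<d. U $$ (j, i) * p s l m j) = (U $$ (l, i) + s * U $$ (m, i)) / sqrt 2" for i
    proof -
      have "(\<Sum>j<d. U $$ (j, i) * p s l m j)
          = ((\<Sum>j<d. U $$ (j, i) * unit_fun l j) + s * (\<Sum>j<d. U $$ (j, i) * unit_fun m j)) / sqrt 2"
        by (simp add: p_def distrib_left sum.distrib sum_distrib_left sum_divide_distrib add_divide_distrib mult_ac)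
      then show ?thesis using that by (simp add: sum_unit_fun)
    qed
    then have "a U (p s l m) = real d / real k * (\<Sum>i<k. (U $$ (l, i) + s * U $$ (m, i))\<^sup>2 / 2)"
      by (simp add: a_def proj_len_square power_divide)
    also have "(\<Sum>i<k. (U $$ (l, i) + s * U $$ (m, i))\<^sup>2 / 2)
        = (\<Sum>i<k. U $$ (l, i) * U $$ (l, i) / 2 + s * (U $$ (l, i) * U $$ (m, i)) + s\<^sup>2 * (U $$ (m, i) * U $$ (m, i)) / 2)"
      by (intro sum.cong refl) (simp add: power2_eq_square algebra_simps)
    also have "\<dots> = (\<Sum>i<k. U $$ (l, i) * U $$ (l, i)) / 2 + s * (\<Sum>i<k. U $$ (l, i) * U $$ (m, i))
        + s\<^sup>2 * (\<Sum>i<k. U $$ (m, i) * U $$ (m, i)) / 2"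
      by (simp add: sum.distrib sum_distrib_left sum_divide_distrib)
    finally show ?thesis by (simp add: b_def algebra_simps add_divide_distrib)
  qed
  have pp: "(\<Sum>j<d. p s l m j * p t l m j) = (1 + s * t) / 2" if "l < d" "m < d" "l \<noteq> m" for s t l m
  proof -
    have "(\<Sum>j<d. p s l m j * p t l m j)
        = (\<Sum>j<d. (unit_fun l j * unit_fun l j + (s + t) * (unit_fun l j * unit_fun m j)
            + s * t * (unit_fun m j * unit_fun m j)) / 2)"
      by (intro sum.cong refl) (simp add: p_def algebra_simps flip: add_divide_distrib)
    also have "\<dots> = ((\<Sum>j<d. unit_fun l j * unit_fun l j) + (s + t) * (\<Sum>j<d. unit_fun l j * unit_fun m j)
            + s * t * (\<Sum>j<d. unit_fun m j * unit_fun m j)) / 2"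
      by (simp add: sum.distrib sum_distrib_left flip: sum_divide_distrib)
    finally show ?thesis using that by (simp add: sum_unit_fun_mult)
  qed
  \<comment> \<open>The values a(p 1) and a(p (-1)) are (b_ll + b_mm) / 2 plus and minus b_lm, so
    their product is a difference of two squares. For distinct l and m, taking means turns E b_lm^2
    into (m2 + m11) / 2 - m11 = (m2 - m11) / 2.\<close>
  have b_square: "b U l m ^ 2 = (a U (unit_fun l) * a U (unit_fun l) + 2 * (a U (unit_fun l) * a U (unit_fun m))
      + a U (unit_fun m) * a U (unit_fun m)) / 4 - a U (p 1 l m) * a U (p (-1) l m)"
    if "l < d" "m < d" for U l m
    using that by (simp add: a_p a_unit) (simp add: field_simps power2_eq_square)
  have b_int: "integrable \<mu> (\<lambda>U. (b U l m)\<^sup>2) \<and> (\<integral>U. (b U l m)\<^sup>2 \<partial>\<mu>) = (if l = m then m2 else (m2 - m11) / 2)"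
    if "l < d" "m < d" for l m
  proof (cases "l = m")
    case True
    then show ?thesis using that unit_pair[of l l] int[of "unit_fun l" "unit_fun l"]
      by (simp add: a_unit power2_eq_square)
  next
    case False
    have "(\<integral>U. a U (p 1 l m) * a U (p (-1) l m) \<partial>\<mu>) = m11"
      using pp[OF that False, of 1 1] pp[OF that False, of "-1" "-1"] pp[OF that False, of 1 "-1"]
      by (intro m11) (auto simp: power2_eq_square)
    then show ?thesis using False that unfolding b_square[OF that]
      by (simp add: int unit_pair integral_diff integral_add field_simps)
  qed
  have "(\<Sum>l<d. \<Sum>m<d. if l = m then m2 else (m2 - m11) / 2) = (\<Sum>l<d. \<Sum>m<d. \<integral>U. (b U l m)\<^sup>2 \<partial>\<mu>)"
    by (intro sum.cong refl) (simp add: b_int)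
  also have "\<dots> = (\<integral>U. (\<Sum>l<d. \<Sum>m<d. (b U l m)\<^sup>2) \<partial>\<mu>)"
  proof -
    have "(\<integral>U. (\<Sum>l<d. \<Sum>m<d. (b U l m)\<^sup>2) \<partial>\<mu>) = (\<Sum>l<d. \<integral>U. (\<Sum>m<d. (b U l m)\<^sup>2) \<partial>\<mu>)"
      using b_int by (intro Bochner_Integration.integral_sum Bochner_Integration.integrable_sum) auto
    also have "\<dots> = (\<Sum>l<d. \<Sum>m<d. \<integral>U. (b U l m)\<^sup>2 \<partial>\<mu>)"
      using b_int by (intro sum.cong refl Bochner_Integration.integral_sum) auto
    finally show ?thesis ..
  qed
  also have "\<dots> = (\<integral>U. (real d)\<^sup>2 / real k \<partial>\<mu>)"
  proof (rule Bochner_Integration.integral_cong[OF refl])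
    fix U assume "U \<in> space \<mu>"
    then have U: "U \<in> orthogonal_group d" by simp
    \<comment> \<open>Exchanging the sums turns the squared Frobenius norm of P into that of the
      Gram matrix of the k columns, which is the identity.\<close>
    have "(\<Sum>l<d. \<Sum>m<d. (\<Sum>i<k. U $$ (l, i) * U $$ (m, i))\<^sup>2)
        = (\<Sum>l<d. \<Sum>m<d. \<Sum>i<k. \<Sum>j<k. (U $$ (l, i) * U $$ (l, j)) * (U $$ (m, i) * U $$ (m, j)))"
      unfolding power2_eq_square sum_product by (intro sum.cong refl) (simp add: mult_ac)
    also have "\<dots> = (\<Sum>l<d. \<Sum>i<k. \<Sum>j<k. \<Sum>m<d. (U $$ (l, i) * U $$ (l, j)) * (U $$ (m, i) * U $$ (m, j)))"
      by (intro sum.cong refl sum_rotate3)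
    also have "\<dots> = (\<Sum>i<k. \<Sum>j<k. \<Sum>l<d. \<Sum>m<d. (U $$ (l, i) * U $$ (l, j)) * (U $$ (m, i) * U $$ (m, j)))"
      by (rule sum_rotate3)
    also have "\<dots> = (\<Sum>i<k. \<Sum>j<k. (\<Sum>l<d. U $$ (l, i) * U $$ (l, j))\<^sup>2)"
      unfolding power2_eq_square sum_product ..
    also have "\<dots> = (\<Sum>i<k. \<Sum>j<k. if i = j then 1 else 0)"
      using k_less by (intro sum.cong refl) (simp add: orthogonal_group_columns[OF U])
    also have "\<dots> = real k" by simp
    finally have "(\<Sum>l<d. \<Sum>m<d. (\<Sum>i<k. U $$ (l, i) * U $$ (m, i))\<^sup>2) = real k" .
    then have "(\<Sum>l<d. \<Sum>m<d. (b U l m)\<^sup>2) = (real d / real k)\<^sup>2 * real k"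
      by (simp only: b_def power_mult_distrib flip: sum_distrib_left)
    then show "(\<Sum>l<d. \<Sum>m<d. (b U l m)\<^sup>2) = (real d)\<^sup>2 / real k"
      using k_pos by (simp add: power2_eq_square)
  qed
  finally have eq2: "real d * m2 + real d * (real d - 1) * ((m2 - m11) / 2) = (real d)\<^sup>2 / real k"
    unfolding pairs by (simp add: prob_space)
  show ?thesis
    by (rule that[of m2 m11]) (rule m2 m11[unfolded a_def] eq1 eq2; assumption)+
qed

text \<open>Solving the two linear equations gives m2 - 1 = 2 (d - k) / (k (d + 2)), which increases
  with d and is therefore at least its value at d = k + 1. As m2 + (d - 1) m11 = d, the bound m2
  \<ge> 1 forces m11 \<le> 1.\<close>

lemma fourth_moment_bounds:
  shows "(\<Sum>l<d. (x l)\<^sup>2) = 1 \<Longrightarrow> 1 + 2 / (real k * (real k + 3)) \<le> (\<integral>U. (proj_len k d U x) ^ 4 \<partial>\<mu>)"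
    and "(\<Sum>l<d. (x l)\<^sup>2) = 1 \<Longrightarrow> (\<Sum>l<d. (y l)\<^sup>2) = 1 \<Longrightarrow> (\<Sum>l<d. x l * y l) = 0 \<Longrightarrow>
      (\<integral>U. (proj_len k d U x)\<^sup>2 * (proj_len k d U y)\<^sup>2 \<partial>\<mu>) \<le> 1"
proof -
  obtain m2 m11 where m2: "\<And>x. (\<Sum>l<d. (x l)\<^sup>2) = 1 \<Longrightarrow> (\<integral>U. (proj_len k d U x) ^ 4 \<partial>\<mu>) = m2"
    and m11: "\<And>x y. (\<Sum>l<d. (x l)\<^sup>2) = 1 \<Longrightarrow> (\<Sum>l<d. (y l)\<^sup>2) = 1 \<Longrightarrow> (\<Sum>l<d. x l * y l) = 0 \<Longrightarrow>
      (\<integral>U. (proj_len k d U x)\<^sup>2 * (proj_len k d U y)\<^sup>2 \<partial>\<mu>) = m11"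
    and eq1: "real d * m2 + real d * (real d - 1) * m11 = (real d)\<^sup>2"
    and eq2: "real d * m2 + real d * (real d - 1) * ((m2 - m11) / 2) = (real d)\<^sup>2 / real k"
    by (rule fourth_moments) (rule that)
  have d: "real d \<ge> real k + 1" "real k \<ge> 1" "real d > 0" using k_pos k_less by auto
  have e1: "m2 + (real d - 1) * m11 = real d"
  proof -
    have "real d * (m2 + (real d - 1) * m11) = real d * real d"
      using eq1 by (simp add: algebra_simps power2_eq_square)
    then show ?thesis using d by simp
  qed
  have e2: "2 * m2 + (real d - 1) * (m2 - m11) = 2 * real d / real k"
  proof -
    have "real d * (2 * m2 + (real d - 1) * (m2 - m11))
        = 2 * (real d * m2 + real d * (real d - 1) * ((m2 - m11) / 2))"
      by (simp add: field_simps)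
    also have "\<dots> = 2 * (real d)\<^sup>2 / real k" unfolding eq2 by simp
    also have "\<dots> = real d * (2 * real d / real k)" by (simp add: power2_eq_square)
    finally have "real d * (2 * m2 + (real d - 1) * (m2 - m11)) = real d * (2 * real d / real k)" .
    then show ?thesis using d by (subst (asm) mult_left_cancel) auto
  qed
  have "m2 * (real d + 2) = 2 * real d / real k + real d"
    using e1 e2 by (simp add: algebra_simps)
  then have "(m2 - 1) * (real d + 2) = 2 * real d / real k - 2" by (simp add: algebra_simps)
  also have "\<dots> = 2 * (real d - real k) / real k" using d by (simp add: field_simps)
  finally have "(m2 - 1) * (real k * (real d + 2)) = 2 * (real d - real k)"
    using d by (simp add: field_simps)
  then have m2_eq: "m2 - 1 = 2 * (real d - real k) / (real k * (real d + 2))"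
    using d by (subst nonzero_eq_divide_eq) auto
  \<comment> \<open>This is 1 / (k + 3) \<le> (d - k) / (d + 2), cleared of denominators.\<close>
  have "0 \<le> (real d - real k - 1) * (real k + 2)" using d by simp
  then have "(real d + 2) \<le> (real d - real k) * (real k + 3)" by (simp add: algebra_simps)
  then have "1 / (real k + 3) \<le> (real d - real k) / (real d + 2)" using d by (simp add: field_simps)
  then have "2 / real k * (1 / (real k + 3)) \<le> 2 / real k * ((real d - real k) / (real d + 2))"
    using d by (intro mult_left_mono) auto
  then have m2_ge: "1 + 2 / (real k * (real k + 3)) \<le> m2" using m2_eq by simp
  then show "1 + 2 / (real k * (real k + 3)) \<le> (\<integral>U. (proj_len k d U x) ^ 4 \<partial>\<mu>)" if "(\<Sum>l<d. (x l)\<^sup>2) = 1"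
    using m2[OF that] by simp
  have "1 \<le> m2" using m2_ge d by (smt (verit) divide_nonneg_nonneg mult_nonneg_nonneg)
  then have "(real d - 1) * m11 \<le> (real d - 1) * 1" using e1 by simp
  then have "m11 \<le> 1" using d by (subst (asm) mult_le_cancel_left_pos) auto
  then show "(\<integral>U. (proj_len k d U x)\<^sup>2 * (proj_len k d U y)\<^sup>2 \<partial>\<mu>) \<le> 1"
    if "(\<Sum>l<d. (x l)\<^sup>2) = 1" "(\<Sum>l<d. (y l)\<^sup>2) = 1" "(\<Sum>l<d. x l * y l) = 0"
    using m11[OF that] by simp
qed

end

section \<open>Concentration\<close>

text \<open>Both signs rest on 1 - y \<le> exp (- y). For y \<ge> 0 it gives exp y - 1 \<le> y exp
  y, which is used twice. For y < 0 it gives exp y \<le> 1 / (1 - y) \<le> 1 + y + y^2, because (1 -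
  y) (1 + y + y^2) = 1 - y^3 \<ge> 1.\<close>

lemma exp_le_second_order: "exp (y :: real) \<le> 1 + y + y\<^sup>2 * exp \<bar>y\<bar>"
proof (cases "0 \<le> y")
  case True
  have "(1 - y) * exp y \<le> exp (- y) * exp y"
    using exp_ge_add_one_self[of "- y"] by (intro mult_right_mono) auto
  then have 1: "exp y - 1 \<le> y * exp y" by (simp add: algebra_simps flip: exp_add)
  have "exp y - 1 - y \<le> y * exp y - y" using 1 by simp
  also have "\<dots> = y * (exp y - 1)" by (simp add: algebra_simps)
  also have "\<dots> \<le> y * (y * exp y)" using True 1 by (intro mult_left_mono)
  finally show ?thesis using True by (simp add: power2_eq_square algebra_simps)
next
  case False
  have "(1 - y) * (1 + y + y\<^sup>2) = 1 - y ^ 3" by (simp add: algebra_simps power2_eq_square power3_eq_cube)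
  moreover have "y ^ 3 \<le> 0" using False by (simp add: power_le_zero_eq)
  ultimately have "1 \<le> (1 - y) * (1 + y + y\<^sup>2)" by simp
  then have "exp y * 1 \<le> exp y * ((1 - y) * (1 + y + y\<^sup>2))" by (intro mult_left_mono) auto
  also have "\<dots> = (exp y * (1 - y)) * (1 + y + y\<^sup>2)" by simp
  also have "\<dots> \<le> 1 * (1 + y + y\<^sup>2)"
  proof (rule mult_right_mono)
    have "exp y * (1 - y) \<le> exp y * exp (- y)" using exp_ge_add_one_self[of "- y"] by (intro mult_left_mono) auto
    then show "exp y * (1 - y) \<le> 1" by (simp flip: exp_add)
    have "0 \<le> (1 + y / 2)\<^sup>2 + 3 / 4 * y\<^sup>2" by simp
    then show "0 \<le> 1 + y + y\<^sup>2" by (simp add: power2_eq_square algebra_simps)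
  qed
  also have "\<dots> \<le> 1 + y + y\<^sup>2 * exp \<bar>y\<bar>" by (simp add: mult_le_cancel_left1)
  finally show ?thesis by simp
qed

lemma power_le_fact_exp: "0 \<le> (y :: real) \<Longrightarrow> y ^ m \<le> fact m * exp y"
proof -
  assume y: "0 \<le> y"
  have "y ^ m /\<^sub>R fact m = (\<Sum>n\<in>{m}. y ^ n /\<^sub>R fact n)" by simp
  also have "\<dots> \<le> (\<Sum>n. y ^ n /\<^sub>R fact n)"
    by (intro sum_le_suminf summable_exp_generic) (use y in auto)
  finally show ?thesis by (simp add: exp_def field_simps)
qed

text \<open>This is \<delta> t / 2 for the parameter t chosen in
  \<open>exp_moment_negative_mean\<close>. The explicit formula makes visible that the rate is the
  same for all d, n and vectors once \<delta>, s and K are.\<close>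

definition chernoff_rate :: "real \<Rightarrow> real \<Rightarrow> real \<Rightarrow> real" where
  "chernoff_rate \<delta> s K = \<delta> / 2 * min (s / 2) (\<delta> * s\<^sup>2 / (16 * K))"

lemma chernoff_rate_pos: "0 < \<delta> \<Longrightarrow> 0 < s \<Longrightarrow> 0 < K \<Longrightarrow> 0 < chernoff_rate \<delta> s K"
  by (simp add: chernoff_rate_def)

context prob_space
begin

text \<open>For small t the linear term - t \<delta> beats the quadratic remainder, which is
  uniformly controlled since g^2 exp (t |g|) \<le> (8 / s^2) exp (s |g|) for t \<le> s / 2.\<close>

lemma exp_moment_negative_mean:
  fixes g :: "'a \<Rightarrow> real"
  assumes [measurable]: "g \<in> borel_measurable M"
    and g: "integrable M g" "expectation g \<le> - \<delta>" and "0 < \<delta>"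
    and e: "integrable M (\<lambda>x. exp (s * \<bar>g x\<bar>))" "expectation (\<lambda>x. exp (s * \<bar>g x\<bar>)) \<le> K" and "0 < s"
  obtains t where "0 < t" "integrable M (\<lambda>x. exp (t * g x))"
    "expectation (\<lambda>x. exp (t * g x)) \<le> exp (- chernoff_rate \<delta> s K)"
proof
  have "(1 :: real) = expectation (\<lambda>x. 1)" by (simp add: prob_space)
  also have "\<dots> \<le> expectation (\<lambda>x. exp (s * \<bar>g x\<bar>))"
    using \<open>0 < s\<close> by (intro integral_mono e) auto
  finally have K: "1 \<le> K" using e(2) by simp
  \<comment> \<open>The bound s / 2 leaves half of the exponent s to absorb the factor g^2; the
    other bound makes the remainder t^2 (8 / s^2) K at most t \<delta> / 2.\<close>
  define t where "t = min (s / 2) (\<delta> * s\<^sup>2 / (16 * K))"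
  have t: "0 < t" "t \<le> s / 2" "t \<le> \<delta> * s\<^sup>2 / (16 * K)"
    using \<open>0 < s\<close> \<open>0 < \<delta>\<close> K by (auto simp: t_def)
  show "0 < t" by fact
  have bound: "exp (t * g x) \<le> 1 + t * g x + t\<^sup>2 * (8 / s\<^sup>2) * exp (s * \<bar>g x\<bar>)" for x
  proof -
    have "(s / 2 * \<bar>g x\<bar>)\<^sup>2 \<le> 2 * exp (s / 2 * \<bar>g x\<bar>)"
      using power_le_fact_exp[of "s / 2 * \<bar>g x\<bar>" 2] \<open>0 < s\<close> by (simp add: fact_2)
    then have "s\<^sup>2 * (g x)\<^sup>2 \<le> 8 * exp (s / 2 * \<bar>g x\<bar>)" by (simp add: power_mult_distrib power_divide)
    then have "(g x)\<^sup>2 \<le> 8 / s\<^sup>2 * exp (s / 2 * \<bar>g x\<bar>)" using \<open>0 < s\<close> by (simp add: field_simps)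
    moreover have "exp (t * \<bar>g x\<bar>) \<le> exp (s / 2 * \<bar>g x\<bar>)" 
      by (intro exp_le_cancel_iff[THEN iffD2] mult_right_mono t) auto
    ultimately have "(g x)\<^sup>2 * exp (t * \<bar>g x\<bar>) \<le> (8 / s\<^sup>2 * exp (s / 2 * \<bar>g x\<bar>)) * exp (s / 2 * \<bar>g x\<bar>)"
      by (intro mult_mono) auto
    also have "\<dots> = 8 / s\<^sup>2 * exp (s * \<bar>g x\<bar>)" by (simp add: mult.assoc flip: exp_add)
    finally have "t\<^sup>2 * ((g x)\<^sup>2 * exp (t * \<bar>g x\<bar>)) \<le> t\<^sup>2 * (8 / s\<^sup>2 * exp (s * \<bar>g x\<bar>))"
      by (intro mult_left_mono) auto
    then show ?thesis
      using exp_le_second_order[of "t * g x"] t by (simp add: power_mult_distrib abs_mult mult.assoc)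
  qed
  have int: "integrable M (\<lambda>x. 1 + t * g x + t\<^sup>2 * (8 / s\<^sup>2) * exp (s * \<bar>g x\<bar>))"
    by (intro Bochner_Integration.integrable_add Bochner_Integration.integrable_mult_right g e) auto
  show int': "integrable M (\<lambda>x. exp (t * g x))"
  proof (rule Bochner_Integration.integrable_bound[OF int])
    show "AE x in M. norm (exp (t * g x)) \<le> norm (1 + t * g x + t\<^sup>2 * (8 / s\<^sup>2) * exp (s * \<bar>g x\<bar>))"
      using order.trans[OF bound abs_ge_self] by (intro AE_I2) (simp only: real_norm_def abs_exp_cancel)
  qed measurable
  have "expectation (\<lambda>x. exp (t * g x)) \<le> expectation (\<lambda>x. 1 + t * g x + t\<^sup>2 * (8 / s\<^sup>2) * exp (s * \<bar>g x\<bar>))"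
    by (intro integral_mono int int' bound)
  also have "\<dots> = 1 + t * expectation g + t\<^sup>2 * (8 / s\<^sup>2) * expectation (\<lambda>x. exp (s * \<bar>g x\<bar>))"
    using g e by (simp add: prob_space)
  also have "\<dots> \<le> 1 + t * (- \<delta>) + t\<^sup>2 * (8 / s\<^sup>2) * K"
    using t g e by (intro add_mono mult_left_mono) auto
  also have "t\<^sup>2 * (8 / s\<^sup>2) * K \<le> t * \<delta> / 2"
  proof -
    have "t * (16 * K) \<le> \<delta> * s\<^sup>2" using t(3) K by (simp add: field_simps)
    then have "t * (t * (16 * K)) \<le> t * (\<delta> * s\<^sup>2)" using t by (intro mult_left_mono) auto
    then show ?thesis using \<open>0 < s\<close> by (simp add: field_simps power2_eq_square)
  qed
  finally have "expectation (\<lambda>x. exp (t * g x)) \<le> 1 + (- (\<delta> / 2 * t))" by (simp add: algebra_simps)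
  also have "\<dots> \<le> exp (- (\<delta> / 2 * t))" by (rule exp_ge_add_one_self)
  finally show "expectation (\<lambda>x. exp (t * g x)) \<le> exp (- chernoff_rate \<delta> s K)"
    by (simp add: chernoff_rate_def t_def)
qed

text \<open>Exponential Markov inequality; independence turns the moment of the sum into an n-th
  power.\<close>

lemma chernoff_iid:
  fixes g :: "'a \<Rightarrow> real" and n :: nat
  assumes [measurable]: "g \<in> borel_measurable M"
    and g: "integrable M g" "expectation g \<le> - \<delta>" and "0 < \<delta>"
    and e: "integrable M (\<lambda>x. exp (s * \<bar>g x\<bar>))" "expectation (\<lambda>x. exp (s * \<bar>g x\<bar>)) \<le> K" and "0 < s"
  shows "measure (Pi\<^sub>M {..<n} (\<lambda>_. M)) {\<omega> \<in> space (Pi\<^sub>M {..<n} (\<lambda>_. M)). 0 \<le> (\<Sum>j<n. g (\<omega> j))}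
    \<le> exp (- chernoff_rate \<delta> s K * real n)"
proof -
  interpret P: product_prob_space "\<lambda>_ :: nat. M" "{..<n}" by unfold_locales
  obtain t where t: "0 < t" "integrable M (\<lambda>x. exp (t * g x))"
    "expectation (\<lambda>x. exp (t * g x)) \<le> exp (- chernoff_rate \<delta> s K)"
    by (rule exp_moment_negative_mean[OF assms]) (rule that)
  let ?P = "Pi\<^sub>M {..<n} (\<lambda>_. M)"
  have "{\<omega> \<in> space ?P. 0 \<le> (\<Sum>j<n. g (\<omega> j))} = {\<omega> \<in> space ?P. 1 \<le> (\<Prod>j<n. exp (t * g (\<omega> j)))}"
    using t(1) by (simp add: zero_le_mult_iff flip: exp_sum sum_distrib_left)
  also have "measure ?P \<dots> \<le> (\<integral>\<omega>. (\<Prod>j<n. exp (t * g (\<omega> j))) \<partial>?P) / 1"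
    by (rule integral_Markov_inequality_measure[where A = "{}"])
      (auto intro!: P.product_integrable_prod t(2) prod_nonneg)
  also have "\<dots> = (\<Prod>j<n. expectation (\<lambda>x. exp (t * g x)))"
    unfolding div_by_1 by (rule P.product_integral_prod) (auto intro: t(2))
  also have "\<dots> \<le> (\<Prod>j<n. exp (- chernoff_rate \<delta> s K))"
    using t(3) by (intro prod_mono) (auto intro: Bochner_Integration.integral_nonneg)
  also have "\<dots> = exp (- chernoff_rate \<delta> s K * real n)" by (simp flip: exp_of_nat_mult add: mult.commute)
  finally show ?thesis .
qed

end

section \<open>Events of overwhelming probability, uniformly in the dimension\<close>

text \<open>The constants are fixed before d, \<mu> and n, hence depend on k alone. The event only
  has to contain a measurable set \<open>G\<close> of large probability, so properties quantified
  over all vectors can be handled without proving them measurable.\<close>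

definition whp :: "nat \<Rightarrow> (nat \<Rightarrow> real mat measure \<Rightarrow> nat \<Rightarrow> (nat \<Rightarrow> real mat) \<Rightarrow> bool) \<Rightarrow> bool" where
  "whp k \<Phi> \<longleftrightarrow> (\<exists>c\<^sub>1 c\<^sub>2 :: real. c\<^sub>1 > 0 \<and> c\<^sub>2 > 0 \<and> (\<forall>d \<mu> n. haar_subspace k d \<mu> \<longrightarrow> c\<^sub>1 * real d \<le> real n \<longrightarrow>
    (\<exists>G\<in>sets (Pi\<^sub>M {..<n} (\<lambda>_. \<mu>)). 1 - exp (- c\<^sub>2 * real n) \<le> measure (Pi\<^sub>M {..<n} (\<lambda>_. \<mu>)) G \<and>
      (\<forall>\<omega>\<in>G. \<Phi> d \<mu> n \<omega>))))"

lemma whpE: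
  assumes "whp k \<Phi>"
  obtains c\<^sub>1 c\<^sub>2 :: real where "c\<^sub>1 > 0" "c\<^sub>2 > 0"
    "\<And>d \<mu> n. haar_subspace k d \<mu> \<Longrightarrow> c\<^sub>1 * real d \<le> real n \<Longrightarrow>
      \<exists>G\<in>sets (Pi\<^sub>M {..<n} (\<lambda>_. \<mu>)). 1 - exp (- c\<^sub>2 * real n) \<le> measure (Pi\<^sub>M {..<n} (\<lambda>_. \<mu>)) G \<and>
        (\<forall>\<omega>\<in>G. \<Phi> d \<mu> n \<omega>)"
  using assms unfolding whp_def by blast

text \<open>The implication may use n > 0, which follows from n \<ge> c1 d > 0, and the
  orthogonality of the samples, which holds because \<open>G\<close> lies in the product
  space.\<close>

lemma whp_mono:
  assumes "whp k \<Phi>"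
    and mono: "\<And>d \<mu> n \<omega>. haar_subspace k d \<mu> \<Longrightarrow> 0 < n \<Longrightarrow> \<omega> \<in> {..<n} \<rightarrow> orthogonal_group d \<Longrightarrow> \<Phi> d \<mu> n \<omega> \<Longrightarrow> \<Psi> d \<mu> n \<omega>"
  shows "whp k \<Psi>"
proof -
  obtain c\<^sub>1 c\<^sub>2 :: real where c: "c\<^sub>1 > 0" "c\<^sub>2 > 0"
    and G: "\<And>d \<mu> n. haar_subspace k d \<mu> \<Longrightarrow> c\<^sub>1 * real d \<le> real n \<Longrightarrow>
      \<exists>G\<in>sets (Pi\<^sub>M {..<n} (\<lambda>_. \<mu>)). 1 - exp (- c\<^sub>2 * real n) \<le> measure (Pi\<^sub>M {..<n} (\<lambda>_. \<mu>)) G \<and>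
        (\<forall>\<omega>\<in>G. \<Phi> d \<mu> n \<omega>)"
    using assms(1) by (rule whpE) (rule that)
  show ?thesis unfolding whp_def
  proof (rule exI[of _ c\<^sub>1], rule exI[of _ c\<^sub>2], intro conjI c allI impI)
    fix d \<mu> n
    assume hs: "haar_subspace k d \<mu>" and n: "c\<^sub>1 * real d \<le> real n"
    interpret haar_subspace k d \<mu> by fact
    have "0 < c\<^sub>1 * real d" using c k_less by simp
    then have n0: "0 < n" using n by linarith
    obtain G where G': "G \<in> sets (Pi\<^sub>M {..<n} (\<lambda>_. \<mu>))" "1 - exp (- c\<^sub>2 * real n) \<le> measure (Pi\<^sub>M {..<n} (\<lambda>_. \<mu>)) G"
      "\<forall>\<omega>\<in>G. \<Phi> d \<mu> n \<omega>" using G[OF hs n] by blast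
    moreover have "\<omega> \<in> {..<n} \<rightarrow> orthogonal_group d" if "\<omega> \<in> G" for \<omega>
      using sets.sets_into_space[OF G'(1)] that by (auto simp: space_PiM PiE_iff)
    ultimately show "\<exists>G\<in>sets (Pi\<^sub>M {..<n} (\<lambda>_. \<mu>)). 1 - exp (- c\<^sub>2 * real n) \<le> measure (Pi\<^sub>M {..<n} (\<lambda>_. \<mu>)) G \<and>
        (\<forall>\<omega>\<in>G. \<Psi> d \<mu> n \<omega>)"
      using mono[OF hs n0] by blast
  qed
qed

lemma haar_subspace_product_prob_space:
  assumes "haar_subspace k d \<mu>"
  shows "prob_space (Pi\<^sub>M I (\<lambda>_. \<mu>))"
proof -
  interpret haar_subspace k d \<mu> by fact
  show ?thesis by (intro prob_space_PiM) unfold_locales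
qed

text \<open>A constant factor in front of the failure probability is absorbed into the rate, since \<open>n \<ge> c\<^sub>1\<close>.\<close>

lemma whp_conj:
  assumes "whp k \<Phi>" "whp k \<Psi>"
  shows "whp k (\<lambda>d \<mu> n \<omega>. \<Phi> d \<mu> n \<omega> \<and> \<Psi> d \<mu> n \<omega>)"
proof -
  obtain a\<^sub>1 a\<^sub>2 :: real where a: "a\<^sub>1 > 0" "a\<^sub>2 > 0"
    and A: "\<And>d \<mu> n. haar_subspace k d \<mu> \<Longrightarrow> a\<^sub>1 * real d \<le> real n \<Longrightarrow>
      \<exists>G\<in>sets (Pi\<^sub>M {..<n} (\<lambda>_. \<mu>)). 1 - exp (- a\<^sub>2 * real n) \<le> measure (Pi\<^sub>M {..<n} (\<lambda>_. \<mu>)) G \<and>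
        (\<forall>\<omega>\<in>G. \<Phi> d \<mu> n \<omega>)"
    using assms(1) by (rule whpE) (rule that)
  obtain b\<^sub>1 b\<^sub>2 :: real where b: "b\<^sub>1 > 0" "b\<^sub>2 > 0"
    and B: "\<And>d \<mu> n. haar_subspace k d \<mu> \<Longrightarrow> b\<^sub>1 * real d \<le> real n \<Longrightarrow>
      \<exists>G\<in>sets (Pi\<^sub>M {..<n} (\<lambda>_. \<mu>)). 1 - exp (- b\<^sub>2 * real n) \<le> measure (Pi\<^sub>M {..<n} (\<lambda>_. \<mu>)) G \<and>
        (\<forall>\<omega>\<in>G. \<Psi> d \<mu> n \<omega>)"
    using assms(2) by (rule whpE) (rule that)
  define m where "m = min a\<^sub>2 b\<^sub>2"
  have m: "m > 0" "m \<le> a\<^sub>2" "m \<le> b\<^sub>2" using a b by (auto simp: m_def)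
  define c\<^sub>1 where "c\<^sub>1 = a\<^sub>1 + b\<^sub>1 + 2 * ln 2 / m"
  have "0 < 2 * ln 2 / m" using m by simp
  then have c\<^sub>1: "c\<^sub>1 > 0" "a\<^sub>1 \<le> c\<^sub>1" "b\<^sub>1 \<le> c\<^sub>1" "2 * ln 2 / m \<le> c\<^sub>1" using a b by (auto simp: c\<^sub>1_def)
  show ?thesis unfolding whp_def
  proof (rule exI[of _ c\<^sub>1], rule exI[of _ "m / 2"], intro conjI allI impI)
    fix d \<mu> n
    assume hs: "haar_subspace k d \<mu>" and n: "c\<^sub>1 * real d \<le> real n"
    interpret haar_subspace k d \<mu> by fact
    let ?P = "Pi\<^sub>M {..<n} (\<lambda>_. \<mu>)"
    interpret P: prob_space ?P by (rule haar_subspace_product_prob_space[OF hs])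
    have d1: "1 \<le> real d" using k_less by simp
    have le: "c * real d \<le> real n" if "c \<le> c\<^sub>1" for c
      using mult_right_mono[OF that, of "real d"] n by simp
    obtain G where G: "G \<in> sets ?P" "1 - exp (- a\<^sub>2 * real n) \<le> measure ?P G" "\<forall>\<omega>\<in>G. \<Phi> d \<mu> n \<omega>"
      using A[OF hs le[OF c\<^sub>1(2)]] by blast
    obtain H where H: "H \<in> sets ?P" "1 - exp (- b\<^sub>2 * real n) \<le> measure ?P H" "\<forall>\<omega>\<in>H. \<Psi> d \<mu> n \<omega>"
      using B[OF hs le[OF c\<^sub>1(3)]] by blast
    have "1 \<le> P.prob (G \<inter> H) + (P.prob (space ?P - G) + P.prob (space ?P - H))"
    proof -
      have "1 = P.prob ((G \<inter> H) \<union> ((space ?P - G) \<union> (space ?P - H)))"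
        using G(1) H(1) sets.sets_into_space by (subst P.prob_space[symmetric], intro arg_cong[where f = P.prob]) blast
      also have "\<dots> \<le> P.prob (G \<inter> H) + P.prob ((space ?P - G) \<union> (space ?P - H))"
        using G(1) H(1) by (intro measure_Un_le) auto
      also have "P.prob ((space ?P - G) \<union> (space ?P - H)) \<le> P.prob (space ?P - G) + P.prob (space ?P - H)"
        using G(1) H(1) by (intro measure_Un_le) auto
      finally show ?thesis by simp
    qed
    then have "P.prob (G \<inter> H) \<ge> 1 - exp (- a\<^sub>2 * real n) - exp (- b\<^sub>2 * real n)"
      using G H by (simp add: P.prob_compl)
    moreover have "exp (- a\<^sub>2 * real n) + exp (- b\<^sub>2 * real n) \<le> exp (- (m / 2) * real n)"
    proof -
      have "2 * ln 2 / m * 1 \<le> c\<^sub>1 * real d" using c\<^sub>1 d1 by (intro mult_mono) auto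
      then have "2 * ln 2 / m \<le> real n" using n by simp
      then have ln2: "ln 2 \<le> m / 2 * real n" using m by (simp add: field_simps)
      have "exp (- a\<^sub>2 * real n) + exp (- b\<^sub>2 * real n) \<le> exp (- m * real n) + exp (- m * real n)"
        using m by (intro add_mono) (auto simp: mult_right_mono)
      also have "\<dots> = exp (ln 2) * exp (- m * real n)" by simp
      also have "\<dots> \<le> exp (m / 2 * real n) * exp (- m * real n)" 
        by (intro mult_right_mono exp_le_cancel_iff[THEN iffD2] ln2) auto
      also have "\<dots> = exp (- (m / 2) * real n)" by (simp flip: exp_add)
      finally show ?thesis .
    qed
    ultimately have "1 - exp (- (m / 2) * real n) \<le> P.prob (G \<inter> H)" by linarith
    then show "\<exists>G\<in>sets ?P. 1 - exp (- (m / 2) * real n) \<le> measure ?P G \<and> (\<forall>\<omega>\<in>G. \<Phi> d \<mu> n \<omega> \<and> \<Psi> d \<mu> n \<omega>)"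
      using G H by (intro bexI[of _ "G \<inter> H"]) auto
  qed (use c\<^sub>1 m in auto)
qed

text \<open>Union bound: K^d exp (- c n) is at most exp (- c n / 2) as soon as n \<ge> (2 ln K / c)
  d. Here the condition that n is at least linear in d pays for the size of the net.\<close>

lemma whp_net:
  fixes N :: "nat \<Rightarrow> 't set"
  assumes K: "1 \<le> K" and "0 < c" and N: "\<And>d. finite (N d)" "\<And>d. real (card (N d)) \<le> K ^ d"
    and meas: "\<And>d \<mu> n t. haar_subspace k d \<mu> \<Longrightarrow> t \<in> N d \<Longrightarrow> {\<omega> \<in> space (Pi\<^sub>M {..<n} (\<lambda>_. \<mu>)). 0 \<le> F d \<mu> n t \<omega>} \<in> sets (Pi\<^sub>M {..<n} (\<lambda>_. \<mu>))"
    and fail: "\<And>d \<mu> n t. haar_subspace k d \<mu> \<Longrightarrow> t \<in> N d \<Longrightarrow>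
      measure (Pi\<^sub>M {..<n} (\<lambda>_. \<mu>)) {\<omega> \<in> space (Pi\<^sub>M {..<n} (\<lambda>_. \<mu>)). 0 \<le> F d \<mu> n t \<omega>} \<le> exp (- c * real n)"
  shows "whp k (\<lambda>d \<mu> n \<omega>. \<forall>t\<in>N d. F d \<mu> n t \<omega> < (0 :: real))"
  unfolding whp_def
\<comment> \<open>The summand 1 keeps the constant positive when K = 1.\<close>
proof (rule exI[of _ "2 * ln K / c + 1"], rule exI[of _ "c / 2"], intro conjI allI impI)
  fix d \<mu> n
  assume hs: "haar_subspace k d \<mu>" and n: "(2 * ln K / c + 1) * real d \<le> real n"
  let ?P = "Pi\<^sub>M {..<n} (\<lambda>_. \<mu>)"
  interpret P: prob_space ?P by (rule haar_subspace_product_prob_space[OF hs])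
  define bad where "bad = (\<lambda>t. {\<omega> \<in> space ?P. 0 \<le> F d \<mu> n t \<omega>})"
  define B where "B = (\<Union>t\<in>N d. bad t)"
  have badm: "bad t \<in> sets ?P" "P.prob (bad t) \<le> exp (- c * real n)" if "t \<in> N d" for t
    using meas[OF hs that] fail[OF hs that] by (auto simp: bad_def)
  then have Bm: "B \<in> sets ?P" unfolding B_def using N(1) by (intro sets.finite_UN) auto
  have "P.prob B \<le> (\<Sum>t\<in>N d. P.prob (bad t))"
    unfolding B_def using N(1) badm by (intro P.finite_measure_subadditive_finite) auto
  also have "\<dots> \<le> (\<Sum>t\<in>N d. exp (- c * real n))" by (intro sum_mono badm)
  also have "\<dots> \<le> K ^ d * exp (- c * real n)" using N(2)[of d] by (simp add: mult_right_mono)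
  also have "K ^ d = exp (ln K * real d)" using K by (simp add: exp_of_nat2_mult)
  also have "\<dots> \<le> exp (c / 2 * real n)"
  proof -
    have "2 * ln K / c * real d \<le> real n" using n by (simp add: distrib_right)
    then have "ln K * real d \<le> c / 2 * real n" using \<open>0 < c\<close> by (simp add: field_simps)
    then show ?thesis by simp
  qed
  then have "exp (ln K * real d) * exp (- c * real n) \<le> exp (c / 2 * real n) * exp (- c * real n)"
    by (intro mult_right_mono) auto
  also have "\<dots> = exp (- (c / 2) * real n)" by (simp flip: exp_add)
  finally have "1 - exp (- (c / 2) * real n) \<le> P.prob (space ?P - B)"
    using Bm by (simp add: P.prob_compl)
  moreover have "space ?P - B \<in> sets ?P" using Bm by auto
  moreover have "\<forall>\<omega>\<in>space ?P - B. \<forall>t\<in>N d. F d \<mu> n t \<omega> < 0" by (auto simp: B_def bad_def not_le)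
  ultimately show "\<exists>G\<in>sets ?P. 1 - exp (- (c / 2) * real n) \<le> measure ?P G \<and> (\<forall>\<omega>\<in>G. \<forall>t\<in>N d. F d \<mu> n t \<omega> < 0)"
    by blast
next
  have "0 \<le> ln K" using K by simp
  then show "0 < 2 * ln K / c + 1" using \<open>0 < c\<close> by (simp add: add_nonneg_pos)
qed (use \<open>0 < c\<close> in auto)

lemma product_event_measurable:
  fixes g :: "'a \<Rightarrow> real"
  assumes [measurable]: "g \<in> borel_measurable M"
  shows "{\<omega> \<in> space (Pi\<^sub>M {..<n :: nat} (\<lambda>_. M)). 0 \<le> (\<Sum>j<n. g (\<omega> j))} \<in> sets (Pi\<^sub>M {..<n} (\<lambda>_. M))"
  by measurable

section \<open>Bounds that hold simultaneously over the unit ball\<close>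

lemma L2_set_le_iff: "0 \<le> r \<Longrightarrow> L2_set x A \<le> r \<longleftrightarrow> (\<Sum>l\<in>A. (x l)\<^sup>2) \<le> r\<^sup>2"
  unfolding L2_set_def by (metis abs_of_nonneg real_sqrt_abs real_sqrt_le_iff)

lemma unit_ball_net_function:
  fixes \<eta> :: real
  assumes "\<eta> > 0"
  obtains K :: real and N :: "nat \<Rightarrow> (nat \<Rightarrow> real) set" where "K \<ge> 1"
    "\<And>d. finite (N d)" "\<And>d. real (card (N d)) \<le> K ^ d"
    "\<And>d v. v \<in> N d \<Longrightarrow> (\<Sum>l<d. (v l)\<^sup>2) \<le> 1"
    "\<And>d x. (\<Sum>l<d. (x l)\<^sup>2) \<le> 1 \<Longrightarrow> \<exists>v\<in>N d. (\<Sum>l<d. (x l - v l)\<^sup>2) \<le> \<eta>\<^sup>2"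
proof -
  obtain K :: real where K: "K \<ge> 1"
    "\<And>d. \<exists>N :: (nat \<Rightarrow> real) set. finite N \<and> real (card N) \<le> K ^ d \<and> (\<forall>v\<in>N. L2_set v {..<d} \<le> 1) \<and>
      (\<forall>x. L2_set x {..<d} \<le> 1 \<longrightarrow> (\<exists>v\<in>N. L2_set (\<lambda>i. x i - v i) {..<d} \<le> \<eta>))"
    by (rule unit_ball_net[OF assms]) (rule that)
  then obtain N :: "nat \<Rightarrow> (nat \<Rightarrow> real) set" where N:
    "\<And>d. finite (N d) \<and> real (card (N d)) \<le> K ^ d \<and> (\<forall>v\<in>N d. L2_set v {..<d} \<le> 1) \<and>
      (\<forall>x. L2_set x {..<d} \<le> 1 \<longrightarrow> (\<exists>v\<in>N d. L2_set (\<lambda>i. x i - v i) {..<d} \<le> \<eta>))"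
    by metis
  show ?thesis
    using that[of K N] K(1) N assms by (simp add: L2_set_le_iff)
qed

text \<open>The deviation is at most (1 + \<delta>) + a(x) in absolute value, so the exponential
  moment of a(x) / 4 supplies the Chernoff hypothesis with s = 1/4.\<close>

lemma (in haar_subspace) mean_square_deviation_le:
  assumes x: "(\<Sum>l<d. (x l)\<^sup>2) \<le> 1" and "0 < \<delta>"
  shows "measure (Pi\<^sub>M {..<n} (\<lambda>_. \<mu>)) {\<omega> \<in> space (Pi\<^sub>M {..<n} (\<lambda>_. \<mu>)). 0 \<le> (\<Sum>j<n. (proj_len k d (\<omega> j) x)\<^sup>2 - 1 - \<delta>)}
    \<le> exp (- chernoff_rate \<delta> (1 / 4) (2 * exp ((1 + \<delta>) / 4)) * real n)"
proof (rule chernoff_iid)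
  let ?s = "\<lambda>U. proj_len k d U x"
  have int: "integrable \<mu> (\<lambda>U. (?s U)\<^sup>2)" by (intro integrable_proj_len1 continuous_intros)
  show "integrable \<mu> (\<lambda>U. (?s U)\<^sup>2 - 1 - \<delta>)" by (intro integrable_proj_len1 continuous_intros)
  show "expectation (\<lambda>U. (?s U)\<^sup>2 - 1 - \<delta>) \<le> - \<delta>"
    using x int by (simp add: integral_proj_len_square)
  show int_exp: "integrable \<mu> (\<lambda>U. exp (1 / 4 * \<bar>(?s U)\<^sup>2 - 1 - \<delta>\<bar>))"
    by (intro integrable_proj_len1[where F = "\<lambda>u. exp (1 / 4 * \<bar>u\<^sup>2 - 1 - \<delta>\<bar>)"] continuous_intros)
  have int_exp': "integrable \<mu> (\<lambda>U. exp ((?s U)\<^sup>2 / 4))"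
    by (intro integrable_proj_len1[where F = "\<lambda>u. exp (u\<^sup>2 / 4)"] continuous_intros) auto
  have "expectation (\<lambda>U. exp (1 / 4 * \<bar>(?s U)\<^sup>2 - 1 - \<delta>\<bar>)) \<le> expectation (\<lambda>U. exp ((1 + \<delta>) / 4) * exp ((?s U)\<^sup>2 / 4))"
  proof (intro integral_mono int_exp Bochner_Integration.integrable_mult_right int_exp')
    fix U
    have "\<bar>(?s U)\<^sup>2 - 1 - \<delta>\<bar> \<le> (1 + \<delta>) + (?s U)\<^sup>2"
      using \<open>0 < \<delta>\<close> zero_le_power2[of "?s U"] by linarith
    then have "1 / 4 * \<bar>(?s U)\<^sup>2 - 1 - \<delta>\<bar> \<le> 1 / 4 * ((1 + \<delta>) + (?s U)\<^sup>2)"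
      by (rule mult_left_mono) simp
    also have "\<dots> = (1 + \<delta>) / 4 + (?s U)\<^sup>2 / 4" by (simp add: algebra_simps add_divide_distrib)
    finally have "1 / 4 * \<bar>(?s U)\<^sup>2 - 1 - \<delta>\<bar> \<le> (1 + \<delta>) / 4 + (?s U)\<^sup>2 / 4" .
    then show "exp (1 / 4 * \<bar>(?s U)\<^sup>2 - 1 - \<delta>\<bar>) \<le> exp ((1 + \<delta>) / 4) * exp ((?s U)\<^sup>2 / 4)"
      unfolding exp_add[symmetric] exp_le_cancel_iff .
  qed
  also have "\<dots> = exp ((1 + \<delta>) / 4) * expectation (\<lambda>U. exp ((?s U)\<^sup>2 / 4))" by simp
  also have "\<dots> \<le> exp ((1 + \<delta>) / 4) * 2" by (intro mult_left_mono exp_moment_proj_len x) auto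
  finally show "expectation (\<lambda>U. exp (1 / 4 * \<bar>(?s U)\<^sup>2 - 1 - \<delta>\<bar>)) \<le> 2 * exp ((1 + \<delta>) / 4)" by simp
qed (use \<open>0 < \<delta>\<close> in auto)

text \<open>With S the supremum over the ball, splitting x into a net point and a remainder of norm
  at most \<eta> gives S \<le> q + \<eta> S. Solving for S requires it to be finite, whence the
  hypothesis \<open>bdd\<close>.\<close>

lemma seminorm_bound_from_net:
  fixes L :: "(nat \<Rightarrow> real) \<Rightarrow> real"
  assumes tri: "\<And>x y. L (\<lambda>l. x l + y l) \<le> L x + L y" and scale: "\<And>c x. L (\<lambda>l. c * x l) = \<bar>c\<bar> * L x"
    and bdd: "bdd_above (L ` {x. (\<Sum>l<d. (x l)\<^sup>2) \<le> 1})"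
    and net: "\<And>x. (\<Sum>l<d. (x l)\<^sup>2) \<le> 1 \<Longrightarrow> \<exists>v\<in>N. (\<Sum>l<d. (x l - v l)\<^sup>2) \<le> \<eta>\<^sup>2"
    and q: "\<And>v. v \<in> N \<Longrightarrow> L v \<le> q" and \<eta>: "0 < \<eta>" "\<eta> < 1" and x: "(\<Sum>l<d. (x l)\<^sup>2) \<le> 1"
  shows "L x \<le> q / (1 - \<eta>)"
proof -
  let ?B = "{x :: nat \<Rightarrow> real. (\<Sum>l<d. (x l)\<^sup>2) \<le> 1}"
  define S where "S = Sup (L ` ?B)"
  have upper: "L x \<le> S" if "(\<Sum>l<d. (x l)\<^sup>2) \<le> 1" for x
    unfolding S_def by (rule cSUP_upper[OF _ bdd]) (use that in simp)
  have le: "L x \<le> q + \<eta> * S" if "x \<in> ?B" for x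
  proof -
    obtain v where v: "v \<in> N" "(\<Sum>l<d. (x l - v l)\<^sup>2) \<le> \<eta>\<^sup>2" using net \<open>x \<in> ?B\<close> by blast
    define y where "y = (\<lambda>l. (x l - v l) / \<eta>)"
    have "(\<Sum>l<d. (y l)\<^sup>2) = (\<Sum>l<d. (x l - v l)\<^sup>2) / \<eta>\<^sup>2" by (simp add: y_def power_divide sum_divide_distrib)
    also have "\<dots> \<le> 1" using v(2) \<eta> by simp
    finally have "L y \<le> S" by (rule upper)
    then have 1: "\<eta> * L y \<le> \<eta> * S" using \<eta> by (intro mult_left_mono) auto
    have "(\<lambda>l. v l + \<eta> * y l) = x" using \<eta> by (auto simp: y_def)
    then have "L x \<le> L v + \<eta> * L y" using tri[of v "\<lambda>l. \<eta> * y l"] \<eta> by (simp add: scale)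
    then show ?thesis using 1 q[OF v(1)] by linarith
  qed
  have "(\<lambda>_. 0) \<in> ?B" by simp
  then have "?B \<noteq> {}" by (intro notI) (simp only: empty_iff)
  then have "Sup (L ` ?B) \<le> q + \<eta> * S" using le by (rule cSUP_least)
  then have "S \<le> q + \<eta> * S" by (simp only: S_def)
  then have "S * (1 - \<eta>) \<le> q" by (simp add: algebra_simps)
  then have "S \<le> q / (1 - \<eta>)" using \<eta> by (simp add: field_simps)
  then show ?thesis using upper[OF x] by simp
qed

lemma whp_mean_square_upper:
  assumes "0 < \<epsilon>"
  shows "whp k (\<lambda>d \<mu> n \<omega>. \<forall>x. (\<Sum>l<d. (x l)\<^sup>2) \<le> 1 \<longrightarrow> (\<Sum>j<n. (proj_len k d (\<omega> j) x)\<^sup>2) \<le> (1 + \<epsilon>) * real n)"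
proof -
  define \<delta> where "\<delta> = \<epsilon> / 2"
  \<comment> \<open>Chosen so that the bound (1 + \<delta>) n on the net, divided by (1 - \<eta>)^2
    = \<rho>^2, becomes exactly (1 + \<epsilon>) n.\<close>
  define \<rho> where "\<rho> = sqrt ((1 + \<delta>) / (1 + \<epsilon>))"
  define \<eta> where "\<eta> = 1 - \<rho>"
  have \<delta>: "0 < \<delta>" "\<delta> < \<epsilon>" using assms by (auto simp: \<delta>_def)
  have \<rho>: "0 < \<rho>" "\<rho> < 1" "\<rho>\<^sup>2 = (1 + \<delta>) / (1 + \<epsilon>)" using \<delta> by (auto simp: \<rho>_def)
  have \<eta>: "0 < \<eta>" "\<eta> < 1" using \<rho> by (auto simp: \<eta>_def)
  obtain K :: real and N :: "nat \<Rightarrow> (nat \<Rightarrow> real) set" where K: "K \<ge> 1"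
    and N: "\<And>d. finite (N d)" "\<And>d. real (card (N d)) \<le> K ^ d"
    and N1: "\<And>d v. v \<in> N d \<Longrightarrow> (\<Sum>l<d. (v l)\<^sup>2) \<le> 1"
    and net: "\<And>d x. (\<Sum>l<d. (x l)\<^sup>2) \<le> 1 \<Longrightarrow> \<exists>v\<in>N d. (\<Sum>l<d. (x l - v l)\<^sup>2) \<le> \<eta>\<^sup>2"
    by (rule unit_ball_net_function[OF \<eta>(1)]) (rule that)
  let ?c = "chernoff_rate \<delta> (1 / 4) (2 * exp ((1 + \<delta>) / 4))"
  have "whp k (\<lambda>d \<mu> n \<omega>. \<forall>v\<in>N d. (\<Sum>j<n. (proj_len k d (\<omega> j) v)\<^sup>2 - 1 - \<delta>) < 0)"
  proof (rule whp_net[OF K _ N])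
    show "0 < ?c" by (intro chernoff_rate_pos \<delta>) auto
  next
    fix d \<mu> v and n :: nat assume hs: "haar_subspace k d \<mu>" and v: "v \<in> N d"
    interpret haar_subspace k d \<mu> by fact
    show "{\<omega> \<in> space (Pi\<^sub>M {..<n} (\<lambda>_. \<mu>)). 0 \<le> (\<Sum>j<n. (proj_len k d (\<omega> j) v)\<^sup>2 - 1 - \<delta>)} \<in> sets (Pi\<^sub>M {..<n} (\<lambda>_. \<mu>))"
      by (rule product_event_measurable[where g = "\<lambda>U. (proj_len k d U v)\<^sup>2 - 1 - \<delta>"]) measurable
    show "measure (Pi\<^sub>M {..<n} (\<lambda>_. \<mu>)) {\<omega> \<in> space (Pi\<^sub>M {..<n} (\<lambda>_. \<mu>)). 0 \<le> (\<Sum>j<n. (proj_len k d (\<omega> j) v)\<^sup>2 - 1 - \<delta>)}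
        \<le> exp (- ?c * real n)"
      using mean_square_deviation_le[OF N1[OF v] \<delta>(1)] .
  qed
  then show ?thesis
  proof (rule whp_mono)
    fix d \<mu> n and \<omega> :: "nat \<Rightarrow> real mat"
    assume hs: "haar_subspace k d \<mu>" and \<omega>: "\<omega> \<in> {..<n} \<rightarrow> orthogonal_group d"
      and small: "\<forall>v\<in>N d. (\<Sum>j<n. (proj_len k d (\<omega> j) v)\<^sup>2 - 1 - \<delta>) < 0"
    interpret haar_subspace k d \<mu> by fact
    define L where "L = (\<lambda>x. L2_set (\<lambda>j. proj_len k d (\<omega> j) x) {..<n})"
    have L_square: "(L x)\<^sup>2 = (\<Sum>j<n. (proj_len k d (\<omega> j) x)\<^sup>2)" for x
      by (simp add: L_def L2_set_def sum_nonneg)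
    show "\<forall>x. (\<Sum>l<d. (x l)\<^sup>2) \<le> 1 \<longrightarrow> (\<Sum>j<n. (proj_len k d (\<omega> j) x)\<^sup>2) \<le> (1 + \<epsilon>) * real n"
    proof (intro allI impI)
      fix x :: "nat \<Rightarrow> real" assume x: "(\<Sum>l<d. (x l)\<^sup>2) \<le> 1"
      have "L x \<le> sqrt ((1 + \<delta>) * real n) / (1 - \<eta>)"
      proof (rule seminorm_bound_from_net[OF _ _ _ net _ \<eta> x])
        show "L (\<lambda>l. x l + y l) \<le> L x + L y" for x y
          unfolding L_def
          by (rule order.trans[OF L2_set_mono L2_set_triangle_ineq]) (auto intro: proj_len_triangle proj_len_nonneg)
        show "L (\<lambda>l. c * x l) = \<bar>c\<bar> * L x" for c x
          unfolding L_def proj_len_scale by (simp add: L2_set_right_distrib)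
        show "L v \<le> sqrt ((1 + \<delta>) * real n)" if "v \<in> N d" for v
        proof -
          have "(L v)\<^sup>2 \<le> (1 + \<delta>) * real n"
            using small that by (fastforce simp: L_square sum_subtractf algebra_simps)
          then show ?thesis by (rule real_le_rsqrt)
        qed
        show "bdd_above (L ` {x. (\<Sum>l<d. (x l)\<^sup>2) \<le> 1})"
        proof (rule bdd_aboveI2)
          fix x :: "nat \<Rightarrow> real" assume "x \<in> {x. (\<Sum>l<d. (x l)\<^sup>2) \<le> 1}"
          then have "L2_set x {..<d} \<le> 1" by (simp add: L2_set_le_iff)
          then have "(\<Sum>l<d. \<bar>x l\<bar>) \<le> sqrt (real d)"
            using sum_abs_le_sqrt_L2_set[where x = x and d = d] mult_left_mono[of "L2_set x {..<d}" 1 "sqrt (real d)"] by simp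
          then have "sqrt (real d / real k) * (real k * (\<Sum>l<d. \<bar>x l\<bar>)) \<le> sqrt (real d / real k) * (real k * sqrt (real d))"
            by (intro mult_left_mono) auto
          then have "proj_len k d (\<omega> j) x \<le> sqrt (real d / real k) * (real k * sqrt (real d))" if "j < n" for j
            using proj_len_bound[of "\<omega> j" d k x] \<omega> that k_less by fastforce
          then have "L x \<le> (\<Sum>j<n. sqrt (real d / real k) * (real k * sqrt (real d)))"
            unfolding L_def by (intro order.trans[OF L2_set_le_sum] sum_mono) (auto simp: proj_len_nonneg)
          then show "L x \<le> real n * (sqrt (real d / real k) * (real k * sqrt (real d)))" by simp
        qed
      qed
      then have "(L x)\<^sup>2 \<le> (sqrt ((1 + \<delta>) * real n) / \<rho>)\<^sup>2"
        by (intro power_mono) (auto simp: L_def L2_set_nonneg \<eta>_def)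
      also have "\<dots> = (1 + \<delta>) * real n / \<rho>\<^sup>2" using \<delta> by (simp add: power_divide)
      also have "\<dots> = (1 + \<epsilon>) * real n" unfolding \<rho>(3) using \<delta> by (simp add: field_simps)
      finally show "(\<Sum>j<n. (proj_len k d (\<omega> j) x)\<^sup>2) \<le> (1 + \<epsilon>) * real n" by (simp add: L_square)
    qed
  qed
qed

text \<open>The deviation is bounded by 2 R + \<delta>, which gives the exponential moment at s = 1
  at once.\<close>

lemma (in haar_subspace) bounded_deviation_le:
  fixes f :: "real \<Rightarrow> real \<Rightarrow> real" and x y :: "nat \<Rightarrow> real"
  assumes cont: "continuous_on UNIV (case_prod f)" and R: "\<And>u v. \<bar>f u v\<bar> \<le> R" and "0 < \<delta>"
  defines "m \<equiv> (\<integral>U. f (proj_len k d U x) (proj_len k d U y) \<partial>\<mu>)"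
  shows "measure (Pi\<^sub>M {..<n} (\<lambda>_. \<mu>)) {\<omega> \<in> space (Pi\<^sub>M {..<n} (\<lambda>_. \<mu>)).
      0 \<le> (\<Sum>j<n. f (proj_len k d (\<omega> j) x) (proj_len k d (\<omega> j) y) - m - \<delta>)}
    \<le> exp (- chernoff_rate \<delta> 1 (exp (2 * R + \<delta>)) * real n)"
proof (rule chernoff_iid)
  let ?f = "\<lambda>U. f (proj_len k d U x) (proj_len k d U y)"
  have int: "integrable \<mu> ?f" by (rule integrable_proj_len[OF cont])
  then show [measurable]: "(\<lambda>U. ?f U - m - \<delta>) \<in> borel_measurable \<mu>"
    by (intro borel_measurable_diff borel_measurable_integrable) auto
  show "integrable \<mu> (\<lambda>U. ?f U - m - \<delta>)" using int by simp
  show "expectation (\<lambda>U. ?f U - m - \<delta>) \<le> - \<delta>" using int by (simp add: m_def)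
  have "\<bar>m\<bar> \<le> (\<integral>U. R \<partial>\<mu>)"
    unfolding m_def by (intro order.trans[OF integral_abs_bound] integral_mono Bochner_Integration.integrable_abs int) (auto simp: R)
  then have m: "\<bar>m\<bar> \<le> R" by simp
  have le: "exp (1 * \<bar>?f U - m - \<delta>\<bar>) \<le> exp (2 * R + \<delta>)" for U
    using R[of "proj_len k d U x" "proj_len k d U y"] m \<open>0 < \<delta>\<close> by simp
  show int': "integrable \<mu> (\<lambda>U. exp (1 * \<bar>?f U - m - \<delta>\<bar>))"
    by (rule integrable_const_bound[where B = "exp (2 * R + \<delta>)"]) (use le in auto)
  have "expectation (\<lambda>U. exp (1 * \<bar>?f U - m - \<delta>\<bar>)) \<le> expectation (\<lambda>U. exp (2 * R + \<delta>))"
    by (intro integral_mono int' le) auto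
  then show "expectation (\<lambda>U. exp (1 * \<bar>?f U - m - \<delta>\<bar>)) \<le> exp (2 * R + \<delta>)" by simp
qed (use \<open>0 < \<delta>\<close> in auto)

text \<open>The inequality u \<le> u^2 / (2 \<eta>) + \<eta> / 2 replaces Cauchy-Schwarz and reduces
  to the second moment.\<close>

lemma (in haar_subspace) integral_proj_len_le:
  assumes "(\<Sum>l<d. (x l)\<^sup>2) \<le> \<eta>\<^sup>2" "0 < \<eta>"
  shows "(\<integral>U. proj_len k d U x \<partial>\<mu>) \<le> \<eta>"
proof -
  have "(\<integral>U. proj_len k d U x \<partial>\<mu>) \<le> (\<integral>U. (proj_len k d U x)\<^sup>2 / (2 * \<eta>) + \<eta> / 2 \<partial>\<mu>)"
  proof (intro integral_mono)
    show "integrable \<mu> (\<lambda>U. proj_len k d U x)"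
      by (rule integrable_proj_len1[where F = "\<lambda>u. u"]) (rule continuous_on_id)
    show "integrable \<mu> (\<lambda>U. (proj_len k d U x)\<^sup>2 / (2 * \<eta>) + \<eta> / 2)"
      using \<open>0 < \<eta>\<close> by (intro integrable_proj_len1[where F = "\<lambda>u. u\<^sup>2 / (2 * \<eta>) + \<eta> / 2"] continuous_intros) auto
    show "proj_len k d U x \<le> (proj_len k d U x)\<^sup>2 / (2 * \<eta>) + \<eta> / 2" for U
      using zero_le_power2[of "proj_len k d U x - \<eta>"] \<open>0 < \<eta>\<close>
      by (simp add: field_simps power2_eq_square)
  qed
  also have "\<dots> = (\<Sum>l<d. (x l)\<^sup>2) / (2 * \<eta>) + \<eta> / 2"
    using integrable_proj_len1[of "\<lambda>u. u\<^sup>2"] by (simp add: integral_proj_len_square continuous_intros)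
  also have "\<dots> \<le> \<eta>\<^sup>2 / (2 * \<eta>) + \<eta> / 2" using assms by (intro add_right_mono divide_right_mono) auto
  also have "\<dots> = \<eta>" using \<open>0 < \<eta>\<close> by (simp add: power2_eq_square)
  finally show ?thesis .
qed

text \<open>Passing from (x, y) to net points costs L times the lengths of the two differences.
  These are small only on average, both under \<mu> and over the sample; the sample average is
  governed by the uniform bound on mean squares. The estimate is one-sided; lower bounds come from
  applying it to the negative of a function.\<close>

lemma whp_uniform_deviation:
  fixes f :: "real \<Rightarrow> real \<Rightarrow> real"
  assumes R: "\<And>u v. \<bar>f u v\<bar> \<le> R" and "0 \<le> L"
    and lip: "\<And>u v u' v'. \<bar>f u v - f u' v'\<bar> \<le> L * (\<bar>u - u'\<bar> + \<bar>v - v'\<bar>)"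
    and cont: "continuous_on UNIV (case_prod f)" and "0 < \<epsilon>"
  shows "whp k (\<lambda>d \<mu> n \<omega>. \<forall>x y. (\<Sum>l<d. (x l)\<^sup>2) \<le> 1 \<longrightarrow> (\<Sum>l<d. (y l)\<^sup>2) \<le> 1 \<longrightarrow>
    (\<Sum>j<n. f (proj_len k d (\<omega> j) x) (proj_len k d (\<omega> j) y))
      \<le> real n * ((\<integral>U. f (proj_len k d U x) (proj_len k d U y) \<partial>\<mu>) + \<epsilon>))"
proof -
  define \<delta> where "\<delta> = \<epsilon> / 2"
  \<comment> \<open>Two differences cost 2 L \<eta> in the expectation and 4 L \<eta> in the
    empirical mean, together at most \<epsilon> / 2; the other half is \<delta>. Using L + 1 covers
    L = 0.\<close>
  define \<eta> where "\<eta> = \<epsilon> / (12 * (L + 1))"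
  have \<delta>: "0 < \<delta>" and \<eta>: "0 < \<eta>" using \<open>0 < \<epsilon>\<close> \<open>0 \<le> L\<close> by (auto simp: \<delta>_def \<eta>_def)
  have L\<eta>: "6 * (L * \<eta>) \<le> \<epsilon> / 2"
    using \<open>0 < \<epsilon>\<close> \<open>0 \<le> L\<close> by (simp add: \<eta>_def field_simps)
  obtain K :: real and N :: "nat \<Rightarrow> (nat \<Rightarrow> real) set" where K: "K \<ge> 1"
    and N: "\<And>d. finite (N d)" "\<And>d. real (card (N d)) \<le> K ^ d"
    and net: "\<And>d v. v \<in> N d \<Longrightarrow> (\<Sum>l<d. (v l)\<^sup>2) \<le> 1"
      "\<And>d x. (\<Sum>l<d. (x l)\<^sup>2) \<le> 1 \<Longrightarrow> \<exists>v\<in>N d. (\<Sum>l<d. (x l - v l)\<^sup>2) \<le> \<eta>\<^sup>2"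
    by (rule unit_ball_net_function[OF \<eta>]) (rule that)
  let ?m = "\<lambda>d \<mu> x y. \<integral>U. f (proj_len k d U x) (proj_len k d U y) \<partial>\<mu>"
  let ?F = "\<lambda>d \<mu> n t \<omega>. \<Sum>j<n. f (proj_len k d (\<omega> j) (fst t)) (proj_len k d (\<omega> j) (snd t)) - ?m d \<mu> (fst t) (snd t) - \<delta>"
  let ?c = "chernoff_rate \<delta> 1 (exp (2 * R + \<delta>))"
  have "whp k (\<lambda>d \<mu> n \<omega>. \<forall>t\<in>N d \<times> N d. ?F d \<mu> n t \<omega> < 0)"
  proof (rule whp_net[where K = "K\<^sup>2" and c = ?c])
    show "1 \<le> K\<^sup>2" using K by simp
    show "0 < ?c" by (intro chernoff_rate_pos \<delta>) auto
    show "finite (N d \<times> N d)" for d using N by simp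
    show "real (card (N d \<times> N d)) \<le> (K\<^sup>2) ^ d" for d
      using mult_mono[OF N(2)[of d] N(2)[of d]] K by (simp add: card_cartesian_product power2_eq_square power_mult_distrib)
  next
    fix d \<mu> t and n :: nat assume hs: "haar_subspace k d \<mu>"
    interpret haar_subspace k d \<mu> by fact
    have "(\<lambda>U. f (proj_len k d U (fst t)) (proj_len k d U (snd t)) - ?m d \<mu> (fst t) (snd t) - \<delta>) \<in> borel_measurable \<mu>"
      by (intro borel_measurable_diff borel_measurable_integrable integrable_proj_len[OF cont]) auto
    from product_event_measurable[OF this]
    show "{\<omega> \<in> space (Pi\<^sub>M {..<n} (\<lambda>_. \<mu>)). 0 \<le> ?F d \<mu> n t \<omega>} \<in> sets (Pi\<^sub>M {..<n} (\<lambda>_. \<mu>))" .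
    show "measure (Pi\<^sub>M {..<n} (\<lambda>_. \<mu>)) {\<omega> \<in> space (Pi\<^sub>M {..<n} (\<lambda>_. \<mu>)). 0 \<le> ?F d \<mu> n t \<omega>} \<le> exp (- ?c * real n)"
      by (rule bounded_deviation_le[OF cont R \<delta>])
  qed
  from whp_conj[OF this whp_mean_square_upper[of 1 k]]
  have "whp k (\<lambda>d \<mu> n \<omega>. (\<forall>t\<in>N d \<times> N d. ?F d \<mu> n t \<omega> < 0) \<and>
      (\<forall>x. (\<Sum>l<d. (x l)\<^sup>2) \<le> 1 \<longrightarrow> (\<Sum>j<n. (proj_len k d (\<omega> j) x)\<^sup>2) \<le> (1 + 1) * real n))" by simp
  then show ?thesis
  proof (rule whp_mono, intro allI impI)
    fix d \<mu> n and x y :: "nat \<Rightarrow> real" and \<omega> :: "nat \<Rightarrow> real mat"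
    assume hs: "haar_subspace k d \<mu>" and n0: "0 < n"
      and good: "(\<forall>t\<in>N d \<times> N d. ?F d \<mu> n t \<omega> < 0) \<and>
        (\<forall>x. (\<Sum>l<d. (x l)\<^sup>2) \<le> 1 \<longrightarrow> (\<Sum>j<n. (proj_len k d (\<omega> j) x)\<^sup>2) \<le> (1 + 1) * real n)"
      and x: "(\<Sum>l<d. (x l)\<^sup>2) \<le> 1" and y: "(\<Sum>l<d. (y l)\<^sup>2) \<le> 1"
    interpret haar_subspace k d \<mu> by fact
    have upper: "(\<Sum>j<n. proj_len k d (\<omega> j) h) \<le> 2 * \<eta> * real n" if h: "(\<Sum>l<d. (h l)\<^sup>2) \<le> \<eta>\<^sup>2" for h
    proof -
      define g where "g = (\<lambda>l. h l / \<eta>)"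
      have "(\<Sum>l<d. (g l)\<^sup>2) = (\<Sum>l<d. (h l)\<^sup>2) / \<eta>\<^sup>2" by (simp add: g_def power_divide sum_divide_distrib)
      also have "\<dots> \<le> 1" using h \<eta> by simp
      finally have g: "(\<Sum>j<n. (proj_len k d (\<omega> j) g)\<^sup>2) \<le> 2 * real n" using good by simp
      have "proj_len k d (\<omega> j) h = \<eta> * proj_len k d (\<omega> j) g" for j
        using proj_len_scale[of k d "\<omega> j" \<eta> g] \<eta> by (simp add: g_def)
      then have "(\<Sum>j<n. proj_len k d (\<omega> j) h) = \<eta> * (\<Sum>j<n. proj_len k d (\<omega> j) g)" by (simp add: sum_distrib_left)
      also have "\<dots> \<le> \<eta> * (\<Sum>j<n. ((proj_len k d (\<omega> j) g)\<^sup>2 + 1) / 2)"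
      proof (intro mult_left_mono sum_mono)
        show "proj_len k d (\<omega> j) g \<le> ((proj_len k d (\<omega> j) g)\<^sup>2 + 1) / 2" for j
          using zero_le_power2[of "proj_len k d (\<omega> j) g - 1"] by (simp add: power2_eq_square algebra_simps)
      qed (use \<eta> in auto)
      also have "\<dots> = \<eta> * ((\<Sum>j<n. (proj_len k d (\<omega> j) g)\<^sup>2) + real n) / 2"
        by (simp add: sum.distrib flip: sum_divide_distrib)
      also have "\<dots> \<le> \<eta> * (2 * real n + real n) / 2" using g \<eta> by simp
      also have "\<dots> \<le> 2 * \<eta> * real n" using \<eta> by simp
      finally show ?thesis .
    qed
    obtain v where v: "v \<in> N d" "(\<Sum>l<d. (x l - v l)\<^sup>2) \<le> \<eta>\<^sup>2" using net(2)[OF x] by blast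
    obtain w where w: "w \<in> N d" "(\<Sum>l<d. (y l - w l)\<^sup>2) \<le> \<eta>\<^sup>2" using net(2)[OF y] by blast
    let ?h = "\<lambda>l. x l - v l" and ?g = "\<lambda>l. y l - w l"
    have diff: "\<bar>f (proj_len k d U x) (proj_len k d U y) - f (proj_len k d U v) (proj_len k d U w)\<bar>
        \<le> L * (proj_len k d U ?h + proj_len k d U ?g)" for U
      using lip proj_len_diff_le[of k d U x v] proj_len_diff_le[of k d U y w] \<open>0 \<le> L\<close>
      by (meson add_mono mult_left_mono order.trans)
    have int: "integrable \<mu> (\<lambda>U. f (proj_len k d U x) (proj_len k d U y))" for x y
      by (rule integrable_proj_len[OF cont])
    have int1: "integrable \<mu> (\<lambda>U. proj_len k d U x)" for x
      using integrable_proj_len1[of "\<lambda>u. u"] by (auto intro: continuous_intros)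
    have "?m d \<mu> v w \<le> (\<integral>U. f (proj_len k d U x) (proj_len k d U y) + L * (proj_len k d U ?h + proj_len k d U ?g) \<partial>\<mu>)"
    proof (intro integral_mono Bochner_Integration.integrable_add Bochner_Integration.integrable_mult_right int int1)
      show "f (proj_len k d U v) (proj_len k d U w)
          \<le> f (proj_len k d U x) (proj_len k d U y) + L * (proj_len k d U ?h + proj_len k d U ?g)" for U
        using diff[of U] by linarith
    qed
    also have "\<dots> = ?m d \<mu> x y + L * ((\<integral>U. proj_len k d U ?h \<partial>\<mu>) + (\<integral>U. proj_len k d U ?g \<partial>\<mu>))"
      using int int1 by simp
    also have "\<dots> \<le> ?m d \<mu> x y + L * (\<eta> + \<eta>)"
      using v(2) w(2) \<eta> \<open>0 \<le> L\<close> by (intro add_left_mono mult_left_mono add_mono integral_proj_len_le)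
    finally have m_le: "?m d \<mu> v w \<le> ?m d \<mu> x y + 2 * (L * \<eta>)" by simp
    have "(\<Sum>j<n. f (proj_len k d (\<omega> j) x) (proj_len k d (\<omega> j) y))
        \<le> (\<Sum>j<n. f (proj_len k d (\<omega> j) v) (proj_len k d (\<omega> j) w)
            + L * (proj_len k d (\<omega> j) ?h + proj_len k d (\<omega> j) ?g))"
    proof (rule sum_mono)
      show "f (proj_len k d (\<omega> j) x) (proj_len k d (\<omega> j) y) \<le> f (proj_len k d (\<omega> j) v) (proj_len k d (\<omega> j) w)
            + L * (proj_len k d (\<omega> j) ?h + proj_len k d (\<omega> j) ?g)" for j
        using diff[of "\<omega> j"] by linarith
    qed
    also have "\<dots> = (\<Sum>j<n. f (proj_len k d (\<omega> j) v) (proj_len k d (\<omega> j) w))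
        + L * ((\<Sum>j<n. proj_len k d (\<omega> j) ?h) + (\<Sum>j<n. proj_len k d (\<omega> j) ?g))"
      by (simp add: sum.distrib sum_distrib_left distrib_left)
    also have "\<dots> \<le> real n * (?m d \<mu> v w + \<delta>) + L * (2 * \<eta> * real n + 2 * \<eta> * real n)"
    proof (intro add_mono mult_left_mono upper v w)
      have "?F d \<mu> n (v, w) \<omega> < 0" using good v w by blast
      then show "(\<Sum>j<n. f (proj_len k d (\<omega> j) v) (proj_len k d (\<omega> j) w)) \<le> real n * (?m d \<mu> v w + \<delta>)"
        by (simp add: sum_subtractf algebra_simps)
    qed fact
    also have "\<dots> = real n * (?m d \<mu> v w + \<delta> + 4 * (L * \<eta>))" by (simp add: algebra_simps)
    also have "\<dots> \<le> real n * (?m d \<mu> x y + \<epsilon>)"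
      using m_le L\<eta> by (intro mult_left_mono) (auto simp: \<delta>_def)
    finally show "(\<Sum>j<n. f (proj_len k d (\<omega> j) x) (proj_len k d (\<omega> j) y)) \<le> real n * (?m d \<mu> x y + \<epsilon>)" .
  qed
qed

section \<open>Truncated moments and the separating weight\<close>

text \<open>Truncating u^2 at T is the square of truncating |u| at sqrt T. The truncation of |u| is
  1-Lipschitz, and squaring is 2 sqrt T-Lipschitz on its range.\<close>

lemma min_square_lipschitz:
  fixes u v T :: real
  assumes "0 \<le> T"
  shows "\<bar>min (u\<^sup>2) T - min (v\<^sup>2) T\<bar> \<le> 2 * sqrt T * \<bar>u - v\<bar>"
proof -
  define m where "m = (\<lambda>u. min \<bar>u\<bar> (sqrt T))"
  have m: "min (u\<^sup>2) T = (m u)\<^sup>2" for u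
  proof (cases "\<bar>u\<bar> \<le> sqrt T")
    case True
    then have "u\<^sup>2 \<le> T" using power_mono[OF True, of 2] assms by simp
    then show ?thesis using True by (simp add: m_def)
  next
    case False
    then have "T \<le> u\<^sup>2" using power_mono[of "sqrt T" "\<bar>u\<bar>" 2] assms by simp
    then show ?thesis using False assms by (simp add: m_def)
  qed
  have "min (u\<^sup>2) T - min (v\<^sup>2) T = (m u + m v) * (m u - m v)"
    unfolding m by (simp add: power2_eq_square algebra_simps)
  moreover have "\<bar>m u + m v\<bar> \<le> 2 * sqrt T" "\<bar>m u - m v\<bar> \<le> \<bar>u - v\<bar>"
    using assms by (auto simp: m_def min_def)
  ultimately show ?thesis using assms by (simp add: abs_mult mult_mono)
qed

context haar_subspace
begin

text \<open>Above T one has a \<le> a^2 / T, and a^2 \<le> 32 exp (a / 4), whose mean is at most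
  64.\<close>

lemma integral_truncated_square_ge:
  assumes x: "(\<Sum>l<d. (x l)\<^sup>2) = 1" and "0 < T"
  shows "1 - 64 / T \<le> (\<integral>U. min ((proj_len k d U x)\<^sup>2) T \<partial>\<mu>)"
proof -
  let ?s = "\<lambda>U. proj_len k d U x"
  have int_exp: "integrable \<mu> (\<lambda>U. exp ((?s U)\<^sup>2 / 4))"
    by (rule integrable_proj_len1[where F = "\<lambda>u. exp (u\<^sup>2 / 4)"]) (intro continuous_intros, simp)
  have int_min: "integrable \<mu> (\<lambda>U. min ((?s U)\<^sup>2) T)"
    by (rule integrable_proj_len1[where F = "\<lambda>u. min (u\<^sup>2) T"]) (intro continuous_intros)
  have "(\<integral>U. (?s U)\<^sup>2 \<partial>\<mu>) \<le> (\<integral>U. min ((?s U)\<^sup>2) T + 32 / T * exp ((?s U)\<^sup>2 / 4) \<partial>\<mu>)"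
  proof (intro integral_mono Bochner_Integration.integrable_add Bochner_Integration.integrable_mult_right int_exp int_min)
    show "integrable \<mu> (\<lambda>U. (?s U)\<^sup>2)" by (intro integrable_proj_len1[where F = "\<lambda>u. u\<^sup>2"] continuous_intros)
    fix U
    let ?a = "(?s U)\<^sup>2"
    have "(?a / 4) ^ 2 \<le> 2 * exp (?a / 4)" using power_le_fact_exp[of "?a / 4" 2] by (simp add: fact_2)
    then have a2: "?a * ?a \<le> 32 * exp (?a / 4)" by (simp add: power2_eq_square)
    show "?a \<le> min ?a T + 32 / T * exp (?a / 4)"
    proof (cases "?a \<le> T")
      case True
      then show ?thesis using \<open>0 < T\<close> by simp
    next
      case False
      then have "?a * T \<le> ?a * ?a" by (intro mult_left_mono) auto
      then have "?a \<le> 32 * exp (?a / 4) / T" using a2 \<open>0 < T\<close> by (simp add: field_simps)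
      then show ?thesis using False \<open>0 < T\<close> by simp
    qed
  qed
  also have "\<dots> = (\<integral>U. min ((?s U)\<^sup>2) T \<partial>\<mu>) + 32 / T * (\<integral>U. exp ((?s U)\<^sup>2 / 4) \<partial>\<mu>)"
    using int_exp int_min by simp
  also have "\<dots> \<le> (\<integral>U. min ((?s U)\<^sup>2) T \<partial>\<mu>) + 32 / T * 2"
    using x \<open>0 < T\<close> by (intro add_left_mono mult_left_mono exp_moment_proj_len) auto
  finally show ?thesis using x by (simp add: integral_proj_len_square)
qed

text \<open>Above B one has a^2 \<le> a^3 / B, and a^3 \<le> 384 exp (a / 4), whose mean is at most
  768.\<close>

lemma integral_truncated_fourth_ge:
  assumes x: "(\<Sum>l<d. (x l)\<^sup>2) = 1" and "0 < B"
  shows "1 + 2 / (real k * (real k + 3)) - 768 / B \<le> (\<integral>U. (min ((proj_len k d U x)\<^sup>2) B)\<^sup>2 \<partial>\<mu>)"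
proof -
  let ?s = "\<lambda>U. proj_len k d U x"
  have int_exp: "integrable \<mu> (\<lambda>U. exp ((?s U)\<^sup>2 / 4))"
    by (rule integrable_proj_len1[where F = "\<lambda>u. exp (u\<^sup>2 / 4)"]) (intro continuous_intros, simp)
  have int_min: "integrable \<mu> (\<lambda>U. (min ((?s U)\<^sup>2) B)\<^sup>2)"
    by (rule integrable_proj_len1[where F = "\<lambda>u. (min (u\<^sup>2) B)\<^sup>2"]) (intro continuous_intros)
  have "1 + 2 / (real k * (real k + 3)) \<le> (\<integral>U. (?s U) ^ 4 \<partial>\<mu>)" by (rule fourth_moment_bounds(1)[OF x])
  also have "\<dots> \<le> (\<integral>U. (min ((?s U)\<^sup>2) B)\<^sup>2 + 384 / B * exp ((?s U)\<^sup>2 / 4) \<partial>\<mu>)"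
  proof (intro integral_mono Bochner_Integration.integrable_add Bochner_Integration.integrable_mult_right int_exp int_min)
    show "integrable \<mu> (\<lambda>U. (?s U) ^ 4)" by (intro integrable_proj_len1[where F = "\<lambda>u. u ^ 4"] continuous_intros)
    fix U
    define a where "a = (?s U)\<^sup>2"
    have a0: "0 \<le> a" by (simp add: a_def)
    have a4: "(?s U) ^ 4 = a\<^sup>2" by (simp add: a_def)
    have "(a / 4) ^ 3 \<le> 6 * exp (a / 4)" using power_le_fact_exp[of "a / 4" 3] a0 by (simp add: fact_numeral)
    then have a3: "a * a * a \<le> 384 * exp (a / 4)" by (simp add: power3_eq_cube)
    have "a\<^sup>2 \<le> (min a B)\<^sup>2 + 384 / B * exp (a / 4)"
    proof (cases "a \<le> B")
      case True
      then show ?thesis using \<open>0 < B\<close> by simp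
    next
      case False
      then have "(a * a) * B \<le> (a * a) * a" by (intro mult_left_mono) auto
      then have "a\<^sup>2 \<le> 384 * exp (a / 4) / B" using a3 \<open>0 < B\<close> by (simp add: field_simps power2_eq_square)
      moreover have "384 * exp (a / 4) / B = 384 / B * exp (a / 4)" by simp
      ultimately show ?thesis using zero_le_power2[of "min a B"] by linarith
    qed
    then show "(?s U) ^ 4 \<le> (min ((?s U)\<^sup>2) B)\<^sup>2 + 384 / B * exp ((?s U)\<^sup>2 / 4)"
      unfolding a4 by (simp only: a_def)
  qed
  also have "\<dots> = (\<integral>U. (min ((?s U)\<^sup>2) B)\<^sup>2 \<partial>\<mu>) + 384 / B * (\<integral>U. exp ((?s U)\<^sup>2 / 4) \<partial>\<mu>)"
    using int_exp int_min by simp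
  also have "\<dots> \<le> (\<integral>U. (min ((?s U)\<^sup>2) B)\<^sup>2 \<partial>\<mu>) + 384 / B * 2"
    using x \<open>0 < B\<close> by (intro add_left_mono mult_left_mono exp_moment_proj_len) auto
  finally show ?thesis by simp
qed

lemma integral_truncated_product_le:
  assumes x: "(\<Sum>l<d. (x l)\<^sup>2) = 1" "(\<Sum>l<d. (y l)\<^sup>2) = 1" "(\<Sum>l<d. x l * y l) = 0" and "0 < B" "0 < T"
  shows "(\<integral>U. min ((proj_len k d U x)\<^sup>2) B * min ((proj_len k d U y)\<^sup>2) T \<partial>\<mu>) \<le> 1"
proof -
  have "(\<integral>U. min ((proj_len k d U x)\<^sup>2) B * min ((proj_len k d U y)\<^sup>2) T \<partial>\<mu>)
      \<le> (\<integral>U. (proj_len k d U x)\<^sup>2 * (proj_len k d U y)\<^sup>2 \<partial>\<mu>)"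
  proof (intro integral_mono)
    show "integrable \<mu> (\<lambda>U. min ((proj_len k d U x)\<^sup>2) B * min ((proj_len k d U y)\<^sup>2) T)"
      by (rule integrable_proj_len[where F = "\<lambda>u v. min (u\<^sup>2) B * min (v\<^sup>2) T"])
        (auto simp: case_prod_beta' intro!: continuous_intros)
    show "integrable \<mu> (\<lambda>U. (proj_len k d U x)\<^sup>2 * (proj_len k d U y)\<^sup>2)"
      by (rule integrable_proj_len[where F = "\<lambda>u v. u\<^sup>2 * v\<^sup>2"]) (auto simp: case_prod_beta' intro!: continuous_intros)
    show "min ((proj_len k d U x)\<^sup>2) B * min ((proj_len k d U y)\<^sup>2) T \<le> (proj_len k d U x)\<^sup>2 * (proj_len k d U y)\<^sup>2" for U
      using assms(4,5) by (intro mult_mono) auto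
  qed
  also have "\<dots> \<le> 1" by (rule fourth_moment_bounds(2)[OF x])
  finally show ?thesis .
qed

end

text \<open>The interface between probability and linear algebra: a condition on the sample alone.
  It is applied with z a negative eigenvector and y a normalised component orthogonal to it. The
  strict inequality at z also shows that no unit vector has all its projection lengths equal to
  zero.\<close>

definition separates :: "(real \<Rightarrow> real) \<Rightarrow> nat \<Rightarrow> nat \<Rightarrow> nat \<Rightarrow> (nat \<Rightarrow> real mat) \<Rightarrow> bool" where
  "separates \<phi> k d n \<omega> \<longleftrightarrow> (\<forall>z. (\<Sum>l<d. (z l)\<^sup>2) = 1 \<longrightarrow>
      (\<Sum>j<n. \<phi> (proj_len k d (\<omega> j) z) * (proj_len k d (\<omega> j) z)\<^sup>2) < 0 \<and>
      (\<forall>y. (\<Sum>l<d. (y l)\<^sup>2) = 1 \<longrightarrow> (\<Sum>l<d. z l * y l) = 0 \<longrightarrow>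
        0 < (\<Sum>j<n. \<phi> (proj_len k d (\<omega> j) z) * (proj_len k d (\<omega> j) y)\<^sup>2)))"

text \<open>The weight \<open>c - min(u\<^sup>2, B)\<close> tells \<open>z\<close> apart from its orthogonal complement because
  \<open>E |P z|\<^sup>4 > 1 \<ge> E |P z|\<^sup>2 |P y|\<^sup>2\<close> in the normalisation \<open>E |P z|\<^sup>2 = 1\<close>.\<close>

lemma whp_separation:
  assumes "1 \<le> k"
  obtains \<phi> :: "real \<Rightarrow> real" where "whp k (\<lambda>d \<mu> n \<omega>. separates \<phi> k d n \<omega>)"
proof -
  \<comment> \<open>\<kappa> is the guaranteed excess of the fourth moment over 1. B is large enough
    that truncation loses only half of it, and c = 1 + \<kappa> / 4 lies midway between 1 and 1 +
    \<kappa> / 2. \<delta> keeps the sum of all errors, \<delta> (2 c + 1 + 3 B), at \<kappa> / 8,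
    below the available margin \<kappa> / 4. T makes the truncation loss 64 / T equal to
    \<delta>.\<close>
  define \<kappa> where "\<kappa> = 2 / (real k * (real k + 3))"
  define B where "B = 1536 / \<kappa>"
  define c where "c = 1 + \<kappa> / 4"
  define \<delta> where "\<delta> = \<kappa> / (8 * (2 * c + 1 + 3 * B))"
  define T where "T = 64 / \<delta>"
  have \<kappa>: "0 < \<kappa>" using assms by (simp add: \<kappa>_def)
  have B: "0 < B" "768 / B = \<kappa> / 2" using \<kappa> by (auto simp: B_def)
  have c: "1 < c" using \<kappa> by (simp add: c_def)
  have \<delta>: "0 < \<delta>" "\<delta> * (2 * c + 1 + 3 * B) = \<kappa> / 8" using \<kappa> B c by (auto simp: \<delta>_def field_simps)
  have T: "0 < T" "64 / T = \<delta>" using \<delta> by (auto simp: T_def)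
  have minb: "0 \<le> min (u\<^sup>2) r" "min (u\<^sup>2) r \<le> r" if "0 < r" for u r :: real using that by auto
  have A1: "whp k (\<lambda>d \<mu> n \<omega>. \<forall>x. (\<Sum>l<d. (x l)\<^sup>2) \<le> 1 \<longrightarrow> (\<Sum>j<n. (proj_len k d (\<omega> j) x)\<^sup>2) \<le> (1 + \<delta>) * real n)"
    by (rule whp_mean_square_upper[OF \<delta>(1)])
  \<comment> \<open>A function of one length, with a dummy second argument; the sign turns the upper
    estimate into a lower bound. The same holds for \<open>?f3\<close>.\<close>
  let ?f1 = "\<lambda>u v :: real. - min (u\<^sup>2) T"
  have A2: "whp k (\<lambda>d \<mu> n \<omega>. \<forall>x y. (\<Sum>l<d. (x l)\<^sup>2) \<le> 1 \<longrightarrow> (\<Sum>l<d. (y l)\<^sup>2) \<le> 1 \<longrightarrow>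
    (\<Sum>j<n. ?f1 (proj_len k d (\<omega> j) x) (proj_len k d (\<omega> j) y))
      \<le> real n * ((\<integral>U. ?f1 (proj_len k d U x) (proj_len k d U y) \<partial>\<mu>) + \<delta>))"
  proof (rule whp_uniform_deviation[OF _ _ _ _ \<delta>(1)])
    show "\<bar>- min (u\<^sup>2) T\<bar> \<le> T" for u using minb[OF T(1), of u] by simp
    show "\<bar>- min (u\<^sup>2) T - - min (u'\<^sup>2) T\<bar> \<le> 2 * sqrt T * (\<bar>u - u'\<bar> + \<bar>v - v'\<bar>)" for u u' v v' :: real
    proof -
      have "\<bar>- min (u\<^sup>2) T - - min (u'\<^sup>2) T\<bar> = \<bar>min (u\<^sup>2) T - min (u'\<^sup>2) T\<bar>" by simp
      also have "\<dots> \<le> 2 * sqrt T * \<bar>u - u'\<bar>" using T by (intro min_square_lipschitz) auto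
      also have "\<dots> \<le> 2 * sqrt T * (\<bar>u - u'\<bar> + \<bar>v - v'\<bar>)" using T by (intro mult_left_mono) auto
      finally show ?thesis .
    qed
  qed (use T in \<open>auto simp: case_prod_beta' intro!: continuous_intros\<close>)
  let ?f2 = "\<lambda>u v :: real. min (u\<^sup>2) B * min (v\<^sup>2) T"
  have A3: "whp k (\<lambda>d \<mu> n \<omega>. \<forall>x y. (\<Sum>l<d. (x l)\<^sup>2) \<le> 1 \<longrightarrow> (\<Sum>l<d. (y l)\<^sup>2) \<le> 1 \<longrightarrow>
    (\<Sum>j<n. ?f2 (proj_len k d (\<omega> j) x) (proj_len k d (\<omega> j) y))
      \<le> real n * ((\<integral>U. ?f2 (proj_len k d U x) (proj_len k d U y) \<partial>\<mu>) + \<delta>))"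
  proof (rule whp_uniform_deviation[OF _ _ _ _ \<delta>(1)])
    show "\<bar>min (u\<^sup>2) B * min (v\<^sup>2) T\<bar> \<le> B * T" for u v
      using minb[OF B(1), of u] minb[OF T(1), of v] by (simp add: abs_mult mult_mono)
    show "\<bar>min (u\<^sup>2) B * min (v\<^sup>2) T - min (u'\<^sup>2) B * min (v'\<^sup>2) T\<bar>
        \<le> (2 * sqrt B * T + B * (2 * sqrt T)) * (\<bar>u - u'\<bar> + \<bar>v - v'\<bar>)" for u u' v v' :: real
    proof -
      have "min (u\<^sup>2) B * min (v\<^sup>2) T - min (u'\<^sup>2) B * min (v'\<^sup>2) T
          = (min (u\<^sup>2) B - min (u'\<^sup>2) B) * min (v\<^sup>2) T + min (u'\<^sup>2) B * (min (v\<^sup>2) T - min (v'\<^sup>2) T)"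
        by (simp add: algebra_simps)
      also have "\<bar>\<dots>\<bar> \<le> \<bar>min (u\<^sup>2) B - min (u'\<^sup>2) B\<bar> * \<bar>min (v\<^sup>2) T\<bar> + \<bar>min (u'\<^sup>2) B\<bar> * \<bar>min (v\<^sup>2) T - min (v'\<^sup>2) T\<bar>"
        by (rule order.trans[OF abs_triangle_ineq]) (simp add: abs_mult)
      also have "\<dots> \<le> (2 * sqrt B * \<bar>u - u'\<bar>) * T + B * (2 * sqrt T * \<bar>v - v'\<bar>)"
        using B T by (intro add_mono mult_mono min_square_lipschitz) auto
      also have "\<dots> \<le> (2 * sqrt B * (\<bar>u - u'\<bar> + \<bar>v - v'\<bar>)) * T + B * (2 * sqrt T * (\<bar>u - u'\<bar> + \<bar>v - v'\<bar>))"
        using B T by (intro add_mono mult_mono) auto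
      also have "\<dots> = (2 * sqrt B * T + B * (2 * sqrt T)) * (\<bar>u - u'\<bar> + \<bar>v - v'\<bar>)" by (simp add: algebra_simps)
      finally show ?thesis .
    qed
  qed (use B T in \<open>auto simp: case_prod_beta' intro!: continuous_intros\<close>)
  let ?f3 = "\<lambda>u v :: real. - (min (u\<^sup>2) B)\<^sup>2"
  have A4: "whp k (\<lambda>d \<mu> n \<omega>. \<forall>x y. (\<Sum>l<d. (x l)\<^sup>2) \<le> 1 \<longrightarrow> (\<Sum>l<d. (y l)\<^sup>2) \<le> 1 \<longrightarrow>
    (\<Sum>j<n. ?f3 (proj_len k d (\<omega> j) x) (proj_len k d (\<omega> j) y))
      \<le> real n * ((\<integral>U. ?f3 (proj_len k d U x) (proj_len k d U y) \<partial>\<mu>) + \<delta>))"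
  proof (rule whp_uniform_deviation[OF _ _ _ _ \<delta>(1)])
    show "\<bar>- (min (u\<^sup>2) B)\<^sup>2\<bar> \<le> B\<^sup>2" for u using minb[OF B(1), of u] by (simp add: power_mono)
    show "\<bar>- (min (u\<^sup>2) B)\<^sup>2 - - (min (u'\<^sup>2) B)\<^sup>2\<bar> \<le> (2 * B * (2 * sqrt B)) * (\<bar>u - u'\<bar> + \<bar>v - v'\<bar>)" for u u' v v' :: real
    proof -
      have "- (min (u\<^sup>2) B)\<^sup>2 - - (min (u'\<^sup>2) B)\<^sup>2 = - ((min (u\<^sup>2) B + min (u'\<^sup>2) B) * (min (u\<^sup>2) B - min (u'\<^sup>2) B))"
        by (simp add: power2_eq_square algebra_simps)
      also have "\<bar>\<dots>\<bar> = \<bar>min (u\<^sup>2) B + min (u'\<^sup>2) B\<bar> * \<bar>min (u\<^sup>2) B - min (u'\<^sup>2) B\<bar>" by (simp add: abs_mult)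
      also have "\<dots> \<le> (2 * B) * (2 * sqrt B * \<bar>u - u'\<bar>)"
        using B minb[OF B(1), of u] minb[OF B(1), of u'] by (intro mult_mono min_square_lipschitz) auto
      also have "\<dots> \<le> (2 * B) * (2 * sqrt B * (\<bar>u - u'\<bar> + \<bar>v - v'\<bar>))" using B by (intro mult_left_mono) auto
      finally show ?thesis by (simp add: mult.assoc)
    qed
  qed (use B in \<open>auto simp: case_prod_beta' intro!: continuous_intros\<close>)
  define \<phi> where "\<phi> = (\<lambda>u :: real. c - min (u\<^sup>2) B)"
  note all = whp_conj[OF whp_conj[OF A1 A2] whp_conj[OF A3 A4]]
  have "whp k (\<lambda>d \<mu> n \<omega>. separates \<phi> k d n \<omega>)"
    using all
  proof (rule whp_mono, elim conjE)
    fix d \<mu> and n :: nat and \<omega> :: "nat \<Rightarrow> real mat"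
    assume hs: "haar_subspace k d \<mu>" and n0: "0 < n"
    let ?s = "\<lambda>x j. proj_len k d (\<omega> j) x"
    assume upper: "\<forall>x. (\<Sum>l<d. (x l)\<^sup>2) \<le> 1 \<longrightarrow> (\<Sum>j<n. (?s x j)\<^sup>2) \<le> (1 + \<delta>) * real n"
      and trunc: "\<forall>x y. (\<Sum>l<d. (x l)\<^sup>2) \<le> 1 \<longrightarrow> (\<Sum>l<d. (y l)\<^sup>2) \<le> 1 \<longrightarrow>
        (\<Sum>j<n. ?f1 (?s x j) (?s y j)) \<le> real n * ((\<integral>U. ?f1 (proj_len k d U x) (proj_len k d U y) \<partial>\<mu>) + \<delta>)"
      and prod: "\<forall>x y. (\<Sum>l<d. (x l)\<^sup>2) \<le> 1 \<longrightarrow> (\<Sum>l<d. (y l)\<^sup>2) \<le> 1 \<longrightarrow>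
        (\<Sum>j<n. ?f2 (?s x j) (?s y j)) \<le> real n * ((\<integral>U. ?f2 (proj_len k d U x) (proj_len k d U y) \<partial>\<mu>) + \<delta>)"
      and fourth: "\<forall>x y. (\<Sum>l<d. (x l)\<^sup>2) \<le> 1 \<longrightarrow> (\<Sum>l<d. (y l)\<^sup>2) \<le> 1 \<longrightarrow>
        (\<Sum>j<n. ?f3 (?s x j) (?s y j)) \<le> real n * ((\<integral>U. ?f3 (proj_len k d U x) (proj_len k d U y) \<partial>\<mu>) + \<delta>)"
    interpret haar_subspace k d \<mu> by fact
    have n: "0 < real n" using n0 by simp
    show "separates \<phi> k d n \<omega>"
      unfolding separates_def
    proof (intro allI impI conjI)
      fix z :: "nat \<Rightarrow> real" assume z: "(\<Sum>l<d. (z l)\<^sup>2) = 1"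
      have up: "(\<Sum>j<n. (?s z j)\<^sup>2) \<le> (1 + \<delta>) * real n" using upper z by simp
      have "(\<Sum>j<n. - (min ((?s z j)\<^sup>2) B)\<^sup>2) \<le> real n * ((\<integral>U. - (min ((proj_len k d U z)\<^sup>2) B)\<^sup>2 \<partial>\<mu>) + \<delta>)"
        using fourth[rule_format, of z z] z by simp
      then have "real n * ((\<integral>U. (min ((proj_len k d U z)\<^sup>2) B)\<^sup>2 \<partial>\<mu>) - \<delta>) \<le> (\<Sum>j<n. (min ((?s z j)\<^sup>2) B)\<^sup>2)"
        by (simp add: sum_negf algebra_simps)
      moreover have "1 + \<kappa> / 2 - \<delta> \<le> (\<integral>U. (min ((proj_len k d U z)\<^sup>2) B)\<^sup>2 \<partial>\<mu>) - \<delta>"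
        using integral_truncated_fourth_ge[OF z B(1)] B(2) by (simp add: \<kappa>_def)
      then have "real n * (1 + \<kappa> / 2 - \<delta>) \<le> real n * ((\<integral>U. (min ((proj_len k d U z)\<^sup>2) B)\<^sup>2 \<partial>\<mu>) - \<delta>)"
        by (intro mult_left_mono) auto
      \<comment> \<open>The unbounded min(a, B) a is needed only from below, where the bounded
        min(a, B)^2 can stand in for it.\<close>
      moreover have "(\<Sum>j<n. (min ((?s z j)\<^sup>2) B)\<^sup>2) \<le> (\<Sum>j<n. min ((?s z j)\<^sup>2) B * (?s z j)\<^sup>2)"
        unfolding power2_eq_square[of "min _ _"] using B by (intro sum_mono mult_left_mono) auto
      ultimately have low: "real n * (1 + \<kappa> / 2 - \<delta>) \<le> (\<Sum>j<n. min ((?s z j)\<^sup>2) B * (?s z j)\<^sup>2)" by linarith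
      have "(\<Sum>j<n. \<phi> (?s z j) * (?s z j)\<^sup>2) = c * (\<Sum>j<n. (?s z j)\<^sup>2) - (\<Sum>j<n. min ((?s z j)\<^sup>2) B * (?s z j)\<^sup>2)"
        by (simp add: \<phi>_def left_diff_distrib sum_subtractf sum_distrib_left)
      also have "\<dots> \<le> c * ((1 + \<delta>) * real n) - real n * (1 + \<kappa> / 2 - \<delta>)"
        using up low c by (intro diff_mono mult_left_mono) auto
      also have "\<dots> = real n * (\<delta> * (c + 1) - \<kappa> / 4)" by (simp add: c_def algebra_simps)
      also have "\<dots> < 0"
      proof -
        have "\<delta> * (c + 1) \<le> \<delta> * (2 * c + 1 + 3 * B)" using \<delta>(1) c B by (intro mult_left_mono) auto
        then have "\<delta> * (c + 1) - \<kappa> / 4 < 0" using \<delta>(2) \<kappa> by linarith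
        then show ?thesis using n by (simp add: mult_pos_neg)
      qed
      finally show "(\<Sum>j<n. \<phi> (?s z j) * (?s z j)\<^sup>2) < 0" .
    next
      fix z y :: "nat \<Rightarrow> real" assume z: "(\<Sum>l<d. (z l)\<^sup>2) = 1" and y: "(\<Sum>l<d. (y l)\<^sup>2) = 1" and zy: "(\<Sum>l<d. z l * y l) = 0"
      define S where "S = (\<Sum>j<n. (?s y j)\<^sup>2)"
      define M where "M = (\<Sum>j<n. min ((?s y j)\<^sup>2) T)"
      have up: "S \<le> (1 + \<delta>) * real n" using upper y by (simp add: S_def)
      have "(\<Sum>j<n. - min ((?s y j)\<^sup>2) T) \<le> real n * ((\<integral>U. - min ((proj_len k d U y)\<^sup>2) T \<partial>\<mu>) + \<delta>)"
        using trunc[rule_format, of y y] y by simp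
      then have "real n * ((\<integral>U. min ((proj_len k d U y)\<^sup>2) T \<partial>\<mu>) - \<delta>) \<le> M"
        by (simp add: M_def sum_negf algebra_simps)
      moreover have "1 - \<delta> - \<delta> \<le> (\<integral>U. min ((proj_len k d U y)\<^sup>2) T \<partial>\<mu>) - \<delta>"
        using integral_truncated_square_ge[OF y T(1)] T(2) by simp
      then have "real n * (1 - \<delta> - \<delta>) \<le> real n * ((\<integral>U. min ((proj_len k d U y)\<^sup>2) T \<partial>\<mu>) - \<delta>)"
        by (intro mult_left_mono) auto
      ultimately have M: "real n * (1 - 2 * \<delta>) \<le> M" by simp
      have MS: "M \<le> S" unfolding M_def S_def by (intro sum_mono) auto
      have "(\<Sum>j<n. min ((?s z j)\<^sup>2) B * min ((?s y j)\<^sup>2) T)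
          \<le> real n * ((\<integral>U. min ((proj_len k d U z)\<^sup>2) B * min ((proj_len k d U y)\<^sup>2) T \<partial>\<mu>) + \<delta>)"
        using prod[rule_format, of z y] z y by simp
      also have "\<dots> \<le> real n * (1 + \<delta>)"
        using integral_truncated_product_le[OF z y zy B(1) T(1)] by (intro mult_left_mono) auto
      finally have pr: "(\<Sum>j<n. min ((?s z j)\<^sup>2) B * min ((?s y j)\<^sup>2) T) \<le> real n * (1 + \<delta>)" .
      \<comment> \<open>Here an upper bound is needed. The part of a(y) above T gets weight at most
        B, and its total S - M is at most (1 + \<delta>) n - (1 - 2 \<delta>) n = 3 \<delta>
        n.\<close>
      have "(\<Sum>j<n. min ((?s z j)\<^sup>2) B * (?s y j)\<^sup>2)
          \<le> (\<Sum>j<n. min ((?s z j)\<^sup>2) B * min ((?s y j)\<^sup>2) T + B * ((?s y j)\<^sup>2 - min ((?s y j)\<^sup>2) T))"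
      proof (rule sum_mono)
        fix j
        have "min ((?s z j)\<^sup>2) B * ((?s y j)\<^sup>2 - min ((?s y j)\<^sup>2) T) \<le> B * ((?s y j)\<^sup>2 - min ((?s y j)\<^sup>2) T)"
          by (intro mult_right_mono) auto
        then show "min ((?s z j)\<^sup>2) B * (?s y j)\<^sup>2
            \<le> min ((?s z j)\<^sup>2) B * min ((?s y j)\<^sup>2) T + B * ((?s y j)\<^sup>2 - min ((?s y j)\<^sup>2) T)"
          by (simp only: right_diff_distrib)
      qed
      also have "\<dots> = (\<Sum>j<n. min ((?s z j)\<^sup>2) B * min ((?s y j)\<^sup>2) T) + B * (S - M)"
        unfolding S_def M_def by (simp add: sum.distrib sum_subtractf flip: sum_distrib_left)
      also have "\<dots> \<le> real n * (1 + \<delta>) + B * (3 * \<delta> * real n)"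
        using pr up M B by (intro add_mono mult_left_mono) (auto simp: algebra_simps)
      finally have cross: "(\<Sum>j<n. min ((?s z j)\<^sup>2) B * (?s y j)\<^sup>2) \<le> real n * (1 + \<delta>) + B * (3 * \<delta> * real n)" .
      have "\<delta> * (2 * c + 1 + 3 * B) < \<kappa> / 4" using \<delta>(2) \<kappa> by simp
      then have "0 < real n * (\<kappa> / 4 - \<delta> * (2 * c + 1 + 3 * B))" using n by simp
      also have "\<dots> = c * (real n * (1 - 2 * \<delta>)) - (real n * (1 + \<delta>) + B * (3 * \<delta> * real n))"
        by (simp add: c_def algebra_simps)
      also have "\<dots> \<le> c * S - (\<Sum>j<n. min ((?s z j)\<^sup>2) B * (?s y j)\<^sup>2)"
        using M MS cross c by (intro diff_mono mult_left_mono) auto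
      also have "\<dots> = (\<Sum>j<n. \<phi> (?s z j) * (?s y j)\<^sup>2)"
        by (simp add: \<phi>_def S_def left_diff_distrib sum_subtractf sum_distrib_left)
      finally show "0 < (\<Sum>j<n. \<phi> (?s z j) * (?s y j)\<^sup>2)" .
    qed
  qed
  then show ?thesis by (rule that)
qed

section \<open>Separation implies unique recovery\<close>

definition mat_pairing :: "nat \<Rightarrow> (nat \<Rightarrow> nat \<Rightarrow> real) \<Rightarrow> (nat \<Rightarrow> nat \<Rightarrow> real) \<Rightarrow> real" where
  "mat_pairing d H P = (\<Sum>i<d. \<Sum>l<d. H i l * P l i)"

text \<open>For orthogonal \<open>U\<close>, the entries of the orthogonal projector onto the span
  of the first \<open>k\<close> columns.\<close>

definition column_proj :: "nat \<Rightarrow> real mat \<Rightarrow> nat \<Rightarrow> nat \<Rightarrow> real" where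
  "column_proj k U i l = (\<Sum>m<k. U $$ (i, m) * U $$ (l, m))"

lemma mat_pairing_rank_one:
  assumes "0 < k" "0 < d"
  shows "mat_pairing d (\<lambda>i l. g i * g l) (column_proj k U) = real k / real d * (proj_len k d U g)\<^sup>2"
proof -
  have "mat_pairing d (\<lambda>i l. g i * g l) (column_proj k U)
      = (\<Sum>i<d. \<Sum>l<d. \<Sum>m<k. (U $$ (i, m) * g i) * (U $$ (l, m) * g l))"
    unfolding mat_pairing_def column_proj_def sum_distrib_left
    by (intro sum.cong refl) (simp add: mult_ac)
  also have "\<dots> = (\<Sum>i<d. \<Sum>m<k. \<Sum>l<d. (U $$ (i, m) * g i) * (U $$ (l, m) * g l))"
    by (intro sum.cong refl sum.swap)
  also have "\<dots> = (\<Sum>m<k. \<Sum>i<d. \<Sum>l<d. (U $$ (i, m) * g i) * (U $$ (l, m) * g l))"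
    by (rule sum.swap)
  also have "\<dots> = (\<Sum>m<k. (\<Sum>l<d. U $$ (l, m) * g l)\<^sup>2)"
    unfolding power2_eq_square sum_product ..
  finally show ?thesis using assms by (simp add: proj_len_square)
qed

lemma mat_pairing_decomposition:
  assumes "\<And>i l. i < d \<Longrightarrow> l < d \<Longrightarrow> H i l = (\<Sum>m<r. g m i * g m l) - c * (z i * z l)"
  shows "mat_pairing d H P = (\<Sum>m<r. mat_pairing d (\<lambda>i l. g m i * g m l) P) - c * mat_pairing d (\<lambda>i l. z i * z l) P"
proof -
  have "mat_pairing d H P = (\<Sum>i<d. \<Sum>l<d. (\<Sum>m<r. g m i * g m l * P l i) - c * (z i * z l * P l i))"
    unfolding mat_pairing_def
    by (intro sum.cong refl) (simp add: assms left_diff_distrib sum_distrib_right mult.assoc)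
  also have "\<dots> = (\<Sum>i<d. \<Sum>l<d. \<Sum>m<r. g m i * g m l * P l i) - c * mat_pairing d (\<lambda>i l. z i * z l) P"
    by (simp add: sum_subtractf mat_pairing_def sum_distrib_left)
  also have "(\<Sum>i<d. \<Sum>l<d. \<Sum>m<r. g m i * g m l * P l i) = (\<Sum>m<r. \<Sum>i<d. \<Sum>l<d. g m i * g m l * P l i)"
    unfolding sum.swap[of _ "{..<d}" "{..<r}"] by (rule refl)
  finally show ?thesis by (simp add: mat_pairing_def)
qed

text \<open>If \<open>H\<close> is positive semidefinite apart from one eigenvalue \<open>-\<lambda> < 0\<close> with eigenvector \<open>z\<close>, then the
  \<open>\<phi>\<close>-weighted sum of the measurements of \<open>H\<close> is positive: each part of \<open>H\<close> contributes with the right sign.\<close>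

lemma separation_imp_zero:
  fixes \<phi> :: "real \<Rightarrow> real" and \<omega> :: "nat \<Rightarrow> real mat"
  assumes k: "0 < k" and d: "0 < d"
    and sep: "separates \<phi> k d n \<omega>"
    and sym: "\<And>i l. i < d \<Longrightarrow> l < d \<Longrightarrow> H i l = H l i"
    and psd: "\<And>v. 0 \<le> qform d H v + (\<Sum>i<d. x i * v i)\<^sup>2"
    and zero: "\<And>j. j < n \<Longrightarrow> mat_pairing d H (column_proj k (\<omega> j)) = 0"
    and "i < d" "l < d"
  shows "H i l = 0"
proof -
  let ?s = "\<lambda>g j. proj_len k d (\<omega> j) g"
  have neg: "(\<Sum>j<n. \<phi> (?s z j) * (?s z j)\<^sup>2) < 0" if "(\<Sum>l<d. (z l)\<^sup>2) = 1" for z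
    using sep that by (simp add: separates_def)
  show ?thesis
  proof (cases "\<exists>v. qform d H v < 0")
    case True
    then obtain v where v: "qform d H v < 0" ..
    obtain z lam g where z: "(\<Sum>i<d. (z i)\<^sup>2) = 1" and lam: "lam > 0"
      and gz: "\<And>m. m < d \<Longrightarrow> (\<Sum>i<d. g m i * z i) = 0"
      and H: "\<And>i l. i < d \<Longrightarrow> l < d \<Longrightarrow> H i l = (\<Sum>m<d. g m i * g m l) - lam * (z i * z l)"
      using psd_minus_rank_one_decomposition[where H = H and d = d and x = x and ?v0.0 = v, OF sym d psd v] by blast
    define Y where "Y = (\<lambda>g. \<Sum>j<n. \<phi> (?s z j) * (?s g j)\<^sup>2)"
    \<comment> \<open>Separation speaks of unit vectors; the quadratic form Y extends it to all
      multiples, zero included.\<close>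
    have Y: "0 \<le> Y y" if "(\<Sum>l<d. y l * z l) = 0" for y
    proof (cases "(\<Sum>l<d. (y l)\<^sup>2) = 0")
      case True
      then have "?s y j = 0" for j by (subst (asm) sum_nonneg_eq_0_iff) (auto simp: proj_len_def L2_set_def)
      then show ?thesis by (simp add: Y_def)
    next
      case False
      from exists_normalization[OF this] obtain r :: real where r: "0 < r" "(\<Sum>l<d. (y l / r)\<^sup>2) = 1"
        "\<And>j. ?s y j = r * ?s (\<lambda>l. y l / r) j" by metis
      have "(\<Sum>l<d. z l * (y l / r)) = (\<Sum>l<d. y l * z l) / r" by (simp add: sum_divide_distrib mult.commute)
      then have "0 < Y (\<lambda>l. y l / r)" using sep z r(2) that by (simp add: separates_def Y_def)
      moreover have "Y y = r\<^sup>2 * Y (\<lambda>l. y l / r)"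
        unfolding Y_def r(3)[of "_"] by (simp add: power_mult_distrib sum_distrib_left mult_ac)
      ultimately show ?thesis by simp
    qed
    have dec: "mat_pairing d H P = (\<Sum>m<d. mat_pairing d (\<lambda>i l. g m i * g m l) P) - lam * mat_pairing d (\<lambda>i l. z i * z l) P" for P
      by (rule mat_pairing_decomposition) (rule H)
    have "(\<Sum>m<d. (?s (g m) j)\<^sup>2) - lam * (?s z j)\<^sup>2 = 0" if "j < n" for j
    proof -
      have "real k / real d * ((\<Sum>m<d. (?s (g m) j)\<^sup>2) - lam * (?s z j)\<^sup>2) = mat_pairing d H (column_proj k (\<omega> j))"
        unfolding dec mat_pairing_rank_one[OF k d]
        by (simp add: right_diff_distrib sum_distrib_left)
      then show ?thesis using zero[OF that] k d by simp
    qed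
    \<comment> \<open>Each measurement of H is zero, so weighting them with \<open>\<phi>\<close> at
      z and summing changes nothing; regrouping by rank-one parts gives the contradictory
      signs.\<close>
    then have "0 = (\<Sum>j<n. \<phi> (?s z j) * ((\<Sum>m<d. (?s (g m) j)\<^sup>2) - lam * (?s z j)\<^sup>2))" by simp
    also have "\<dots> = (\<Sum>j<n. \<Sum>m<d. \<phi> (?s z j) * (?s (g m) j)\<^sup>2) - lam * Y z"
      by (simp add: Y_def right_diff_distrib sum_subtractf sum_distrib_left mult_ac)
    also have "(\<Sum>j<n. \<Sum>m<d. \<phi> (?s z j) * (?s (g m) j)\<^sup>2) = (\<Sum>m<d. Y (g m))"
      unfolding Y_def by (rule sum.swap)
    finally have "lam * Y z = (\<Sum>m<d. Y (g m))" by simp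
    moreover have "0 \<le> (\<Sum>m<d. Y (g m))" by (intro sum_nonneg Y gz) simp
    moreover have "lam * Y z < 0" using lam neg[OF z] by (simp add: Y_def mult_pos_neg)
    ultimately show ?thesis by linarith
  next
    case False
    then have "0 \<le> qform d H v" for v by (simp add: not_less)
    then obtain g where g: "\<forall>i<d. \<forall>l<d. H i l = (\<Sum>m<d. g m i * g m l)"
      using psd_sum_rank_one[where H = H and d = d] sym by blast
    have s0: "?s (g m) j = 0" if "j < n" "m < d" for j m
    proof -
      have "mat_pairing d H (column_proj k (\<omega> j)) = real k / real d * (\<Sum>m<d. (?s (g m) j)\<^sup>2)"
        using mat_pairing_decomposition[where H = H and d = d and r = d and g = g and c = 0] g
        by (simp add: mat_pairing_rank_one[OF k d] sum_distrib_left)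
      then have "(\<Sum>m<d. (?s (g m) j)\<^sup>2) = 0" using zero[OF that(1)] k d by simp
      then show ?thesis using that(2) by (subst (asm) sum_nonneg_eq_0_iff) auto
    qed
    \<comment> \<open>A nonzero g_m, normalised, would have length zero under every sample, and the
      sum that separation makes strictly negative would be 0.\<close>
    have "g m i = 0" if "m < d" "i < d" for m i
    proof (rule ccontr)
      assume "g m i \<noteq> 0"
      then have "(\<Sum>l<d. (g m l)\<^sup>2) \<noteq> 0" using that(2) by (subst sum_nonneg_eq_0_iff) auto
      from exists_normalization[OF this] obtain r :: real where r: "0 < r" "(\<Sum>l<d. (g m l / r)\<^sup>2) = 1"
        "\<And>j. ?s (g m) j = r * ?s (\<lambda>l. g m l / r) j" by metis
      then have "?s (\<lambda>l. g m l / r) j = 0" if "j < n" for j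
        using s0[OF that \<open>m < d\<close>] by simp
      then show False using neg[OF r(2)] by simp
    qed
    then show ?thesis using g \<open>i < d\<close> \<open>l < d\<close> by simp
  qed
qed

section \<open>Measurability of the failure of recovery\<close>

text \<open>A nonnegative continuous function on a compact set has a zero iff it takes arbitrarily
  small values on a countable dense subset: continuity gives one direction, attainment of the
  minimum the other. So the uncountable quantifier becomes countable operations.\<close>

lemma measurable_exists_zero_compact:
  fixes F :: "'c :: {metric_space, second_countable_topology} \<Rightarrow> 'w \<Rightarrow> real"
  assumes C: "compact C" and nonneg: "\<And>c \<omega>. 0 \<le> F c \<omega>"
    and cont: "\<And>\<omega>. \<omega> \<in> space M \<Longrightarrow> continuous_on C (\<lambda>c. F c \<omega>)"
    and meas: "\<And>c. c \<in> C \<Longrightarrow> F c \<in> borel_measurable M"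
  shows "{\<omega> \<in> space M. \<exists>c\<in>C. F c \<omega> = 0} \<in> sets M"
proof -
  obtain D where D: "countable D" "D \<subseteq> C" "C \<subseteq> closure D" by (rule separable)
  have "{\<omega> \<in> space M. \<exists>c\<in>C. F c \<omega> = 0} = {\<omega> \<in> space M. \<forall>m. \<exists>c\<in>D. F c \<omega> < 1 / real (Suc m)}"
  proof (intro Collect_cong conj_cong refl iffI allI)
    fix \<omega> m assume \<omega>: "\<omega> \<in> space M" and "\<exists>c\<in>C. F c \<omega> = 0"
    then obtain c where c: "c \<in> C" "F c \<omega> = 0" by blast
    obtain A where A: "open A" "A \<inter> C = (\<lambda>c. F c \<omega>) -` {..<1 / real (Suc m)} \<inter> C"
      using cont[OF \<omega>] unfolding continuous_on_open_invariant by (meson open_lessThan)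
    have "c \<in> A" using A(2) c by auto
    then have "A \<inter> closure D \<noteq> {}" using c D(3) by blast
    then have "A \<inter> D \<noteq> {}" using A(1) open_Int_closure_eq_empty by blast
    then show "\<exists>c\<in>D. F c \<omega> < 1 / real (Suc m)" using A(2) D(2) by blast
  next
    fix \<omega> assume \<omega>: "\<omega> \<in> space M" and small: "\<forall>m. \<exists>c\<in>D. F c \<omega> < 1 / real (Suc m)"
    then have "C \<noteq> {}" using D(2) by blast
    then obtain c where c: "c \<in> C" "\<And>c'. c' \<in> C \<Longrightarrow> F c \<omega> \<le> F c' \<omega>"
      using continuous_attains_inf[OF C _ cont[OF \<omega>]] by blast
    have "F c \<omega> < 1 / real (Suc m)" for m using small c(2) D(2) by (meson order.strict_trans1 subsetD)
    then have "F c \<omega> \<le> 0" using nat_approx_posE not_le by (metis less_asym)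
    then show "\<exists>c\<in>C. F c \<omega> = 0" using nonneg[of c \<omega>] c(1) by (intro bexI[of _ c]) auto
  qed
  also have "\<dots> = (\<Inter>m. \<Union>c\<in>D. {\<omega> \<in> space M. F c \<omega> < 1 / real (Suc m)})" by auto
  also have "\<dots> \<in> sets M"
  proof -
    have "{\<omega> \<in> space M. F c \<omega> < r} \<in> sets M" if "c \<in> D" for c r
      using meas[of c] that D(2) by (intro borel_measurable_less) auto
    then have "(\<Union>c\<in>D. {\<omega> \<in> space M. F c \<omega> < 1 / real (Suc m)}) \<in> sets M" for m
      by (intro sets.countable_UN' D(1)) auto
    then show ?thesis by (intro sets.countable_INT) auto
  qed
  finally show ?thesis .
qed

text \<open>The matrices \<open>(P\<^sub>j)\<close> for which recovery fails form a countable union of projections of compact sets.\<close>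

lemma measurable_recovery_failure:
  fixes P :: "nat \<Rightarrow> 'w \<Rightarrow> nat \<Rightarrow> nat \<Rightarrow> real"
  assumes meas: "\<And>j i l. j < n \<Longrightarrow> i < d \<Longrightarrow> l < d \<Longrightarrow> (\<lambda>\<omega>. P j \<omega> i l) \<in> borel_measurable M"
  shows "{\<omega> \<in> space M. \<exists>(X :: nat \<Rightarrow> nat \<Rightarrow> real) (x :: nat \<Rightarrow> real).
      (\<forall>i<d. \<forall>l<d. X i l = X l i) \<and> (\<forall>v. 0 \<le> qform d X v) \<and>
      (\<forall>j<n. mat_pairing d (\<lambda>i l. X i l - x i * x l) (P j \<omega>) = 0) \<and> (\<exists>i<d. \<exists>l<d. X i l \<noteq> x i * x l)} \<in> sets M"
    (is "?bad \<in> _")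
proof -
  define S where "S = (\<lambda>X :: nat \<times> nat \<Rightarrow> real. \<lambda>x :: nat \<Rightarrow> real. \<Sum>i<d. \<Sum>l<d. (X (i, l) - x i * x l)\<^sup>2)"
  \<comment> \<open>Failure is not a closed condition, as X only has to differ from x x^T, and it is
    not bounded. Bounding all entries by m and the squared distance S from below by 1 / (m + 1)
    makes each piece compact; positive semidefiniteness is an intersection of closed conditions over
    all v.\<close>
  define C :: "nat \<Rightarrow> ((nat \<times> nat \<Rightarrow> real) \<times> (nat \<Rightarrow> real)) set" where
    "C = (\<lambda>m. ({X. \<forall>p. \<bar>X p\<bar> \<le> real m} \<times> {x. \<forall>i. \<bar>x i\<bar> \<le> real m})
      \<inter> (\<Inter>i\<in>{..<d}. \<Inter>l\<in>{..<d}. {c. fst c (i, l) = fst c (l, i)})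
      \<inter> (\<Inter>v. {c. 0 \<le> qform d (\<lambda>i l. fst c (i, l)) v})
      \<inter> {c. 1 / real (Suc m) \<le> S (fst c) (snd c)})"
  define F where "F = (\<lambda>(c :: (nat \<times> nat \<Rightarrow> real) \<times> (nat \<Rightarrow> real)) \<omega>.
    \<Sum>j<n. \<bar>mat_pairing d (\<lambda>i l. fst c (i, l) - snd c i * snd c l) (P j \<omega>)\<bar>)"
  have cf: "continuous_on A (\<lambda>c :: (nat \<times> nat \<Rightarrow> real) \<times> (nat \<Rightarrow> real). fst c p)" for A p
    by (rule continuous_on_compose2[OF continuous_on_coordinate[of UNIV p]]) (auto intro: continuous_intros)
  have cs: "continuous_on A (\<lambda>c :: (nat \<times> nat \<Rightarrow> real) \<times> (nat \<Rightarrow> real). snd c i)" for A i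
    by (rule continuous_on_compose2[OF continuous_on_coordinate[of UNIV i]]) (auto intro: continuous_intros)
  have compact_C: "compact (C m)" for m
    unfolding C_def S_def qform_def
    by (intro compact_Int_closed compact_Times compact_pointwise_bounded closed_INT ballI closed_Collect_eq
        closed_Collect_le continuous_intros cf cs)
  have "{\<omega> \<in> space M. \<exists>c\<in>C m. F c \<omega> = 0} \<in> sets M" for m
  proof (rule measurable_exists_zero_compact[OF compact_C])
    show "0 \<le> F c \<omega>" for c \<omega> by (simp add: F_def sum_nonneg)
    show "continuous_on (C m) (\<lambda>c. F c \<omega>)" for \<omega>
      unfolding F_def mat_pairing_def by (intro continuous_intros cf cs)
    show "F c \<in> borel_measurable M" for c
      unfolding F_def mat_pairing_def
      by (intro borel_measurable_sum borel_measurable_abs borel_measurable_times borel_measurable_const meas) auto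
  qed
  then have "(\<Union>m. {\<omega> \<in> space M. \<exists>c\<in>C m. F c \<omega> = 0}) \<in> sets M"
    by (intro sets.countable_UN) auto
  also have "(\<Union>m. {\<omega> \<in> space M. \<exists>c\<in>C m. F c \<omega> = 0}) = ?bad"
  proof (intro subset_antisym subsetI)
    fix \<omega> assume "\<omega> \<in> (\<Union>m. {\<omega> \<in> space M. \<exists>c\<in>C m. F c \<omega> = 0})"
    then obtain m c where \<omega>: "\<omega> \<in> space M" and c: "c \<in> C m" "F c \<omega> = 0" by blast
    have "\<exists>i<d. \<exists>l<d. fst c (i, l) \<noteq> snd c i * snd c l"
    proof (rule ccontr)
      assume "\<not> ?thesis"
      then have "S (fst c) (snd c) = 0" by (simp add: S_def)
      moreover have "1 / real (Suc m) \<le> S (fst c) (snd c)" using c(1) by (simp add: C_def)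
      moreover have "0 < 1 / real (Suc m)" by simp
      ultimately show False by linarith
    qed
    moreover have "\<forall>j<n. mat_pairing d (\<lambda>i l. fst c (i, l) - snd c i * snd c l) (P j \<omega>) = 0"
      using c(2) unfolding F_def by (subst (asm) sum_nonneg_eq_0_iff) auto
    moreover have "\<forall>i<d. \<forall>l<d. fst c (i, l) = fst c (l, i)" "\<forall>v. 0 \<le> qform d (\<lambda>i l. fst c (i, l)) v"
      using c(1) by (auto simp: C_def)
    ultimately show "\<omega> \<in> ?bad" using \<omega>
      by (intro CollectI conjI exI[of _ "\<lambda>i l. fst c (i, l)"] exI[of _ "snd c"]) auto
  next
    fix \<omega> assume "\<omega> \<in> ?bad"
    then obtain X :: "nat \<Rightarrow> nat \<Rightarrow> real" and x :: "nat \<Rightarrow> real" where \<omega>: "\<omega> \<in> space M"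
      and sym: "\<forall>i<d. \<forall>l<d. X i l = X l i" and psd: "\<forall>v. 0 \<le> qform d X v"
      and zero: "\<forall>j<n. mat_pairing d (\<lambda>i l. X i l - x i * x l) (P j \<omega>) = 0"
      and ne: "\<exists>i<d. \<exists>l<d. X i l \<noteq> x i * x l" by blast
    \<comment> \<open>The bounds in C m concern all indices, so the entries outside the range below
      d are reset to 0.\<close>
    define X' where "X' = (\<lambda>(i, l). if i < d \<and> l < d then X i l else 0)"
    define x' where "x' = (\<lambda>i. if i < d then x i else 0)"
    have S_pos: "0 < S X' x'"
    proof -
      obtain i l where il: "i < d" "l < d" "X i l \<noteq> x i * x l" using ne by blast
      have "0 < (X' (i, l) - x' i * x' l)\<^sup>2" using il by (simp add: X'_def x'_def)
      also have "\<dots> \<le> (\<Sum>l<d. (X' (i, l) - x' i * x' l)\<^sup>2)" using il by (intro member_le_sum) auto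
      also have "\<dots> \<le> S X' x'"
        unfolding S_def using il
        by (intro member_le_sum[of i "{..<d}" "\<lambda>i. \<Sum>l<d. (X' (i, l) - x' i * x' l)\<^sup>2"]) (auto intro: sum_nonneg)
      finally show ?thesis .
    qed
    obtain m0 where m0: "1 / real (Suc m0) < S X' x'" using S_pos by (rule nat_approx_posE)
    define R where "R = (\<Sum>i<d. \<Sum>l<d. \<bar>X i l\<bar>) + (\<Sum>i<d. \<bar>x i\<bar>)"
    obtain m1 :: nat where m1: "R \<le> real m1" using real_arch_simple by blast
    define m where "m = max m0 m1"
    have "(X' , x') \<in> C m"
    proof -
      have "\<bar>X' p\<bar> \<le> R" for p
      proof (cases p)
        case (Pair i l)
        show ?thesis
        proof (cases "i < d \<and> l < d")
          case True
          have "\<bar>X i l\<bar> \<le> (\<Sum>l<d. \<bar>X i l\<bar>)" using True by (intro member_le_sum) auto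
          also have "\<dots> \<le> (\<Sum>i<d. \<Sum>l<d. \<bar>X i l\<bar>)"
            using True by (intro member_le_sum[of i "{..<d}" "\<lambda>i. \<Sum>l<d. \<bar>X i l\<bar>"]) (auto intro: sum_nonneg)
          also have "\<dots> \<le> R" by (simp add: R_def sum_nonneg)
          finally show ?thesis using True by (simp add: X'_def Pair)
        qed (auto simp: X'_def Pair R_def intro!: add_nonneg_nonneg sum_nonneg)
      qed
      moreover have "\<bar>x' i\<bar> \<le> R" for i
      proof (cases "i < d")
        case True
        then have "\<bar>x i\<bar> \<le> (\<Sum>i<d. \<bar>x i\<bar>)" by (intro member_le_sum) auto
        also have "\<dots> \<le> R" by (simp add: R_def sum_nonneg)
        finally show ?thesis using True by (simp add: x'_def)
      qed (auto simp: x'_def R_def intro!: add_nonneg_nonneg sum_nonneg)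
      moreover have "R \<le> real m" using m1 by (simp add: m_def)
      ultimately have "\<forall>p. \<bar>X' p\<bar> \<le> real m" "\<forall>i. \<bar>x' i\<bar> \<le> real m" using order.trans by blast+
      moreover have "\<forall>i<d. \<forall>l<d. X' (i, l) = X' (l, i)" using sym by (simp add: X'_def)
      moreover have "qform d (\<lambda>i l. X' (i, l)) v = qform d X v" for v
        unfolding qform_def by (intro sum.cong refl) (simp add: X'_def)
      moreover have "1 / real (Suc m) \<le> 1 / real (Suc m0)" by (intro divide_left_mono) (auto simp: m_def)
      then have "1 / real (Suc m) \<le> S X' x'" using m0 by linarith
      ultimately show ?thesis using psd by (simp add: C_def)
    qed
    moreover have "mat_pairing d (\<lambda>i l. X' (i, l) - x' i * x' l) (P j \<omega>) = mat_pairing d (\<lambda>i l. X i l - x i * x l) (P j \<omega>)" for j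
      unfolding mat_pairing_def by (intro sum.cong refl) (simp add: X'_def x'_def)
    then have "F (X', x') \<omega> = 0" using zero by (simp add: F_def)
    ultimately show "\<omega> \<in> (\<Union>m. {\<omega> \<in> space M. \<exists>c\<in>C m. F c \<omega> = 0})" using \<omega> by blast
  qed
  finally show ?thesis .
qed

section \<open>Orthogonal projectors onto subspaces\<close>

lemma scalar_prod_sum: "w \<in> carrier_vec d \<Longrightarrow> v \<bullet> w = (\<Sum>i<d. v $ i * w $ i)"
  by (auto simp: scalar_prod_def lessThan_atLeast0)

lemma mult_mat_vec_index_sum:
  "A \<in> carrier_mat r d \<Longrightarrow> v \<in> carrier_vec d \<Longrightarrow> i < r \<Longrightarrow> (A *\<^sub>v v) $ i = (\<Sum>l<d. A $$ (i, l) * v $ l)"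
  by (auto simp: scalar_prod_def lessThan_atLeast0 intro!: sum.cong)

lemma mult_mat_unit_vec_index:
  fixes A :: "real mat"
  assumes "A \<in> carrier_mat r d" "i < r" "j < d"
  shows "(A *\<^sub>v unit_vec d j) $ i = A $$ (i, j)"
proof -
  have "(A *\<^sub>v unit_vec d j) $ i = (\<Sum>l<d. A $$ (i, l) * unit_vec d j $ l)"
    using assms by (intro mult_mat_vec_index_sum) auto
  also have "\<dots> = (\<Sum>l<d. if l = j then A $$ (i, l) else 0)"
    using assms by (intro sum.cong) auto
  finally show ?thesis using assms by simp
qed

lemma subspace_module_vecD:
  assumes "VectorSpace.subspace class_ring V (module_vec TYPE(real) d)"
  shows "V \<subseteq> carrier_vec d" "0\<^sub>v d \<in> V" "\<And>v w. v \<in> V \<Longrightarrow> w \<in> V \<Longrightarrow> v + w \<in> V"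
    "\<And>c v. v \<in> V \<Longrightarrow> c \<cdot>\<^sub>v v \<in> V"
proof -
  have sub: "submodule class_ring V (module_vec TYPE(real) d)"
    using assms by (simp add: VectorSpace.subspace_def)
  show "V \<subseteq> carrier_vec d" "0\<^sub>v d \<in> V" "\<And>v w. v \<in> V \<Longrightarrow> w \<in> V \<Longrightarrow> v + w \<in> V"
    using submodule.subset[OF sub] submodule.zero_closed[OF sub] submodule.m_closed[OF sub]
    by (auto simp: module_vec_simps)
  show "c \<cdot>\<^sub>v v \<in> V" if "v \<in> V" for c v
    using submodule.smult_closed[OF sub _ that, of c] by (simp add: module_vec_simps class_ring_simps)
qed

text \<open>The definite description needs uniqueness: for two candidates the difference w of the
  images of x lies in V and is orthogonal to both residuals, hence to their difference, which is w
  itself.\<close>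

lemma proj_mat_eqI:
  assumes V: "V \<subseteq> carrier_vec d" "\<And>v w. v \<in> V \<Longrightarrow> w \<in> V \<Longrightarrow> v - w \<in> V"
    and P: "P \<in> carrier_mat d d" "\<And>x. x \<in> carrier_vec d \<Longrightarrow> P *\<^sub>v x \<in> V"
      "\<And>x v. x \<in> carrier_vec d \<Longrightarrow> v \<in> V \<Longrightarrow> (x - P *\<^sub>v x) \<bullet> v = 0"
  shows "proj_mat d V = P"
  unfolding proj_mat_def
proof (rule the_equality)
  show "P \<in> carrier_mat d d \<and> (\<forall>x\<in>carrier_vec d. P *\<^sub>v x \<in> V \<and> (\<forall>v\<in>V. (x - P *\<^sub>v x) \<bullet> v = 0))"
    using P by blast
next
  fix Q assume Q: "Q \<in> carrier_mat d d \<and> (\<forall>x\<in>carrier_vec d. Q *\<^sub>v x \<in> V \<and> (\<forall>v\<in>V. (x - Q *\<^sub>v x) \<bullet> v = 0))"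
  have eq: "Q *\<^sub>v x = P *\<^sub>v x" if x: "x \<in> carrier_vec d" for x
  proof -
    define p q w where "p = P *\<^sub>v x" and "q = Q *\<^sub>v x" and "w = p - q"
    have V': "p \<in> V" "q \<in> V" "w \<in> V" using P(2)[OF x] Q x V(2) by (auto simp: p_def q_def w_def)
    then have c: "p \<in> carrier_vec d" "q \<in> carrier_vec d" "w \<in> carrier_vec d" using V(1) by auto
    have "(x - p) \<bullet> w = 0" "(x - q) \<bullet> w = 0" using P(3)[OF x V'(3)] Q x V'(3) by (auto simp: p_def q_def)
    then have "(\<Sum>i<d. (x $ i - p $ i) * w $ i) = 0" "(\<Sum>i<d. (x $ i - q $ i) * w $ i) = 0"
      using c x by (auto simp: scalar_prod_sum[OF c(3)])
    then have "(\<Sum>i<d. (x $ i - q $ i) * w $ i - (x $ i - p $ i) * w $ i) = 0" by (simp add: sum_subtractf)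
    also have "(\<Sum>i<d. (x $ i - q $ i) * w $ i - (x $ i - p $ i) * w $ i) = (\<Sum>i<d. (p $ i - q $ i)\<^sup>2)"
      using c by (intro sum.cong refl) (simp add: w_def power2_eq_square algebra_simps)
    finally have "\<forall>i<d. p $ i = q $ i" by (subst (asm) sum_nonneg_eq_0_iff) auto
    then show ?thesis using c by (intro eq_vecI) (auto simp: p_def[symmetric] q_def[symmetric])
  qed
  show "Q = P"
  proof (rule eq_matI)
    fix i j assume ij: "i < dim_row P" "j < dim_col P"
    have "(Q *\<^sub>v unit_vec d j) $ i = (P *\<^sub>v unit_vec d j) $ i" using eq[of "unit_vec d j"] by simp
    then show "Q $$ (i, j) = P $$ (i, j)"
      using Q P(1) ij mult_mat_unit_vec_index[of Q d d i j] mult_mat_unit_vec_index[of P d d i j] by simp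
  qed (use P(1) Q in auto)
qed

definition orthonormal_in :: "real vec set \<Rightarrow> real vec set \<Rightarrow> bool" where
  "orthonormal_in V B \<longleftrightarrow> finite B \<and> B \<subseteq> V \<and> (\<forall>b\<in>B. \<forall>c\<in>B. b \<bullet> c = (if b = c then 1 else 0))"

text \<open>The matrix p is the sum of b b^T over B, symmetric and idempotent. Its diagonal entries
  are at most 1, because the squared distance of the i-th unit vector from its image is 1 - p_ii,
  and its trace is the cardinality of B.\<close>

lemma card_orthonormal_le:
  assumes V: "V \<subseteq> carrier_vec d" and B: "orthonormal_in V B"
  shows "card B \<le> d"
proof -
  have fin: "finite B" and BV: "B \<subseteq> carrier_vec d" using B V by (auto simp: orthonormal_in_def)
  have orth: "(\<Sum>i<d. b $ i * c $ i) = (if b = c then 1 else 0)" if "b \<in> B" "c \<in> B" for b c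
  proof -
    have "c \<in> carrier_vec d" using BV that by blast
    then show ?thesis using B that scalar_prod_sum[of c d b] by (simp add: orthonormal_in_def)
  qed
  define p where "p = (\<lambda>i l. \<Sum>b\<in>B. b $ i * b $ l)"
  have "p i i \<le> 1" if "i < d" for i
  proof -
    have "(\<Sum>l<d. (p i l)\<^sup>2) = (\<Sum>l<d. \<Sum>b\<in>B. \<Sum>c\<in>B. (b $ i * c $ i) * (b $ l * c $ l))"
      unfolding p_def power2_eq_square sum_product by (intro sum.cong refl) (simp add: mult_ac)
    also have "\<dots> = (\<Sum>b\<in>B. \<Sum>c\<in>B. \<Sum>l<d. (b $ i * c $ i) * (b $ l * c $ l))"
      by (rule sum_rotate3)
    also have "\<dots> = (\<Sum>b\<in>B. \<Sum>c\<in>B. (b $ i * c $ i) * (\<Sum>l<d. b $ l * c $ l))"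
      unfolding sum_distrib_left ..
    also have "\<dots> = (\<Sum>b\<in>B. \<Sum>c\<in>B. (b $ i * c $ i) * (if b = c then 1 else 0))"
      by (intro sum.cong refl) (simp add: orth)
    also have "\<dots> = p i i" using fin by (simp add: p_def if_distrib[of "\<lambda>x. _ * x"] cong: if_cong)
    finally have "(\<Sum>l<d. (p i l)\<^sup>2) = p i i" .
    moreover have "0 \<le> (\<Sum>l<d. ((if l = i then 1 else 0) - p i l)\<^sup>2)" by (intro sum_nonneg) auto
    moreover have "(\<Sum>l<d. ((if l = i then 1 else 0) - p i l)\<^sup>2)
        = (\<Sum>l<d. (if l = i then 1 - 2 * p i l else 0) + (p i l)\<^sup>2)"
      by (intro sum.cong refl) (simp add: power2_diff)
    ultimately show ?thesis using that by (simp add: sum.distrib)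
  qed
  then have "(\<Sum>i<d. p i i) \<le> real d" using sum_mono[of "{..<d}" "\<lambda>i. p i i" "\<lambda>_. 1"] by simp
  also have "(\<Sum>i<d. p i i) = (\<Sum>b\<in>B. \<Sum>i<d. b $ i * b $ i)" unfolding p_def by (rule sum.swap)
  also have "\<dots> = real (card B)" by (simp add: orth)
  finally show ?thesis by simp
qed

lemma sum_in_subspace:
  assumes V: "V \<subseteq> carrier_vec d" "0\<^sub>v d \<in> V" "\<And>v w. v \<in> V \<Longrightarrow> w \<in> V \<Longrightarrow> v + w \<in> V" "\<And>c v. v \<in> V \<Longrightarrow> c \<cdot>\<^sub>v v \<in> V"
    and "finite B" "B \<subseteq> V"
  shows "Matrix.vec d (\<lambda>i. \<Sum>b\<in>B. f b * b $ i) \<in> V"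
  using assms(5,6)
proof (induction B rule: finite_induct)
  case empty
  have "Matrix.vec d (\<lambda>i. \<Sum>b\<in>{}. f b * b $ i) = 0\<^sub>v d" by auto
  then show ?case using V(2) by simp
next
  case (insert b B)
  have "Matrix.vec d (\<lambda>i. \<Sum>b\<in>insert b B. f b * b $ i) = f b \<cdot>\<^sub>v b + Matrix.vec d (\<lambda>i. \<Sum>b\<in>B. f b * b $ i)"
    using insert V(1) by (intro eq_vecI) auto
  then show ?case using insert V(3,4) by auto
qed

text \<open>A maximal orthonormal subset of \<open>V\<close> is a basis of \<open>V\<close>, since otherwise the normalised residual of
  a vector of \<open>V\<close> would extend it.\<close>

lemma proj_mat_carrier:
  assumes "VectorSpace.subspace class_ring V (module_vec TYPE(real) d)"
  shows "proj_mat d V \<in> carrier_mat d d"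
proof -
  note V = subspace_module_vecD[OF assms]
  have "orthonormal_in V {}" by (simp add: orthonormal_in_def)
  moreover have "\<forall>B. orthonormal_in V B \<longrightarrow> card B < Suc d"
    using card_orthonormal_le[OF V(1)] by (simp add: less_Suc_eq_le)
  ultimately have "\<exists>B. orthonormal_in V B \<and> (\<forall>B'. orthonormal_in V B' \<longrightarrow> card B' \<le> card B)"
    by (rule ex_has_greatest_nat)
  then obtain B where B: "orthonormal_in V B" and max: "\<And>B'. orthonormal_in V B' \<Longrightarrow> card B' \<le> card B"
    by blast
  have fin: "finite B" and BV: "B \<subseteq> V" using B by (auto simp: orthonormal_in_def)
  have carr: "b \<in> carrier_vec d" if "b \<in> B" for b using that BV V(1) by blast
  have orth: "(\<Sum>i<d. b $ i * c $ i) = (if b = c then 1 else 0)" if "b \<in> B" "c \<in> B" for b c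
    using B that scalar_prod_sum[OF carr[OF that(2)], of b] by (simp add: orthonormal_in_def)
  define P where "P = Matrix.mat d d (\<lambda>(i, l). \<Sum>b\<in>B. b $ i * b $ l)"
  have Px: "P *\<^sub>v x = Matrix.vec d (\<lambda>i. \<Sum>b\<in>B. (\<Sum>l<d. b $ l * x $ l) * b $ i)" if x: "x \<in> carrier_vec d" for x
  proof (rule eq_vecI)
    fix i assume "i < dim_vec (Matrix.vec d (\<lambda>i. \<Sum>b\<in>B. (\<Sum>l<d. b $ l * x $ l) * b $ i))"
    then have i: "i < d" by simp
    have "(P *\<^sub>v x) $ i = (\<Sum>l<d. \<Sum>b\<in>B. b $ i * b $ l * x $ l)"
      using i x by (subst mult_mat_vec_index_sum[of _ d d]) (auto simp: P_def sum_distrib_right)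
    also have "\<dots> = (\<Sum>b\<in>B. (\<Sum>l<d. b $ l * x $ l) * b $ i)"
      by (subst sum.swap) (simp add: sum_distrib_left mult_ac)
    finally show "(P *\<^sub>v x) $ i = Matrix.vec d (\<lambda>i. \<Sum>b\<in>B. (\<Sum>l<d. b $ l * x $ l) * b $ i) $ i" using i by simp
  qed (simp add: P_def)
  have PV: "P *\<^sub>v x \<in> V" if "x \<in> carrier_vec d" for x
    unfolding Px[OF that] by (rule sum_in_subspace[OF V fin BV])
  have resid: "(\<Sum>i<d. (x $ i - (P *\<^sub>v x) $ i) * c $ i) = 0" if x: "x \<in> carrier_vec d" and c: "c \<in> B" for x c
  proof -
    have "(\<Sum>i<d. (P *\<^sub>v x) $ i * c $ i) = (\<Sum>i<d. \<Sum>b\<in>B. (\<Sum>l<d. b $ l * x $ l) * (b $ i * c $ i))"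
      by (simp add: Px[OF x] sum_distrib_right mult.assoc)
    also have "\<dots> = (\<Sum>b\<in>B. (\<Sum>l<d. b $ l * x $ l) * (\<Sum>i<d. b $ i * c $ i))"
      by (subst sum.swap) (simp add: sum_distrib_left)
    also have "\<dots> = (\<Sum>b\<in>B. if b = c then (\<Sum>l<d. b $ l * x $ l) else 0)"
      by (intro sum.cong refl) (simp add: orth c)
    also have "\<dots> = (\<Sum>i<d. x $ i * c $ i)" using fin c by (simp add: mult.commute)
    finally show ?thesis by (simp add: left_diff_distrib sum_subtractf)
  qed
  have fixed: "P *\<^sub>v v = v" if v: "v \<in> V" for v
  proof (rule ccontr)
    assume ne: "P *\<^sub>v v \<noteq> v"
    have vc: "v \<in> carrier_vec d" using v V(1) by blast
    define w where "w = v + (-1) \<cdot>\<^sub>v (P *\<^sub>v v)"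
    have wV: "w \<in> V" unfolding w_def by (intro V(3,4) v PV vc)
    have Pvc: "P *\<^sub>v v \<in> carrier_vec d" using PV[OF vc] V(1) by blast
    have wi: "w $ i = v $ i - (P *\<^sub>v v) $ i" if "i < d" for i
      using that vc by (simp add: w_def P_def)
    define r where "r = sqrt (\<Sum>i<d. (w $ i)\<^sup>2)"
    have "\<exists>i<d. w $ i \<noteq> 0"
    proof (rule ccontr)
      assume "\<not> ?thesis"
      then have "\<forall>i<d. (P *\<^sub>v v) $ i = v $ i" using wi by simp
      then have "P *\<^sub>v v = v"
        using carrier_vecD[OF vc] carrier_vecD[OF Pvc] by (intro eq_vecI) (simp_all only:)
      then show False using ne by simp
    qed
    then have "(\<Sum>i<d. (w $ i)\<^sup>2) \<noteq> 0" by (subst sum_nonneg_eq_0_iff) auto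
    then have r: "r > 0" "r\<^sup>2 = (\<Sum>i<d. (w $ i)\<^sup>2)"
      using sum_nonneg[of "{..<d}" "\<lambda>i. (w $ i)\<^sup>2"] by (auto simp: r_def less_le)
    define u where "u = (1 / r) \<cdot>\<^sub>v w"
    have uV: "u \<in> V" unfolding u_def by (intro V(4) wV)
    have uc: "u \<in> carrier_vec d" using uV V(1) by blast
    have wc: "w \<in> carrier_vec d" using wV V(1) by blast
    have ui: "u $ i = w $ i / r" if "i < d" for i using that wc by (simp add: u_def)
    have uc0: "(\<Sum>i<d. u $ i * c $ i) = 0" if c: "c \<in> B" for c
    proof -
      have "(\<Sum>i<d. u $ i * c $ i) = (\<Sum>i<d. (v $ i - (P *\<^sub>v v) $ i) * c $ i) / r"
        by (simp add: ui wi sum_divide_distrib)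
      then show ?thesis using resid[OF vc c] by simp
    qed
    have uu: "(\<Sum>i<d. u $ i * u $ i) = 1"
    proof -
      have "(\<Sum>i<d. u $ i * u $ i) = (\<Sum>i<d. (w $ i)\<^sup>2) / r\<^sup>2"
        by (simp add: ui power2_eq_square sum_divide_distrib)
      then show ?thesis unfolding r(2)[symmetric] using r(1) by simp
    qed
    have "u \<notin> B"
    proof
      assume "u \<in> B"
      then show False using uc0[of u] uu by simp
    qed
    have "orthonormal_in V (insert u B)"
      unfolding orthonormal_in_def
    proof (intro conjI ballI)
      fix b c assume b: "b \<in> insert u B" and c: "c \<in> insert u B"
      then have "c \<in> carrier_vec d" using uc carr by blast
      then have "b \<bullet> c = (\<Sum>i<d. b $ i * c $ i)" by (rule scalar_prod_sum)
      also have "\<dots> = (if b = c then 1 else 0)"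
      proof -
        have u_right: "(\<Sum>i<d. a $ i * u $ i) = 0" if "a \<in> B" for a
          using uc0[OF that] by (simp add: mult.commute)
        consider "b = u" "c = u" | "b = u" "c \<in> B" | "b \<in> B" "c = u" | "b \<in> B" "c \<in> B"
          using b c by blast
        then show ?thesis
        proof cases
          case 1
          then show ?thesis by (simp add: uu)
        next
          case 2
          then have "b \<noteq> c" using \<open>u \<notin> B\<close> by blast
          then show ?thesis using uc0[OF 2(2)] 2(1) by simp
        next
          case 3
          then have "b \<noteq> c" using \<open>u \<notin> B\<close> by blast
          then show ?thesis using u_right[OF 3(1)] 3(2) by simp
        next
          case 4
          then show ?thesis by (rule orth)
        qed
      qed
      finally show "b \<bullet> c = (if b = c then 1 else 0)" .
    qed (use fin BV uV in auto)
    then have "card (insert u B) \<le> card B" by (rule max)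
    then show False using fin \<open>u \<notin> B\<close> by simp
  qed
  have "proj_mat d V = P"
  proof (rule proj_mat_eqI[OF V(1) _ _ PV])
    show "v - w \<in> V" if "v \<in> V" "w \<in> V" for v w
    proof -
      have "v - w = v + (-1) \<cdot>\<^sub>v w" using that V(1) by (intro eq_vecI) auto
      then show ?thesis using V(3)[OF that(1) V(4)[OF that(2)]] by simp
    qed
    show "(x - P *\<^sub>v x) \<bullet> v = 0" if x: "x \<in> carrier_vec d" and v: "v \<in> V" for x v
    proof -
      have vc: "v \<in> carrier_vec d" and Pc: "P *\<^sub>v x \<in> carrier_vec d" using v PV[OF x] V(1) by auto
      have "(x - P *\<^sub>v x) \<bullet> v = (\<Sum>i<d. (x $ i - (P *\<^sub>v x) $ i) * v $ i)"
        unfolding scalar_prod_sum[OF vc]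
        by (intro sum.cong refl) (simp add: P_def del: index_mult_mat_vec)
      also have "\<dots> = (\<Sum>i<d. (x $ i - (P *\<^sub>v x) $ i) * (P *\<^sub>v v) $ i)" by (simp add: fixed[OF v])
      also have "\<dots> = (\<Sum>i<d. \<Sum>b\<in>B. (\<Sum>l<d. b $ l * v $ l) * ((x $ i - (P *\<^sub>v x) $ i) * b $ i))"
        by (simp add: Px[OF vc] sum_distrib_left mult_ac)
      also have "\<dots> = (\<Sum>b\<in>B. (\<Sum>l<d. b $ l * v $ l) * (\<Sum>i<d. (x $ i - (P *\<^sub>v x) $ i) * b $ i))"
        by (subst sum.swap) (simp add: sum_distrib_left)
      also have "\<dots> = 0" using resid[OF x] by simp
      finally show ?thesis .
    qed
  qed (simp add: P_def)
  then show ?thesis by (simp add: P_def)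
qed

section \<open>Subspaces spanned by columns of an orthogonal matrix\<close>

definition rotated_subspace :: "nat \<Rightarrow> nat \<Rightarrow> real mat \<Rightarrow> real vec set" where
  "rotated_subspace k d U = (\<lambda>v. U *\<^sub>v v) ` coord_subspace k d"

text \<open>Vectors of \<open>coord_subspace\<close> vanish from index k on, so only the first k
  columns of U act. The right-hand side is the column space in the form given by
  \<open>col_space_eq\<close>.\<close>

lemma rotated_subspace_eq:
  assumes U: "U \<in> carrier_mat d d" and k: "k \<le> d"
  defines "A \<equiv> Matrix.mat d k (\<lambda>(i, m). U $$ (i, m))"
  shows "rotated_subspace k d U = {y \<in> carrier_vec d. \<exists>x\<in>carrier_vec k. A *\<^sub>v x = y}"
proof (intro subset_antisym subsetI)
  have A: "A \<in> carrier_mat d k" by (simp add: A_def)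
  have mult: "U *\<^sub>v v = A *\<^sub>v x" if v: "v \<in> carrier_vec d" and x: "x \<in> carrier_vec k"
    and vx: "\<And>i. i < k \<Longrightarrow> v $ i = x $ i" "\<And>i. i < d \<Longrightarrow> k \<le> i \<Longrightarrow> v $ i = 0" for v x
  proof (rule eq_vecI)
    fix i assume "i < dim_vec (A *\<^sub>v x)"
    then have i: "i < d" by (simp add: A_def)
    have "(\<Sum>l<d. U $$ (i, l) * v $ l) = (\<Sum>l<k. U $$ (i, l) * v $ l)"
      using k vx(2) by (intro sum.mono_neutral_right) auto
    also have "\<dots> = (\<Sum>l<k. A $$ (i, l) * x $ l)"
      using i by (intro sum.cong refl) (simp add: A_def vx)
    finally show "(U *\<^sub>v v) $ i = (A *\<^sub>v x) $ i"
      by (simp only: mult_mat_vec_index_sum[OF U v i] mult_mat_vec_index_sum[OF A x i])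
  qed (use U in \<open>simp add: A_def\<close>)
  fix y
  {
    assume "y \<in> rotated_subspace k d U"
    then obtain v where v: "v \<in> carrier_vec d" "\<forall>i<d. k \<le> i \<longrightarrow> v $ i = 0" "y = U *\<^sub>v v"
      by (auto simp: rotated_subspace_def coord_subspace_def)
    have "y = A *\<^sub>v Matrix.vec k (\<lambda>i. v $ i)"
      unfolding v(3) using v(1,2) by (intro mult) auto
    then show "y \<in> {y \<in> carrier_vec d. \<exists>x\<in>carrier_vec k. A *\<^sub>v x = y}"
      using mult_mat_vec_carrier[OF A] by auto
  next
    assume "y \<in> {y \<in> carrier_vec d. \<exists>x\<in>carrier_vec k. A *\<^sub>v x = y}"
    then obtain x where x: "x \<in> carrier_vec k" "y = A *\<^sub>v x" by blast
    define v where "v = Matrix.vec d (\<lambda>i. if i < k then x $ i else 0)"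
    have "y = U *\<^sub>v v" unfolding x(2) using k x(1) by (intro mult[symmetric]) (auto simp: v_def)
    moreover have "v \<in> coord_subspace k d" by (simp add: v_def coord_subspace_def)
    ultimately show "y \<in> rotated_subspace k d U" by (auto simp: rotated_subspace_def)
  }
qed

text \<open>The first k columns form a basis: they span by \<open>rotated_subspace_eq\<close>, are
  distinct by orthonormality, and are independent as a subset of the rows of the invertible
  transpose of U.\<close>

lemma rotated_subspace_in_grassmannian:
  assumes U: "U \<in> orthogonal_group d" and k: "k \<le> d"
  shows "rotated_subspace k d U \<in> grassmannian k d"
proof -
  interpret vec_space "TYPE(real)" d .
  have Uc: "U \<in> carrier_mat d d" and UU: "transpose_mat U * U = 1\<^sub>m d" using U by (auto simp: orthogonal_group_def)
  define A where "A = Matrix.mat d k (\<lambda>(i, m). U $$ (i, m))"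
  define S where "S = set (cols A)"
  have A: "A \<in> carrier_mat d k" by (simp add: A_def)
  have S_eq: "S = col U ` {..<k}"
  proof -
    have "col A m = col U m" if "m < k" for m
      using that k Uc by (intro eq_vecI) (auto simp: A_def)
    then show ?thesis using A by (auto simp: S_def cols_def)
  qed
  have S: "S \<subseteq> carrier_vec d" "finite S" using A by (auto simp: S_def cols_def)
  have W: "rotated_subspace k d U = span S"
    using col_space_eq[OF A] A unfolding rotated_subspace_eq[OF Uc k] A_def[symmetric] col_space_def S_def by simp
  have card: "card S = k"
  proof -
    have "inj_on (col U) {..<k}"
    proof (rule inj_onI, rule ccontr)
      fix a b assume a: "a \<in> {..<k}" and b: "b \<in> {..<k}" and eq: "col U a = col U b" and ne: "a \<noteq> b"
      have ab: "a < d" "b < d" using a b k by auto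
      have "(\<Sum>l<d. U $$ (l, a) * U $$ (l, b)) = (\<Sum>l<d. U $$ (l, a) * U $$ (l, a))"
      proof (intro sum.cong refl)
        fix l assume l: "l \<in> {..<d}"
        have "col U a $ l = col U b $ l" using eq by simp
        then show "U $$ (l, a) * U $$ (l, b) = U $$ (l, a) * U $$ (l, a)" using l ab Uc by auto
      qed
      then show False
        using ne orthogonal_group_columns[OF U ab(1) ab(2)] orthogonal_group_columns[OF U ab(1) ab(1)] by simp
    qed
    then show ?thesis by (simp add: S_eq card_image)
  qed
  have "det (transpose_mat U) * det U = 1"
    using det_mult[of "transpose_mat U" d U] Uc UU by simp
  then have "det (transpose_mat U) \<noteq> 0" by auto
  then have "lin_indpt (set (rows (transpose_mat U)))"
    using Uc by (intro det_not_0_imp_lin_indpt_rows) auto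
  moreover have "S \<subseteq> set (rows (transpose_mat U))"
    using k Uc by (auto simp: S_eq cols_def)
  ultimately have li: "lin_indpt S" by (rule subset_li_is_li)
  have sub: "VectorSpace.subspace class_ring (span S) V" by (rule span_is_subspace[OF S(1)])
  have subm: "submodule class_ring (span S) V" by (rule span_is_submodule[OF S(1)])
  have vsW: "vectorspace class_ring (vs (span S))" using sub by (rule subspace_is_vs)
  have in_span: "S \<subseteq> span S" by (rule in_own_span[OF S(1)])
  have "vectorspace.basis class_ring (vs (span S)) S"
    unfolding vectorspace.basis_def[OF vsW]
    using span_li_not_depend[OF in_span subm] li in_span by simp
  then have "vectorspace.dim class_ring (vs (span S)) = k"
    using vectorspace.dim_basis[OF vsW S(2)] card by simp
  then show ?thesis using sub unfolding W grassmannian_def by simp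
qed

text \<open>The sum of u_m u_m^T over the first k columns maps into their span, and its residuals
  are orthogonal to each u_m. The projector is thus polynomial in the entries of U, which also
  yields its measurability.\<close>

lemma proj_mat_rotated_subspace:
  assumes U: "U \<in> orthogonal_group d" and k: "k \<le> d"
  shows "proj_mat d (rotated_subspace k d U) = Matrix.mat d d (\<lambda>(i, l). column_proj k U i l)"
proof -
  have Uc: "U \<in> carrier_mat d d" using U by (simp add: orthogonal_group_def)
  have "VectorSpace.subspace class_ring (rotated_subspace k d U) (module_vec TYPE(real) d)"
    using rotated_subspace_in_grassmannian[OF assms] by (simp add: grassmannian_def)
  note W = subspace_module_vecD[OF this]
  let ?P = "Matrix.mat d d (\<lambda>(i, l). column_proj k U i l)"
  define \<xi> where "\<xi> = (\<lambda>x m. \<Sum>l<d. U $$ (l, m) * x $ l)"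
  have Px: "(?P *\<^sub>v x) $ i = (\<Sum>m<k. U $$ (i, m) * \<xi> x m)" if x: "x \<in> carrier_vec d" and i: "i < d" for x i
  proof -
    have "(?P *\<^sub>v x) $ i = (\<Sum>l<d. \<Sum>m<k. U $$ (i, m) * U $$ (l, m) * x $ l)"
      using i x by (subst mult_mat_vec_index_sum[of _ d d]) (auto simp: column_proj_def sum_distrib_right)
    also have "\<dots> = (\<Sum>m<k. U $$ (i, m) * \<xi> x m)"
      unfolding \<xi>_def by (subst sum.swap) (simp add: sum_distrib_left mult.assoc)
    finally show ?thesis .
  qed
  show ?thesis
  proof (rule proj_mat_eqI[OF W(1)])
    show "v - w \<in> rotated_subspace k d U" if "v \<in> rotated_subspace k d U" "w \<in> rotated_subspace k d U" for v w
    proof -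
      have "v - w = v + (-1) \<cdot>\<^sub>v w" using that W(1) by (intro eq_vecI) auto
      then show ?thesis using W(3)[OF that(1) W(4)[OF that(2)]] by simp
    qed
    show "?P *\<^sub>v x \<in> rotated_subspace k d U" if x: "x \<in> carrier_vec d" for x
    proof -
      define v where "v = Matrix.vec d (\<lambda>m. if m < k then \<xi> x m else 0)"
      have v: "v \<in> carrier_vec d" by (simp add: v_def)
      have "?P *\<^sub>v x = U *\<^sub>v v"
      proof (rule eq_vecI)
        fix i assume "i < dim_vec (U *\<^sub>v v)"
        then have i: "i < d" using Uc by simp
        have "(\<Sum>l<d. U $$ (i, l) * v $ l) = (\<Sum>l<k. U $$ (i, l) * v $ l)"
          using k by (intro sum.mono_neutral_right) (auto simp: v_def)
        also have "\<dots> = (\<Sum>m<k. U $$ (i, m) * \<xi> x m)"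
          using k by (intro sum.cong refl) (simp add: v_def)
        finally show "(?P *\<^sub>v x) $ i = (U *\<^sub>v v) $ i"
          by (simp only: Px[OF x i] mult_mat_vec_index_sum[OF Uc v i])
      qed (use Uc in simp)
      moreover have "v \<in> coord_subspace k d" by (simp add: v_def coord_subspace_def)
      ultimately show ?thesis by (auto simp: rotated_subspace_def)
    qed
    show "(x - ?P *\<^sub>v x) \<bullet> w = 0" if x: "x \<in> carrier_vec d" and w: "w \<in> rotated_subspace k d U" for x w
    proof -
      obtain v where v: "v \<in> carrier_vec d" "\<forall>i<d. k \<le> i \<longrightarrow> v $ i = 0" "w = U *\<^sub>v v"
        using w by (auto simp: rotated_subspace_def coord_subspace_def)
      have wc: "w \<in> carrier_vec d" using w W(1) by blast
      have wi: "w $ i = (\<Sum>m<k. v $ m * U $$ (i, m))" if i: "i < d" for i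
      proof -
        have "w $ i = (\<Sum>l<d. U $$ (i, l) * v $ l)" unfolding v(3) by (rule mult_mat_vec_index_sum[OF Uc v(1) i])
        also have "\<dots> = (\<Sum>l<k. U $$ (i, l) * v $ l)" using k v(2) by (intro sum.mono_neutral_right) auto
        finally show ?thesis by (simp add: mult.commute)
      qed
      have resid: "(\<Sum>i<d. (x $ i - (?P *\<^sub>v x) $ i) * U $$ (i, m)) = 0" if m: "m < k" for m
      proof -
        have "(\<Sum>i<d. (?P *\<^sub>v x) $ i * U $$ (i, m)) = (\<Sum>i<d. \<Sum>m'<k. \<xi> x m' * (U $$ (i, m') * U $$ (i, m)))"
          by (intro sum.cong refl) (simp add: Px[OF x] sum_distrib_left mult_ac del: index_mult_mat_vec)
        also have "\<dots> = (\<Sum>m'<k. \<xi> x m' * (\<Sum>i<d. U $$ (i, m') * U $$ (i, m)))"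
          by (subst sum.swap) (simp add: sum_distrib_left)
        also have "\<dots> = (\<Sum>m'<k. if m' = m then \<xi> x m' else 0)"
          using m k by (intro sum.cong refl) (simp add: orthogonal_group_columns[OF U])
        also have "\<dots> = \<xi> x m" using m by simp
        finally show ?thesis
          unfolding left_diff_distrib sum_subtractf by (simp add: \<xi>_def mult.commute del: index_mult_mat_vec)
      qed
      have "(x - ?P *\<^sub>v x) \<bullet> w = (\<Sum>i<d. (x $ i - (?P *\<^sub>v x) $ i) * w $ i)"
        using x by (subst scalar_prod_sum[OF wc]) (auto intro!: sum.cong)
      also have "\<dots> = (\<Sum>i<d. \<Sum>m<k. v $ m * ((x $ i - (?P *\<^sub>v x) $ i) * U $$ (i, m)))"
        by (intro sum.cong refl) (simp add: wi sum_distrib_left mult_ac)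
      also have "\<dots> = (\<Sum>m<k. v $ m * (\<Sum>i<d. (x $ i - (?P *\<^sub>v x) $ i) * U $$ (i, m)))"
        by (subst sum.swap) (simp add: sum_distrib_left)
      also have "\<dots> = 0" using resid by simp
      finally show ?thesis .
    qed
  qed simp
qed

section \<open>Recovery\<close>

lemma qform_quadratic:
  assumes "X \<in> carrier_mat d d" "v \<in> carrier_vec d"
  shows "v \<bullet> (X *\<^sub>v v) = qform d (\<lambda>i l. X $$ (i, l)) (\<lambda>i. v $ i)"
proof -
  have "v \<bullet> (X *\<^sub>v v) = (\<Sum>i<d. v $ i * (X *\<^sub>v v) $ i)"
    using assms by (intro scalar_prod_sum) simp
  also have "\<dots> = (\<Sum>i<d. v $ i * (\<Sum>l<d. X $$ (i, l) * v $ l))"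
    by (intro sum.cong refl) (simp add: mult_mat_vec_index_sum[OF assms] del: index_mult_mat_vec)
  finally show ?thesis by (simp add: qform_def sum_distrib_left mult.assoc)
qed

lemma psd_iff_qform:
  assumes "X \<in> carrier_mat d d"
  shows "psd X \<longleftrightarrow> (\<forall>v. 0 \<le> qform d (\<lambda>i l. X $$ (i, l)) v)"
proof
  assume "psd X"
  show "\<forall>v. 0 \<le> qform d (\<lambda>i l. X $$ (i, l)) v"
  proof
    fix v
    have "0 \<le> Matrix.vec d v \<bullet> (X *\<^sub>v Matrix.vec d v)"
      using \<open>psd X\<close> assms by (auto simp: psd_def)
    also have "\<dots> = qform d (\<lambda>i l. X $$ (i, l)) (\<lambda>i. Matrix.vec d v $ i)"
      by (rule qform_quadratic[OF assms]) simp
    also have "\<dots> = qform d (\<lambda>i l. X $$ (i, l)) v" by (simp add: qform_def)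
    finally show "0 \<le> qform d (\<lambda>i l. X $$ (i, l)) v" .
  qed
next
  assume "\<forall>v. 0 \<le> qform d (\<lambda>i l. X $$ (i, l)) v"
  then show "psd X" using assms by (auto simp: psd_def qform_quadratic)
qed

lemma mat_inner_eq_mat_pairing:
  assumes "X \<in> carrier_mat d d" "P \<in> carrier_mat d d"
  shows "mat_inner X P = mat_pairing d (\<lambda>i l. X $$ (i, l)) (\<lambda>i l. P $$ (i, l))"
  using assms unfolding mat_inner_def trace_mat_def mat_pairing_def
  by (auto simp: scalar_prod_def lessThan_atLeast0 intro!: sum.cong)

lemma mat_pairing_diff: "mat_pairing d (\<lambda>i l. G i l - H i l) P = mat_pairing d G P - mat_pairing d H P"
  by (simp add: mat_pairing_def left_diff_distrib sum_subtractf)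

text \<open>Stated for arbitrary matrix functions \<open>P\<close>, so that it applies both to
  orthogonal matrices via \<open>column_proj\<close> and to subspaces via
  \<open>proj_mat\<close>.\<close>

definition recovery_fails :: "nat \<Rightarrow> nat \<Rightarrow> (nat \<Rightarrow> nat \<Rightarrow> nat \<Rightarrow> real) \<Rightarrow> bool" where
  "recovery_fails d n P \<longleftrightarrow> (\<exists>(X :: nat \<Rightarrow> nat \<Rightarrow> real) (x :: nat \<Rightarrow> real).
      (\<forall>i<d. \<forall>l<d. X i l = X l i) \<and> (\<forall>v. 0 \<le> qform d X v) \<and>
      (\<forall>j<n. mat_pairing d (\<lambda>i l. X i l - x i * x l) (P j) = 0) \<and> (\<exists>i<d. \<exists>l<d. X i l \<noteq> x i * x l))"

text \<open>x x^T is always feasible, so uniqueness can fail only through another feasible X. The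
  nonzero factor d / k of the measurements cancels.\<close>

lemma unique_recovery_iff:
  assumes k: "0 < k" and d: "0 < d" and V: "\<And>j. j < n \<Longrightarrow> proj_mat d (V j) \<in> carrier_mat d d"
  shows "(\<forall>x\<in>carrier_vec d. feasible_set k d n V x = {outer_prod x})
    \<longleftrightarrow> \<not> recovery_fails d n (\<lambda>j i l. proj_mat d (V j) $$ (i, l))"
proof -
  let ?P = "\<lambda>j i l. proj_mat d (V j) $$ (i, l)"
  have outer: "outer_prod x \<in> carrier_mat d d" "\<And>i l. i < d \<Longrightarrow> l < d \<Longrightarrow> outer_prod x $$ (i, l) = x $ i * x $ l"
    if "x \<in> carrier_vec d" for x
    using that by (auto simp: outer_prod_def)
  have meas: "meas_map k d n V X = meas_map k d n V (outer_prod x)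
      \<longleftrightarrow> (\<forall>j<n. mat_pairing d (\<lambda>i l. X $$ (i, l) - x $ i * x $ l) (?P j) = 0)"
    if X: "X \<in> carrier_mat d d" and x: "x \<in> carrier_vec d" for X x
  proof -
    have "mat_pairing d (\<lambda>i l. X $$ (i, l) - x $ i * x $ l) (?P j)
        = mat_inner X (proj_mat d (V j)) - mat_inner (outer_prod x) (proj_mat d (V j))" if "j < n" for j
    proof -
      have "mat_pairing d (\<lambda>i l. X $$ (i, l) - x $ i * x $ l) (?P j)
          = mat_pairing d (\<lambda>i l. X $$ (i, l) - outer_prod x $$ (i, l)) (?P j)"
        unfolding mat_pairing_def by (intro sum.cong refl) (simp add: outer[OF x])
      then show ?thesis using V[OF that] X outer(1)[OF x] by (simp add: mat_pairing_diff mat_inner_eq_mat_pairing)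
    qed
    moreover have "meas_map k d n V X = meas_map k d n V (outer_prod x)
        \<longleftrightarrow> (\<forall>j<n. mat_inner X (proj_mat d (V j)) = mat_inner (outer_prod x) (proj_mat d (V j)))"
      using k d by (auto simp: meas_map_def vec_eq_iff)
    ultimately show ?thesis by auto
  qed
  have outer_feasible: "outer_prod x \<in> feasible_set k d n V x" if x: "x \<in> carrier_vec d" for x
  proof -
    have "qform d (\<lambda>i l. outer_prod x $$ (i, l)) v = (\<Sum>i<d. x $ i * v i)\<^sup>2" for v
      unfolding qform_rank_one[symmetric] qform_def by (intro sum.cong refl) (simp add: outer[OF x])
    then have "psd (outer_prod x)" by (simp add: psd_iff_qform[OF outer(1)[OF x]])
    moreover have "outer_prod x \<in> sym_mats d"
      using outer[OF x] by (auto simp: sym_mats_def mult.commute intro!: eq_matI)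
    ultimately show ?thesis by (simp add: feasible_set_def)
  qed
  show ?thesis
  proof
    assume unique: "\<forall>x\<in>carrier_vec d. feasible_set k d n V x = {outer_prod x}"
    show "\<not> recovery_fails d n ?P"
    proof
      assume "recovery_fails d n ?P"
      then obtain X :: "nat \<Rightarrow> nat \<Rightarrow> real" and x :: "nat \<Rightarrow> real" where X: "\<forall>i<d. \<forall>l<d. X i l = X l i" "\<forall>v. 0 \<le> qform d X v"
        and zero: "\<forall>j<n. mat_pairing d (\<lambda>i l. X i l - x i * x l) (?P j) = 0" and ne: "\<exists>i<d. \<exists>l<d. X i l \<noteq> x i * x l"
        unfolding recovery_fails_def by blast
      define Y where "Y = Matrix.mat d d (\<lambda>(i, l). X i l)"
      define y where "y = Matrix.vec d x"
      have Y: "Y \<in> carrier_mat d d" "Y \<in> sym_mats d" using X(1) by (auto simp: Y_def sym_mats_def intro!: eq_matI)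
      have y: "y \<in> carrier_vec d" by (simp add: y_def)
      have "qform d (\<lambda>i l. Y $$ (i, l)) v = qform d X v" for v
        unfolding qform_def by (intro sum.cong refl) (simp add: Y_def)
      then have "psd Y" using X(2) by (simp add: psd_iff_qform[OF Y(1)])
      moreover have "mat_pairing d (\<lambda>i l. Y $$ (i, l) - y $ i * y $ l) (?P j) = mat_pairing d (\<lambda>i l. X i l - x i * x l) (?P j)" for j
        unfolding mat_pairing_def by (intro sum.cong refl) (simp add: Y_def y_def)
      then have "meas_map k d n V Y = meas_map k d n V (outer_prod y)" using zero by (simp add: meas[OF Y(1) y])
      ultimately have "Y \<in> feasible_set k d n V y" using Y by (simp add: feasible_set_def)
      then have "Y = outer_prod y" using unique y by blast
      then have "X i l = x i * x l" if "i < d" "l < d" for i l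
      proof -
        have "X i l = Y $$ (i, l)" using that by (simp add: Y_def)
        also have "\<dots> = y $ i * y $ l" unfolding \<open>Y = outer_prod y\<close> by (rule outer(2)[OF y that])
        finally show ?thesis using that by (simp add: y_def)
      qed
      then show False using ne by blast
    qed
  next
    assume ok: "\<not> recovery_fails d n ?P"
    show "\<forall>x\<in>carrier_vec d. feasible_set k d n V x = {outer_prod x}"
    proof
      fix x :: "real vec" assume x: "x \<in> carrier_vec d"
      have "X = outer_prod x" if "X \<in> feasible_set k d n V x" for X
      proof -
        have X: "X \<in> carrier_mat d d" "transpose_mat X = X" "psd X" "meas_map k d n V X = meas_map k d n V (outer_prod x)"
          using that by (auto simp: feasible_set_def sym_mats_def)
        have sym: "\<forall>i<d. \<forall>l<d. X $$ (i, l) = X $$ (l, i)"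
        proof (intro allI impI)
          fix i l assume "i < d" "l < d"
          then have "transpose_mat X $$ (i, l) = X $$ (l, i)" using X(1) by simp
          then show "X $$ (i, l) = X $$ (l, i)" unfolding X(2) .
        qed
        have "recovery_fails d n ?P" if ne: "\<exists>i<d. \<exists>l<d. X $$ (i, l) \<noteq> x $ i * x $ l"
          unfolding recovery_fails_def
          by (rule exI[of _ "\<lambda>i l. X $$ (i, l)"], rule exI[of _ "\<lambda>i. x $ i"], intro conjI sym ne
              X(3)[unfolded psd_iff_qform[OF X(1)]] X(4)[unfolded meas[OF X(1) x]])
        then have "\<not> (\<exists>i<d. \<exists>l<d. X $$ (i, l) \<noteq> x $ i * x $ l)" using ok by blast
        then show ?thesis using X(1) outer[OF x] by (intro eq_matI) auto
      qed
      then show "feasible_set k d n V x = {outer_prod x}" using outer_feasible[OF x] by blast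
    qed
  qed
qed

section \<open>Transfer from the orthogonal group to the Grassmannian\<close>

context haar_subspace
begin

text \<open>The \<sigma>-algebra of the Grassmannian is pulled back along \<open>proj_mat\<close>,
  so it suffices that the projector depends measurably on U.\<close>

lemma measurable_rotated_subspace: "rotated_subspace k d \<in> measurable \<mu> (grassmann_space k d)"
  unfolding grassmann_space_def
proof (rule measurable_vimage_algebra2)
  show "rotated_subspace k d \<in> space \<mu> \<rightarrow> grassmannian k d"
    using k_less by (auto intro!: rotated_subspace_in_grassmannian)
  show "(\<lambda>U. proj_mat d (rotated_subspace k d U)) \<in> measurable \<mu> (borel_mat d)"
  proof (rule measurable_borel_matI)
    show "(\<lambda>U. proj_mat d (rotated_subspace k d U)) \<in> space \<mu> \<rightarrow> carrier_mat d d"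
      using k_less by (auto simp: proj_mat_rotated_subspace)
    fix i l assume il: "i < d" "l < d"
    have "(\<lambda>U. column_proj k U i l) \<in> borel_measurable \<mu>"
      unfolding column_proj_def using il k_less
      by (intro borel_measurable_sum borel_measurable_times measurable_entry) auto
    moreover have "proj_mat d (rotated_subspace k d U) $$ (i, l) = column_proj k U i l" if "U \<in> space \<mu>" for U
      using that il k_less by (simp add: proj_mat_rotated_subspace)
    ultimately show "(\<lambda>U. proj_mat d (rotated_subspace k d U) $$ (i, l)) \<in> borel_measurable \<mu>"
      by (subst measurable_cong) auto
  qed
qed

lemma grassmann_measure_eq: "grassmann_measure k d \<mu> = distr \<mu> (grassmann_space k d) (rotated_subspace k d)"
  by (simp add: grassmann_measure_def rotated_subspace_def[abs_def])

lemma space_grassmann_measure: "space (grassmann_measure k d \<mu>) = grassmannian k d"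
  by (simp add: grassmann_measure_def grassmann_space_def)

lemma measurable_proj_mat_entry:
  assumes "i < d" "l < d"
  shows "(\<lambda>W. proj_mat d W $$ (i, l)) \<in> borel_measurable (grassmann_measure k d \<mu>)"
proof -
  have "proj_mat d \<in> measurable (grassmann_space k d) (borel_mat d)"
    unfolding grassmann_space_def
    by (rule measurable_vimage_algebra1) (auto simp: grassmannian_def intro!: proj_mat_carrier)
  then have "(\<lambda>W. proj_mat d W $$ (i, l)) \<in> borel_measurable (grassmann_space k d)"
    by (rule measurable_compose[OF _ measurable_mat_entry[OF assms]])
  then show ?thesis by (simp add: grassmann_measure_def)
qed

text \<open>A product of image measures is the image of the product, so independent random subspaces
  may be sampled through independent orthogonal matrices. \<open>compose\<close> keeps the tuples
  extensional.\<close>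

lemma product_grassmann_measure_eq:
  fixes n :: nat
  shows "Pi\<^sub>M {..<n} (\<lambda>_. grassmann_measure k d \<mu>)
    = distr (Pi\<^sub>M {..<n} (\<lambda>_. \<mu>)) (Pi\<^sub>M {..<n} (\<lambda>_. grassmann_measure k d \<mu>)) (compose {..<n} (rotated_subspace k d))"
proof -
  let ?\<nu> = "grassmann_measure k d \<mu>"
  have m: "rotated_subspace k d \<in> measurable \<mu> ?\<nu>"
    using measurable_rotated_subspace by (simp add: grassmann_measure_eq)
  have "prob_space ?\<nu>"
    unfolding grassmann_measure_eq by (rule prob_space_distr[OF measurable_rotated_subspace])
  then have "distr (Pi\<^sub>M {..<n} (\<lambda>_. \<mu>)) (Pi\<^sub>M {..<n} (\<lambda>_. ?\<nu>)) (compose {..<n} (rotated_subspace k d))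
      = Pi\<^sub>M {..<n} (\<lambda>_. distr \<mu> ?\<nu> (rotated_subspace k d))"
    using m prob_space_axioms by (intro distr_PiM_finite_prob_space') auto
  also have "distr \<mu> ?\<nu> (rotated_subspace k d) = ?\<nu>"
    unfolding grassmann_measure_eq by (rule distr_cong) auto
  finally show ?thesis ..
qed

end

theorem theorem5p1:
  fixes k :: nat
  assumes "k \<ge> 1"
  shows "\<exists>c\<^sub>1 c\<^sub>2 :: real. c\<^sub>1 > 0 \<and> c\<^sub>2 > 0 \<and>
    (\<forall>(d::nat) (n::nat) (\<mu> :: real mat measure).
       d > k \<longrightarrow> real n \<ge> c\<^sub>1 * real d \<longrightarrow> haar_orthogonal d \<mu> \<longrightarrow>
       \<P>(V in Pi\<^sub>M {..<n} (\<lambda>_. grassmann_measure k d \<mu>).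
          \<forall>x\<in>carrier_vec d. feasible_set k d n V x = {outer_prod x}) \<ge> 1 - exp (- c\<^sub>2 * real n))"
proof -
  obtain \<phi> :: "real \<Rightarrow> real" where "whp k (\<lambda>d \<mu> n \<omega>. separates \<phi> k d n \<omega>)"
    by (rule whp_separation[OF assms])
  then have "whp k (\<lambda>d \<mu> n \<omega>. \<not> recovery_fails d n (\<lambda>j. column_proj k (\<omega> j)))"
  proof (rule whp_mono)
    fix d \<mu> and n :: nat and \<omega> :: "nat \<Rightarrow> real mat"
    assume hs: "haar_subspace k d \<mu>" and sep: "separates \<phi> k d n \<omega>"
    interpret haar_subspace k d \<mu> by fact
    show "\<not> recovery_fails d n (\<lambda>j. column_proj k (\<omega> j))"
    proof
      assume "recovery_fails d n (\<lambda>j. column_proj k (\<omega> j))"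
      then obtain X :: "nat \<Rightarrow> nat \<Rightarrow> real" and x :: "nat \<Rightarrow> real" where
        sym: "\<And>i l. i < d \<Longrightarrow> l < d \<Longrightarrow> X i l = X l i" and psd: "\<And>v. 0 \<le> qform d X v"
        and zero: "\<And>j. j < n \<Longrightarrow> mat_pairing d (\<lambda>i l. X i l - x i * x l) (column_proj k (\<omega> j)) = 0"
        and ne: "\<exists>i<d. \<exists>l<d. X i l \<noteq> x i * x l"
        unfolding recovery_fails_def by blast
      have "X i l - x i * x l = 0" if "i < d" "l < d" for i l
      proof (rule separation_imp_zero[OF _ _ sep, where H = "\<lambda>i l. X i l - x i * x l" and x = x])
        show "0 < k" "0 < d" using k_pos k_less by auto
        show "X i l - x i * x l = X l i - x l * x i" if "i < d" "l < d" for i l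
          using sym[OF that] by simp
        show "0 \<le> qform d (\<lambda>i l. X i l - x i * x l) v + (\<Sum>i<d. x i * v i)\<^sup>2" for v
          using psd[of v] by (simp add: qform_diff qform_rank_one)
      qed (use that zero in auto)
      then show False using ne by auto
    qed
  qed
  then obtain c\<^sub>1 c\<^sub>2 :: real where c: "c\<^sub>1 > 0" "c\<^sub>2 > 0"
    and good: "\<And>d \<mu> n. haar_subspace k d \<mu> \<Longrightarrow> c\<^sub>1 * real d \<le> real n \<Longrightarrow>
      \<exists>G\<in>sets (Pi\<^sub>M {..<n} (\<lambda>_. \<mu>)). 1 - exp (- c\<^sub>2 * real n) \<le> measure (Pi\<^sub>M {..<n} (\<lambda>_. \<mu>)) G \<and>
        (\<forall>\<omega>\<in>G. \<not> recovery_fails d n (\<lambda>j. column_proj k (\<omega> j)))"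
    by (rule whpE) (rule that)
  show ?thesis
  proof (rule exI[of _ c\<^sub>1], rule exI[of _ c\<^sub>2], intro conjI c allI impI)
    fix d n :: nat and \<mu> :: "real mat measure"
    assume "k < d" and n: "c\<^sub>1 * real d \<le> real n" and "haar_orthogonal d \<mu>"
    then have hs: "haar_subspace k d \<mu>" using assms by (simp add: haar_subspace_def)
    interpret haar_subspace k d \<mu> by fact
    let ?P = "Pi\<^sub>M {..<n} (\<lambda>_. \<mu>)" and ?Q = "Pi\<^sub>M {..<n} (\<lambda>_. grassmann_measure k d \<mu>)"
    let ?f = "compose {..<n} (rotated_subspace k d)"
    interpret P: prob_space ?P by (rule haar_subspace_product_prob_space[OF hs])
    define E where "E = {V \<in> space ?Q. \<forall>x\<in>carrier_vec d. feasible_set k d n V x = {outer_prod x}}"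
    have proj: "proj_mat d (V j) \<in> carrier_mat d d" if "V \<in> space ?Q" "j < n" for V j
      using that by (auto simp: space_PiM space_grassmann_measure grassmannian_def intro!: proj_mat_carrier)
    have recovery: "(\<forall>x\<in>carrier_vec d. feasible_set k d n V x = {outer_prod x})
        \<longleftrightarrow> \<not> recovery_fails d n (\<lambda>j i l. proj_mat d (V j) $$ (i, l))" if "V \<in> space ?Q" for V
      by (rule unique_recovery_iff) (use k_pos k_less proj[OF that] in auto)
    \<comment> \<open>Here a good subset is not enough: the probability in the conclusion is that of
      the event itself, which must belong to the \<sigma>-algebra.\<close>
    have "{V \<in> space ?Q. recovery_fails d n (\<lambda>j i l. proj_mat d (V j) $$ (i, l))} \<in> sets ?Q"
      unfolding recovery_fails_def
    proof (rule measurable_recovery_failure)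
      fix j i l assume "j < n" and il: "i < d" "l < d"
      then have "(\<lambda>V. V j) \<in> measurable ?Q (grassmann_measure k d \<mu>)"
        using measurable_component_singleton[of j "{..<n}" "\<lambda>_. grassmann_measure k d \<mu>"] by simp
      from measurable_compose[OF this measurable_proj_mat_entry[OF il]]
      show "(\<lambda>V. proj_mat d (V j) $$ (i, l)) \<in> borel_measurable ?Q" .
    qed
    moreover have "E = space ?Q - {V \<in> space ?Q. recovery_fails d n (\<lambda>j i l. proj_mat d (V j) $$ (i, l))}"
      unfolding E_def using recovery by blast
    ultimately have E: "E \<in> sets ?Q" by auto
    have f: "?f \<in> measurable ?P ?Q"
    proof (rule measurable_PiM_single')
      show "(\<lambda>\<omega>. ?f \<omega> j) \<in> measurable ?P (grassmann_measure k d \<mu>)" if "j \<in> {..<n}" for j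
      proof -
        have rot: "rotated_subspace k d \<in> measurable \<mu> (grassmann_measure k d \<mu>)"
          using measurable_rotated_subspace by (simp add: grassmann_measure_eq)
        have "(\<lambda>\<omega>. \<omega> j) \<in> measurable ?P \<mu>"
          using that measurable_component_singleton[of j "{..<n}" "\<lambda>_. \<mu>"] by simp
        from measurable_compose[OF this rot]
        have "(\<lambda>\<omega>. rotated_subspace k d (\<omega> j)) \<in> measurable ?P (grassmann_measure k d \<mu>)" .
        then show ?thesis using that by (simp add: compose_def)
      qed
      show "?f \<in> space ?P \<rightarrow> {..<n} \<rightarrow>\<^sub>E space (grassmann_measure k d \<mu>)"
        using k_less rotated_subspace_in_grassmannian
        by (auto simp: space_PiM space_grassmann_measure compose_def PiE_iff extensional_def)
    qed
    obtain G where G: "G \<in> sets ?P" "1 - exp (- c\<^sub>2 * real n) \<le> measure ?P G"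
      "\<And>\<omega>. \<omega> \<in> G \<Longrightarrow> \<not> recovery_fails d n (\<lambda>j. column_proj k (\<omega> j))"
      using good[OF hs n] by blast
    have "G \<subseteq> ?f -` E \<inter> space ?P"
    proof
      fix \<omega> assume \<omega>: "\<omega> \<in> G"
      then have sp: "\<omega> \<in> space ?P" using sets.sets_into_space[OF G(1)] by blast
      then have fsp: "?f \<omega> \<in> space ?Q" using f by (rule measurable_space[rotated])
      have "proj_mat d (?f \<omega> j) $$ (i, l) = column_proj k (\<omega> j) i l" if "j < n" "i < d" "l < d" for j i l
        using sp that k_less by (simp add: compose_def space_PiM PiE_iff proj_mat_rotated_subspace)
      then have "mat_pairing d H (\<lambda>i l. proj_mat d (?f \<omega> j) $$ (i, l)) = mat_pairing d H (column_proj k (\<omega> j))" if "j < n" for j H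
        using that unfolding mat_pairing_def by (intro sum.cong refl) simp
      then have "\<not> recovery_fails d n (\<lambda>j i l. proj_mat d (?f \<omega> j) $$ (i, l))"
        using G(3)[OF \<omega>] unfolding recovery_fails_def by simp
      then show "\<omega> \<in> ?f -` E \<inter> space ?P"
        using sp fsp recovery[OF fsp] by (simp add: E_def)
    qed
    then have "measure ?P G \<le> measure ?P (?f -` E \<inter> space ?P)"
      using f E by (intro P.finite_measure_mono measurable_sets)
    also have "\<dots> = measure (distr ?P ?Q ?f) E" by (rule measure_distr[symmetric, OF f E])
    also have "\<dots> = measure ?Q E" by (simp only: product_grassmann_measure_eq[symmetric])
    finally show "1 - exp (- c\<^sub>2 * real n) \<le> \<P>(V in ?Q. \<forall>x\<in>carrier_vec d. feasible_set k d n V x = {outer_prod x})"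
      using G(2) by (simp add: E_def)
  qed
qed

end
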